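(* Let $N\ge 1$ and let $\Gamma$ be $\Gamma_0(N)$ or an Atkin--Lehner extension of $\Gamma_0(N)$ such that the associated modular curve $X(\Gamma)$ is of genus zero. Let $\mathcal{O}\subset\mathbb{C}$ be a subring. Suppose that $t=t(\tau)\in q+q^{2}\mathcal{O}[[q]]$, with $q=\exp(2\pi i\tau)$, is a uniformizer (Hauptmodul) of $X(\Gamma)$ with a unique zero at the cusp $[i\infty]$ and a unique pole at a point $[\tau_0]\in X(\Gamma)$. Let $Z=Z(\tau)\in 1+q\mathcal{O}[[q]]$ be a holomorphic modular form of weight $1$ for $\Gamma$ with a multiplier, having a unique zero, supported at $[\tau_0]$, of order smaller than or equal to $1$. Suppose that $Z^2$ is a modular form of weight $2$ for $\Gamma$ with a quadratic character $\chi$ that is trivial on $\Gamma_0(N)$. Define the sequence $\{T(n)\}_{n\ge0}$ by $$\sum_{n=0}^{\infty}T(n)t^n=Z.$$ Then $\{T(n)\}$ satisfies the Lucas congruences modulo any prime $p$ such that $\mathcal{O}$ can be embedded into the ring $\mathbb{Z}_p$ of $p$-adic integers, provided $p$ satisfies one of the following conditions: (1) $p=2$; (2) $p\equiv1\pmod 4$ and $\left(\frac{d}{p}\right)=1$ or $0$ for every Hall divisor $d$ of $\Gamma$; (3) $p\equiv-1\pmod 4$ and $\chi(w_d)\left(\frac{d}{p}\right)=1$ or $0$ for every Hall divisor $d$ of $\Gamma$; where $w_d$ is the Atkin--Lehner involution and $\left(\frac{\cdot}{p}\right)$ is the Legendre symbol.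
   Context: Modular forms: for $\gamma=\begin{pmatrix}a&b\\c&d\end{pmatrix}\in \mathrm{GL}_2^+(\mathbb{R})$ and $F:\mathbb{H}\to\mathbb{C}$, put $F|_k\gamma(\tau)=\det(\gamma)^{k/2}(c\tau+d)^{-k}F(\gamma\tau)$. $F$ is a modular form of weight $k$ with multiplier $\chi$ for a discrete subgroup $\Gamma\subset\mathrm{GL}_2^+(\mathbb{R})$ if $F|_k\gamma=\chi(\gamma)F$ for all $\gamma\in\Gamma$, where $\chi:\Gamma\to\mathbb{C}$ has $|\chi(\gamma)|=1$ (with the usual holomorphy conditions on $\mathbb{H}$ and at the cusps). Atkin--Lehner extensions: a Hall divisor $e$ of $N$ is a divisor with $\gcd(e,N/e)=1$ (written $e\| N$). The Atkin--Lehner involution is $w_e=\begin{pmatrix}a_e&b_e\\c_eN&d_e\end{pmatrix}$ with $a_e,b_e,c_e,d_e\in\mathbb{Z}$, $e\mid a_e$, $e\mid d_e$ and $\det w_e=e$. For a set $S$ of Hall divisors of $N$, the group $\Gamma_0(N)+S=\langle \Gamma_0(N), w_e : e\in S\rangle$ is called an Atkin--Lehner extension of $\Gamma_0(N)$. A Hall divisor of $\Gamma$ is a Hall divisor $d$ of $N$ whose Atkin--Lehner involution $w_d$ belongs to $\Gamma$ (up to scalar matrices); since $\chi$ is trivial on $\Gamma_0(N)$, $\chi(w_d)\in\{\pm1\}$, characterized by $Z^2|_2w_d=\chi(w_d)Z^2$, does not depend on the choice of $w_d$. $X(\Gamma)$ is the compactified quotient of $\mathbb{H}$ by $\Gamma$;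 $[\tau]$ denotes the class of a point or cusp $\tau$ in $X(\Gamma)$ (the point $[\tau_0]$ may be a cusp). A uniformizer of $X(\Gamma)$ is a modular function for $\Gamma$ giving an isomorphism of $X(\Gamma)$ with the projective line. The order of vanishing of $Z$ at a point of $X(\Gamma)$ is measured with respect to a local parameter of $X(\Gamma)$ at that point, so it may be fractional. The identity $\sum T(n)t^n=Z$ is one of power series in $q$; it determines $T(n)\in\mathcal{O}$ uniquely. Lucas congruences: $\{T(n)\}$ satisfies the Lucas congruences modulo a prime $p$ if for every $n\ge0$ with base-$p$ expansion $n=n_0+n_1p+\cdots+n_sp^s$, $0\le n_i\le p-1$, one has $T(n)\equiv T(n_0)T(n_1)\cdots T(n_s)\pmod p$. Here $\mathcal{O}$ is regarded as a subring of $\mathbb{Z}_p$ via an embedding (injective ring homomorphism) and the congruence is modulo $p\mathbb{Z}_p$. *)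

theory Defs
  imports
    "HOL-Complex_Analysis.Complex_Analysis"
    "HOL-Number_Theory.Number_Theory"
    "HOL-Algebra.Algebra"
    "HOL-Algebra.Algebraic_Closure_Type"
begin

section \<open>The group of real matrices of positive determinant and its actions\<close>

definition mat2 :: "real \<Rightarrow> real \<Rightarrow> real \<Rightarrow> real \<Rightarrow> real^2^2" where
  "mat2 a b c d = vector [vector [a, b], vector [c, d]]"

definition GL2_plus :: "(real^2^2) monoid" where
  "GL2_plus = \<lparr>carrier = {A. det A > 0}, mult = (**), one = mat 1\<rparr>"

lemma group_GL2_plus: "group GL2_plus"
proof (rule groupI)
  fix A assume "A \<in> carrier GL2_plus"
  then have A: "det A > 0" by (simp add: GL2_plus_def)
  then have inv: "invertible A" by (simp add: invertible_det_nz)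
  then have eq: "matrix_inv A ** A = mat 1"
    by (metis (mono_tags, lifting) invertible_def matrix_inv_def someI_ex)
  then have "det (matrix_inv A) * det A = 1"
    by (metis det_I det_mul)
  then have "det (matrix_inv A) > 0"
    using A by (metis zero_less_mult_pos2 zero_less_one)
  with eq show "\<exists>B\<in>carrier GL2_plus. B \<otimes>\<^bsub>GL2_plus\<^esub> A = \<one>\<^bsub>GL2_plus\<^esub>"
    by (auto simp: GL2_plus_def)
qed (auto simp: GL2_plus_def det_mul matrix_mul_assoc)

definition upper_half_plane :: "complex set" where
  "upper_half_plane = {\<tau>. Im \<tau> > 0}"

definition moebius :: "real^2^2 \<Rightarrow> complex \<Rightarrow> complex" where
  "moebius A \<tau> = (of_real (A$1$1) * \<tau> + of_real (A$1$2)) / (of_real (A$2$1) * \<tau> + of_real (A$2$2))"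

text \<open>The Riemann sphere is modelled by \<^typ>\<open>complex option\<close>, with \<^const>\<open>None\<close> as the point at infinity.\<close>

definition moebius_ext :: "real^2^2 \<Rightarrow> complex option \<Rightarrow> complex option" where
  "moebius_ext A x = (case x of
     None \<Rightarrow> if A$2$1 = 0 then None else Some (of_real (A$1$1 / A$2$1))
   | Some z \<Rightarrow> if of_real (A$2$1) * z + of_real (A$2$2) = 0 then None else Some (moebius A z))"

definition slash :: "int \<Rightarrow> (complex \<Rightarrow> complex) \<Rightarrow> real^2^2 \<Rightarrow> complex \<Rightarrow> complex" where
  "slash k F A \<tau> = of_real (det A powr (of_int k / 2))
     * (of_real (A$2$1) * \<tau> + of_real (A$2$2)) powi (- k) * F (moebius A \<tau>)"


section \<open>Atkin--Lehner extensions\<close>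

definition Gamma0 :: "nat \<Rightarrow> (real^2^2) set" where
  "Gamma0 N = {mat2 (of_int a) (of_int b) (of_int (c * int N)) (of_int d) |a b c d :: int.
     a * d - b * (c * int N) = 1}"

abbreviation SL2Z :: "(real^2^2) set" where
  "SL2Z \<equiv> Gamma0 1"

definition hall_divisor :: "nat \<Rightarrow> nat \<Rightarrow> bool" where
  "hall_divisor e N \<longleftrightarrow> e dvd N \<and> coprime e (N div e)"

text \<open>All admissible choices of the Atkin--Lehner matrix \<open>w\<^sub>e\<close>; for a Hall divisor \<open>e\<close> of \<open>N\<close>
  they form a single coset of \<open>\<Gamma>\<^sub>0(N)\<close>, so the group generated below is the same
  as with one matrix chosen for each \<open>e\<close>.\<close>

definition AL_matrices :: "nat \<Rightarrow> nat \<Rightarrow> (real^2^2) set" where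
  "AL_matrices N e = {mat2 (of_int a) (of_int b) (of_int (c * int N)) (of_int d) |a b c d :: int.
     a * d - b * (c * int N) = int e \<and> int e dvd a \<and> int e dvd d}"

definition AL_extension :: "nat \<Rightarrow> nat set \<Rightarrow> (real^2^2) set" where
  "AL_extension N S = generate GL2_plus (Gamma0 N \<union> (\<Union>e\<in>S. AL_matrices N e))"

definition hall_divisor_of_group :: "nat \<Rightarrow> (real^2^2) set \<Rightarrow> nat \<Rightarrow> bool" where
  "hall_divisor_of_group N \<Gamma> d \<longleftrightarrow>
     hall_divisor d N \<and> (\<exists>w\<in>AL_matrices N d. \<exists>r. r \<noteq> 0 \<and> r *\<^sub>R w \<in> \<Gamma>)"


section \<open>The modular curve of a group commensurable with the modular group\<close>

text \<open>The set of cusps of each group considered here is the projective line over the rationals, i.e.\ the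
  \<open>SL\<^sub>2(\<int>)\<close>-orbit of infinity.\<close>

definition extended_half_plane :: "complex option set" where
  "extended_half_plane = Some ` upper_half_plane \<union> Some ` range (of_rat :: rat \<Rightarrow> complex) \<union> {None}"

definition orbit_pt :: "(real^2^2) set \<Rightarrow> complex option \<Rightarrow> complex option set" where
  "orbit_pt \<Gamma> x = (\<lambda>A. moebius_ext A x) ` \<Gamma>"

definition modular_curve :: "(real^2^2) set \<Rightarrow> complex option set set" where
  "modular_curve \<Gamma> = orbit_pt \<Gamma> ` extended_half_plane"

definition half_plane_open :: "complex option set \<Rightarrow> bool" where
  "half_plane_open U \<longleftrightarrow> U \<subseteq> extended_half_plane
     \<and> open {z. Im z > 0 \<and> Some z \<in> U}
     \<and> (\<forall>A\<in>SL2Z. moebius_ext A None \<in> U \<longrightarrow>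
          (\<exists>Y>0. \<forall>\<tau>. Im \<tau> > Y \<longrightarrow> moebius_ext A (Some \<tau>) \<in> U))"

lemma half_plane_open_Int:
  assumes "half_plane_open U" "half_plane_open V"
  shows "half_plane_open (U \<inter> V)"
  unfolding half_plane_open_def
proof (intro conjI ballI impI)
  show "U \<inter> V \<subseteq> extended_half_plane"
    using assms by (auto simp: half_plane_open_def)
  have "{z. Im z > 0 \<and> Some z \<in> U \<inter> V} = {z. Im z > 0 \<and> Some z \<in> U} \<inter> {z. Im z > 0 \<and> Some z \<in> V}"
    by auto
  then show "open {z. Im z > 0 \<and> Some z \<in> U \<inter> V}"
    using assms by (auto simp: half_plane_open_def)
  fix A assume A: "A \<in> SL2Z" "moebius_ext A None \<in> U \<inter> V"
  then obtain Y where "Y > 0" "\<forall>\<tau>. Im \<tau> > Y \<longrightarrow> moebius_ext A (Some \<tau>) \<in> U"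
    using assms by (auto simp: half_plane_open_def)
  moreover from A obtain Y' where "Y' > 0" "\<forall>\<tau>. Im \<tau> > Y' \<longrightarrow> moebius_ext A (Some \<tau>) \<in> V"
    using assms by (auto simp: half_plane_open_def)
  ultimately show "\<exists>Y>0. \<forall>\<tau>. Im \<tau> > Y \<longrightarrow> moebius_ext A (Some \<tau>) \<in> U \<inter> V"
    by (intro exI[of _ "max Y Y'"]) auto
qed

lemma half_plane_open_Union:
  assumes "\<And>U. U \<in> \<U> \<Longrightarrow> half_plane_open U"
  shows "half_plane_open (\<Union>\<U>)"
  unfolding half_plane_open_def
proof (intro conjI ballI impI)
  show "\<Union>\<U> \<subseteq> extended_half_plane"
    using assms by (auto simp: half_plane_open_def)
  have "{z. Im z > 0 \<and> Some z \<in> \<Union>\<U>} = (\<Union>U\<in>\<U>. {z. Im z > 0 \<and> Some z \<in> U})"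
    by auto
  then show "open {z. Im z > 0 \<and> Some z \<in> \<Union>\<U>}"
    using assms by (auto simp: half_plane_open_def)
  fix A assume A: "A \<in> SL2Z" "moebius_ext A None \<in> \<Union>\<U>"
  then obtain U where U: "U \<in> \<U>" "moebius_ext A None \<in> U" by auto
  then obtain Y where "Y > 0" "\<forall>\<tau>. Im \<tau> > Y \<longrightarrow> moebius_ext A (Some \<tau>) \<in> U"
    using assms[OF U(1)] A(1) by (auto simp: half_plane_open_def)
  then show "\<exists>Y>0. \<forall>\<tau>. Im \<tau> > Y \<longrightarrow> moebius_ext A (Some \<tau>) \<in> \<Union>\<U>"
    using U(1) by auto
qed

text \<open>The quotient topology.\<close>

definition modular_curve_open :: "(real^2^2) set \<Rightarrow> complex option set set \<Rightarrow> bool" where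
  "modular_curve_open \<Gamma> V \<longleftrightarrow> V \<subseteq> modular_curve \<Gamma>
     \<and> half_plane_open {x\<in>extended_half_plane. orbit_pt \<Gamma> x \<in> V}"

lemma istopology_modular_curve_open: "istopology (modular_curve_open \<Gamma>)"
  unfolding istopology_def
proof (intro conjI allI impI)
  let ?pre = "\<lambda>V. {x\<in>extended_half_plane. orbit_pt \<Gamma> x \<in> V}"
  fix V W assume VW: "modular_curve_open \<Gamma> V" "modular_curve_open \<Gamma> W"
  have "?pre (V \<inter> W) = ?pre V \<inter> ?pre W" by auto
  then show "modular_curve_open \<Gamma> (V \<inter> W)"
    using VW half_plane_open_Int[of "?pre V" "?pre W"] by (auto simp: modular_curve_open_def)
next
  let ?pre = "\<lambda>V. {x\<in>extended_half_plane. orbit_pt \<Gamma> x \<in> V}"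
  fix \<V> assume \<V>: "\<forall>V\<in>\<V>. modular_curve_open \<Gamma> V"
  have "?pre (\<Union>\<V>) = \<Union>(?pre ` \<V>)" by auto
  moreover have "half_plane_open (\<Union>(?pre ` \<V>))"
    using \<V> by (intro half_plane_open_Union) (auto simp: modular_curve_open_def)
  ultimately show "modular_curve_open \<Gamma> (\<Union>\<V>)"
    using \<V> by (auto simp: modular_curve_open_def)
qed

definition modular_curve_topology :: "(real^2^2) set \<Rightarrow> complex option set topology" where
  "modular_curve_topology \<Gamma> = topology (modular_curve_open \<Gamma>)"

definition genus_zero :: "'a topology \<Rightarrow> bool" where
  "genus_zero M \<longleftrightarrow> M homeomorphic_space top_of_set (sphere (0 :: real^3) 1)"


section \<open>Behaviour at the cusps, orders on the modular curve\<close>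

definition at_ii_inf :: "complex filter" where
  "at_ii_inf = filtercomap Im at_top"

text \<open>The width of the cusp \<open>A \<infinity>\<close> (\<open>A \<in> SL\<^sub>2(\<int>)\<close>): the smallest positive translation in
  \<open>A\<inverse> \<Gamma> A\<close>, modulo scalars.\<close>

definition cusp_width :: "(real^2^2) set \<Rightarrow> real^2^2 \<Rightarrow> real" where
  "cusp_width \<Gamma> A =
     Inf {h. h > 0 \<and> (\<exists>r. r \<noteq> 0 \<and> A ** (r *\<^sub>R mat2 1 h 0 1) ** matrix_inv A \<in> \<Gamma>)}"

text \<open>With \<open>s = exp (2 \<pi> i \<tau> / h)\<close> the local parameter at the cusp \<open>A \<infinity>\<close>:
  \<open>F|\<^sub>k A = s\<^sup>\<alpha> g(s)\<close> with \<open>g\<close> analytic at 0. The exponent is real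
  because of the multiplier.\<close>

definition cusp_expansion ::
  "(real^2^2) set \<Rightarrow> int \<Rightarrow> (complex \<Rightarrow> complex) \<Rightarrow> real^2^2 \<Rightarrow> real \<Rightarrow> (complex \<Rightarrow> complex) \<Rightarrow> bool" where
  "cusp_expansion \<Gamma> k F A \<alpha> g \<longleftrightarrow> g analytic_on {0} \<and>
     (\<forall>\<^sub>F \<tau> in at_ii_inf. slash k F A \<tau> =
        exp (2 * pi * \<i> * of_real \<alpha> * \<tau> / of_real (cusp_width \<Gamma> A))
        * g (exp (2 * pi * \<i> * \<tau> / of_real (cusp_width \<Gamma> A))))"

definition elliptic_order :: "(real^2^2) set \<Rightarrow> complex \<Rightarrow> nat" where
  "elliptic_order \<Gamma> z = card (moebius_ext ` {A\<in>\<Gamma>. moebius A z = z})"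

text \<open>The order of \<open>F\<close> (of weight \<open>k\<close>) at the class of \<open>x\<close>, with respect to a local parameter of
  the modular curve.\<close>

definition order_at :: "(real^2^2) set \<Rightarrow> int \<Rightarrow> (complex \<Rightarrow> complex) \<Rightarrow> complex option \<Rightarrow> real" where
  "order_at \<Gamma> k F x =
     (if x \<in> Some ` upper_half_plane
      then of_int (zorder F (the x)) / of_nat (elliptic_order \<Gamma> (the x))
      else (THE \<alpha>. \<exists>A\<in>SL2Z. moebius_ext A None = x \<and> (\<exists>g. cusp_expansion \<Gamma> k F A \<alpha> g \<and> g 0 \<noteq> 0)))"


section \<open>Modular forms, modular functions, uniformizers\<close>

definition modular_form ::
  "(real^2^2) set \<Rightarrow> int \<Rightarrow> (real^2^2 \<Rightarrow> complex) \<Rightarrow> (complex \<Rightarrow> complex) \<Rightarrow> bool" where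
  "modular_form \<Gamma> k chi F \<longleftrightarrow>
     (\<forall>A\<in>\<Gamma>. norm (chi A) = 1) \<and>
     (\<forall>A\<in>\<Gamma>. \<forall>\<tau>\<in>upper_half_plane. slash k F A \<tau> = chi A * F \<tau>) \<and>
     F holomorphic_on upper_half_plane \<and>
     (\<forall>A\<in>SL2Z. \<exists>\<alpha>\<ge>0. \<exists>g. cusp_expansion \<Gamma> k F A \<alpha> g)"

definition quadratic_character :: "(real^2^2) set \<Rightarrow> (real^2^2 \<Rightarrow> complex) \<Rightarrow> bool" where
  "quadratic_character \<Gamma> chi \<longleftrightarrow>
     (\<forall>A\<in>\<Gamma>. chi A \<in> {1, -1}) \<and> (\<forall>A\<in>\<Gamma>. \<forall>B\<in>\<Gamma>. chi (A ** B) = chi A * chi B)"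

definition modular_function :: "(real^2^2) set \<Rightarrow> (complex \<Rightarrow> complex) \<Rightarrow> bool" where
  "modular_function \<Gamma> f \<longleftrightarrow>
     f nicely_meromorphic_on upper_half_plane \<and>
     (\<forall>A\<in>\<Gamma>. \<forall>\<tau>\<in>upper_half_plane. f (moebius A \<tau>) = f \<tau>) \<and>
     (\<forall>A\<in>SL2Z. \<exists>\<alpha> g. cusp_expansion \<Gamma> 0 f A \<alpha> g)"

text \<open>The value of a modular function on the Riemann sphere; at a cusp it is the limit.\<close>

definition sphere_value :: "(complex \<Rightarrow> complex) \<Rightarrow> complex option \<Rightarrow> complex option" where
  "sphere_value f x =
     (if x \<in> Some ` upper_half_plane
      then (if is_pole f (the x) then None else Some (f (the x)))
      else if \<exists>A\<in>SL2Z. moebius_ext A None = x \<and> filterlim (\<lambda>\<tau>. f (moebius A \<tau>)) at_infinity at_ii_inf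
      then None
      else Some (THE c. \<exists>A\<in>SL2Z. moebius_ext A None = x \<and> ((\<lambda>\<tau>. f (moebius A \<tau>)) \<longlongrightarrow> c) at_ii_inf))"

text \<open>The induced map to the Riemann sphere is bijective, and biholomorphic near each
  point: \<open>f - f(x)\<close>, resp.\ \<open>1 / f\<close> at a pole, is itself a local parameter at \<open>x\<close>.
  Values on orbits are single by invariance, hence \<^const>\<open>the_elem\<close>.\<close>

definition uniformizer :: "(real^2^2) set \<Rightarrow> (complex \<Rightarrow> complex) \<Rightarrow> bool" where
  "uniformizer \<Gamma> f \<longleftrightarrow> modular_function \<Gamma> f \<and>
     bij_betw (\<lambda>P. the_elem (sphere_value f ` P)) (modular_curve \<Gamma>) (UNIV :: complex option set) \<and>
     (\<forall>x\<in>extended_half_plane.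
        case sphere_value f x of
          None \<Rightarrow> order_at \<Gamma> 0 f x = -1
        | Some c \<Rightarrow> order_at \<Gamma> 0 (\<lambda>\<tau>. f \<tau> - c) x = 1)"

definition has_q_expansion :: "(complex \<Rightarrow> complex) \<Rightarrow> complex fps \<Rightarrow> bool" where
  "has_q_expansion f F \<longleftrightarrow>
     (\<forall>\<^sub>F \<tau> in at_ii_inf. (\<lambda>n. fps_nth F n * exp (2 * pi * \<i> * \<tau>) ^ n) sums f \<tau>)"


section \<open>The ring of p-adic integers and Lucas congruences\<close>

text \<open>The inverse limit of the rings \<open>\<int>/p\<^sup>n\<close>, with residues represented in \<open>{0..<p\<^sup>n}\<close>.\<close>

definition padic_int_ring :: "nat \<Rightarrow> (nat \<Rightarrow> int) ring" where
  "padic_int_ring p =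
     \<lparr>carrier = {x. \<forall>n. x n \<in> {0..<int p ^ n} \<and> x (Suc n) mod int p ^ n = x n},
      monoid.mult = (\<lambda>x y n. (x n * y n) mod int p ^ n),
      one = (\<lambda>n. 1 mod int p ^ n),
      ring.zero = (\<lambda>n. 0),
      add = (\<lambda>x y n. (x n + y n) mod int p ^ n)\<rparr>"

lemma padic_reduce:
  assumes "x \<in> carrier (padic_int_ring p)"
  shows "x n mod int p ^ n = x n" "x (Suc n) mod int p ^ n = x n"
  using assms by (auto simp: padic_int_ring_def)

lemma padic_closedI:
  assumes p: "p > 0" and g: "\<And>n. [g (Suc n) = g n] (mod int p ^ n)"
  shows "(\<lambda>n. g n mod int p ^ n) \<in> carrier (padic_int_ring p)"
  using p g by (auto simp: padic_int_ring_def cong_def mod_mod_cancel)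

lemma padic_cong:
  assumes "x \<in> carrier (padic_int_ring p)"
  shows "[x (Suc n) = x n] (mod int p ^ n)"
  using padic_reduce[OF assms] by (simp add: cong_def)

lemma padic_int_ring_cring:
  assumes p: "p > 0"
  shows "cring (padic_int_ring p)"
proof (rule cringI)
  let ?R = "padic_int_ring p"
  have add: "x \<oplus>\<^bsub>?R\<^esub> y = (\<lambda>n. (x n + y n) mod int p ^ n)" for x y
    by (simp add: padic_int_ring_def)
  have mult: "x \<otimes>\<^bsub>?R\<^esub> y = (\<lambda>n. (x n * y n) mod int p ^ n)" for x y
    by (simp add: padic_int_ring_def)
  have zero: "\<zero>\<^bsub>?R\<^esub> = (\<lambda>n. 0)" and one: "\<one>\<^bsub>?R\<^esub> = (\<lambda>n. 1 mod int p ^ n)"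
    by (simp_all add: padic_int_ring_def)
  show "abelian_group ?R"
  proof (rule abelian_groupI)
    show "\<zero>\<^bsub>?R\<^esub> \<in> carrier ?R" using p by (simp add: padic_int_ring_def)
    fix x assume x: "x \<in> carrier ?R"
    show "\<zero>\<^bsub>?R\<^esub> \<oplus>\<^bsub>?R\<^esub> x = x" by (simp add: add zero padic_reduce[OF x])
    have "(\<lambda>n. (- x n) mod int p ^ n) \<in> carrier ?R"
      by (intro padic_closedI p) (simp add: cong_minus_minus_iff padic_cong x)
    then show "\<exists>y\<in>carrier ?R. y \<oplus>\<^bsub>?R\<^esub> x = \<zero>\<^bsub>?R\<^esub>"
      by (rule rev_bexI) (simp add: add zero mod_simps)
    fix y assume y: "y \<in> carrier ?R"
    show "x \<oplus>\<^bsub>?R\<^esub> y \<in> carrier ?R"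
      unfolding add by (intro padic_closedI p cong_add padic_cong x y)
    show "x \<oplus>\<^bsub>?R\<^esub> y = y \<oplus>\<^bsub>?R\<^esub> x" by (simp add: add add.commute)
    fix z assume "z \<in> carrier ?R"
    show "x \<oplus>\<^bsub>?R\<^esub> y \<oplus>\<^bsub>?R\<^esub> z = x \<oplus>\<^bsub>?R\<^esub> (y \<oplus>\<^bsub>?R\<^esub> z)"
      by (simp add: add mod_simps add.assoc)
  qed
  show "comm_monoid ?R"
  proof (rule comm_monoidI)
    show "\<one>\<^bsub>?R\<^esub> \<in> carrier ?R" unfolding one by (intro padic_closedI p) simp
    fix x assume x: "x \<in> carrier ?R"
    show "\<one>\<^bsub>?R\<^esub> \<otimes>\<^bsub>?R\<^esub> x = x" by (simp add: mult one mod_simps padic_reduce[OF x])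
    fix y assume y: "y \<in> carrier ?R"
    show "x \<otimes>\<^bsub>?R\<^esub> y \<in> carrier ?R"
      unfolding mult by (intro padic_closedI p cong_mult padic_cong x y)
    show "x \<otimes>\<^bsub>?R\<^esub> y = y \<otimes>\<^bsub>?R\<^esub> x" by (simp add: mult mult.commute)
    fix z assume "z \<in> carrier ?R"
    show "x \<otimes>\<^bsub>?R\<^esub> y \<otimes>\<^bsub>?R\<^esub> z = x \<otimes>\<^bsub>?R\<^esub> (y \<otimes>\<^bsub>?R\<^esub> z)"
      by (simp add: mult mod_simps mult.assoc)
  qed
  fix x y z assume "x \<in> carrier ?R" "y \<in> carrier ?R" "z \<in> carrier ?R"
  show "(x \<oplus>\<^bsub>?R\<^esub> y) \<otimes>\<^bsub>?R\<^esub> z = x \<otimes>\<^bsub>?R\<^esub> z \<oplus>\<^bsub>?R\<^esub> y \<otimes>\<^bsub>?R\<^esub> z"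
    by (simp add: add mult mod_simps distrib_right)
qed

definition padic_cong_mod_p :: "nat \<Rightarrow> (nat \<Rightarrow> int) \<Rightarrow> (nat \<Rightarrow> int) \<Rightarrow> bool" where
  "padic_cong_mod_p p x y \<longleftrightarrow>
     x \<ominus>\<^bsub>padic_int_ring p\<^esub> y
       \<in> PIdl\<^bsub>padic_int_ring p\<^esub> ([p] \<cdot>\<^bsub>padic_int_ring p\<^esub> \<one>\<^bsub>padic_int_ring p\<^esub>)"

definition lucas_congruences :: "nat \<Rightarrow> (nat \<Rightarrow> (nat \<Rightarrow> int)) \<Rightarrow> bool" where
  "lucas_congruences p a \<longleftrightarrow>
     (\<forall>n s ns. (\<forall>i\<le>s. ns i \<le> p - 1) \<and> n = (\<Sum>i\<le>s. ns i * p ^ i) \<longrightarrow>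
        padic_cong_mod_p p (a n) (\<Otimes>\<^bsub>padic_int_ring p\<^esub>i\<in>{..s}. a (ns i)))"

text \<open>An injective ring homomorphism from the subring \<open>R\<close> of the complex numbers to the
  p-adic integers; values outside \<open>R\<close> are irrelevant.\<close>

definition padic_embedding :: "complex set \<Rightarrow> nat \<Rightarrow> (complex \<Rightarrow> (nat \<Rightarrow> int)) \<Rightarrow> bool" where
  "padic_embedding R p \<phi> \<longleftrightarrow>
     \<phi> \<in> ring_hom (ring_of_type_algebra\<lparr>carrier := R\<rparr>) (padic_int_ring p) \<and> inj_on \<phi> R"

end

theory Submission
  imports Defs
begin

text \<open>Put \<open>k = (p - 1) p\<^sup>j\<close>. From the Eisenstein series \<open>E\<^sub>k(d\<tau>)\<close>, where \<open>d\<close> runs through the Hall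
  divisors of \<open>\<Gamma>\<close>, one builds a holomorphic form \<open>E\<close> that transforms under \<open>\<Gamma>\<close> like \<open>Z\<^sup>k\<close> and whose
  \<open>q\<close>-expansion is modulo \<open>p\<close> a constant \<open>M\<close> prime to \<open>p\<close>: for odd \<open>p\<close> a sum twisted by \<open>\<chi>\<close>, where the
  conditions on Legendre symbols and Euler's criterion make all constant terms with \<open>p \<nmid> d\<close> congruent
  and the number of such \<open>d\<close> is a power of 2; for \<open>p = 2\<close> a product of \<open>E\<^sub>4(d\<tau>)\<close>.
  Since \<open>Z\<close> vanishes only over the simple pole of \<open>t\<close>, to order at most 1, \<open>E = Z\<^sup>k P(t)\<close>
  with a polynomial \<open>P\<close> of degree at most \<open>k\<close>. For \<open>F(x) = \<Sum> T(n) x\<^sup>n\<close> this says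
  \<open>F(x)\<^sup>k P(x) \<equiv> M\<close> modulo \<open>p\<close>. As \<open>F(x)\<close> to the power \<open>p\<^sup>j\<close> is \<open>F\<close> evaluated at that power of \<open>x\<close>,
  it follows that \<open>F(x) \<equiv> A(x) F(x\<^sup>p)\<close> with \<open>A\<close> of degree less than \<open>p\<close>, which is the Lucas property.\<close>

section \<open>Eisenstein series and the Lipschitz formula\<close>

text \<open>The exponent \<open>j\<close> is there because weight p - 1 is not always available: the
  lattice sums converge absolutely only from weight 4 on. So p = 3 uses weight 6 = 2 * 3, and for p
  = 2 a product over n = 2^i divisors has weight 4 n = 2^(i + 2). That the number of divisors is a
  power of 2 thus matters twice: it is a unit modulo an odd p, and a power of p when p = 2. The
  conditions on p come from a normalisation. Atkin--Lehner matrices permute the E_k(d \<tau>) only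
  after multiplication by d^(k/2), while Z^k picks up \<chi>^(k/2). Up to a common factor the
  constant terms are therefore (\<chi>(w_d) d)^(k/2). For k = p - 1 Euler's criterion turns d^(k/2)
  into the Legendre symbol, and the sign survives exactly when k/2 is odd, that is, when p is -1
  modulo 4. The multiplier of Z and the fractional orders are kept out of the way by comparing E
  with Z^k through a cross-multiplied identity, for which the law of Z^2 suffices, and by replacing
  a valence formula with size estimates, Riemann's removable singularity theorem and Liouville's
  theorem.\<close>

lemma digamma_reflection:
  fixes z :: complex
  assumes "z \<notin> \<int>"
  shows "Digamma (1 - z) - Digamma z = of_real pi * cot (of_real pi * z)"
proof -
  have nz: "sin (of_real pi * z) \<noteq> 0"
    using assms by (subst sin_eq_0) (auto simp: )
  have z1: "z \<notin> \<int>\<^sub>\<le>\<^sub>0" "1 - z \<notin> \<int>\<^sub>\<le>\<^sub>0"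
    using assms by (auto dest: nonpos_Ints_Int)
  have G0: "Gamma z \<noteq> 0" "Gamma (1 - z) \<noteq> 0"
    using z1 by (auto simp: Gamma_eq_zero_iff)
  have D1: "((\<lambda>z. Gamma z * Gamma (1 - z) * sin (of_real pi * z)) has_field_derivative
      (Gamma z * Digamma z * Gamma (1 - z) * sin (of_real pi * z)
       - Gamma z * Gamma (1 - z) * Digamma (1 - z) * sin (of_real pi * z)
       + Gamma z * Gamma (1 - z) * (of_real pi * cos (of_real pi * z)))) (at z)"
    using z1 by (auto intro!: derivative_eq_intros simp: algebra_simps)
  have D2: "((\<lambda>z. Gamma z * Gamma (1 - z) * sin (of_real pi * z)) has_field_derivative 0) (at z)"
  proof (rule DERIV_cong_ev[THEN iffD1, OF refl _ refl])
    have "open (- (\<int> :: complex set))" by (simp add: closed_Ints open_Compl)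
    then have "eventually (\<lambda>z. z \<in> - \<int>) (nhds z)" using assms by (intro eventually_nhds_in_open) auto
    then show "\<forall>\<^sub>F x in nhds z. of_real pi = Gamma x * Gamma (1 - x) * sin (of_real pi * x)"
    proof eventually_elim
      case (elim x)
      then have "sin (of_real pi * x) \<noteq> 0" by (subst sin_eq_0) auto
      then show ?case using Gamma_reflection_complex[of x] by simp
    qed
  qed auto
  have "Gamma z * Gamma (1 - z) * (Digamma z * sin (of_real pi * z)
       - Digamma (1 - z) * sin (of_real pi * z) + of_real pi * cos (of_real pi * z)) = 0"
    using DERIV_unique[OF D1 D2] by (simp add: algebra_simps)
  then have "Digamma z * sin (of_real pi * z)
       - Digamma (1 - z) * sin (of_real pi * z) + of_real pi * cos (of_real pi * z) = 0"
    using G0 by simp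
  then have "(Digamma (1 - z) - Digamma z) * sin (of_real pi * z) = of_real pi * cos (of_real pi * z)"
    unfolding left_diff_distrib by (metis add_eq_0_iff minus_diff_eq)
  then show ?thesis using nz by (simp add: cot_def nonzero_eq_divide_eq)
qed

text \<open>Keeping the factor exp(2 pi i z) - 1 on the left prepares the later comparison of power
  series at 0, where the cotangent has its pole.\<close>

lemma pi_cot_eq:
  fixes z :: complex
  assumes "z \<notin> \<int>"
  shows "of_real pi * cot (of_real pi * z) * (exp (2 * pi * \<i> * z) - 1)
       = of_real pi * \<i> * (exp (2 * pi * \<i> * z) + 1)"
proof -
  define w where "w = of_real pi * z"
  have nz: "sin w \<noteq> 0"
    using assms unfolding w_def by (subst sin_eq_0) auto
  have e: "exp (2 * pi * \<i> * z) = exp (\<i> * w) * exp (\<i> * w)" by (simp add: w_def exp_add[symmetric] mult_ac)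
  have "cos w * (exp (\<i> * w) * exp (\<i> * w) - 1) = \<i> * (exp (\<i> * w) * exp (\<i> * w) + 1) * sin w"
  proof -
    have "exp (\<i> * w) * exp (- (\<i> * w)) = 1" by (simp add: exp_minus)
    then have "exp (\<i> * w) * (exp (\<i> * w) * exp (- (\<i> * w))) = exp (\<i> * w)" by simp
    then show ?thesis unfolding cos_exp_eq sin_exp_eq
      by (simp add: divide_simps) (simp add: algebra_simps)
  qed
  then have "cot w * (exp (\<i> * w) * exp (\<i> * w) - 1) = \<i> * (exp (\<i> * w) * exp (\<i> * w) + 1)"
    using nz by (simp add: cot_def field_simps)
  then show ?thesis unfolding e w_def[symmetric] by simp
qed

text \<open>Bernoulli numbers in the form \<open>B\<^sub>n / n!\<close>.\<close>

definition bern_coeff :: "nat \<Rightarrow> rat" where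
  "bern_coeff n = fps_nth (inverse (Abs_fps (\<lambda>n. 1 / fact (n + 1)))) n"

lemma bern_coeff_0: "bern_coeff 0 = 1" by (simp add: bern_coeff_def)

lemma bern_coeff_rec: assumes "n > 0"
  shows "bern_coeff n = - (\<Sum>i<n. bern_coeff i / fact (n + 1 - i))"
proof -
  define A :: "rat fps" where "A = Abs_fps (\<lambda>n. 1 / fact (n + 1))"
  have "inverse A * A = 1" by (rule inverse_mult_eq_1) (simp add: A_def)
  then have "fps_nth (inverse A * A) n = 0" using assms by simp
  then have "(\<Sum>i=0..n. bern_coeff i / fact (n - i + 1)) = 0"
    by (simp add: fps_mult_nth A_def bern_coeff_def)
  moreover have "{0..n} = insert n {..<n}" by auto
  ultimately show ?thesis by (simp add: Suc_diff_le eq_neg_iff_add_eq_0)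
qed

text \<open>These two values give the constant terms in weight 4, used for p = 2, and in weight 6,
  used for p = 3.\<close>

lemma bern_coeff_4: "bern_coeff 4 = - 1 / 720"
  and bern_coeff_6: "bern_coeff 6 = 1 / 30240"
proof -
  note l = lessThan_nat_numeral fact_numeral pred_numeral_simps
  have 1: "bern_coeff 1 = - 1 / 2" using bern_coeff_rec[of 1] by (simp add: bern_coeff_0)
  have 2: "bern_coeff 2 = 1 / 12"
    using bern_coeff_rec[of 2] by (simp add: bern_coeff_0 1[simplified] l)
  have 3: "bern_coeff 3 = 0"
    using bern_coeff_rec[of 3] by (simp add: bern_coeff_0 1[simplified] 2 l)
  show 4: "bern_coeff 4 = - 1 / 720"
    using bern_coeff_rec[of 4] by (simp add: bern_coeff_0 1[simplified] 2 3 l)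
  have 5: "bern_coeff 5 = 0"
    using bern_coeff_rec[of 5] by (simp add: bern_coeff_0 1[simplified] 2 3 4 l)
  show "bern_coeff 6 = 1 / 30240"
    using bern_coeff_rec[of 6] by (simp add: bern_coeff_0 1[simplified] 2 3 4 5 l)
qed

text \<open>The Lipschitz formula comes from differentiating the reflection formula of Digamma.\<close>

definition lip_fps :: "nat \<Rightarrow> complex fps" where
  "lip_fps n = Abs_fps (\<lambda>r. of_nat r ^ n)"

lemma lip_fps_Suc: "lip_fps (Suc n) = fps_X * fps_deriv (lip_fps n)"
  by (rule fps_ext) (auto simp: lip_fps_def fps_nth_power_0 split: nat.splits)

lemma conv_radius_lip_fps: "fps_conv_radius (lip_fps n) \<ge> 1"
proof (induction n)
  case 0
  show ?case unfolding fps_conv_radius_def lip_fps_def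
    by (rule conv_radius_geI_ex') (auto simp: one_ereal_def summable_geometric)
next
  case (Suc n)
  then have "1 \<le> min (fps_conv_radius (fps_X :: complex fps)) (fps_conv_radius (fps_deriv (lip_fps n)))"
    using fps_conv_radius_deriv[of "lip_fps n"] by (auto intro: order_trans)
  then show ?case unfolding lip_fps_Suc
    by (rule order_trans[OF _ fps_conv_radius_mult])
qed

text \<open>This is the sum of r^n q^r over r >= 0 with q = exp(2 pi i z), a polylogarithm of order
  -n. Since 0^0 = 1, the term r = 0 contributes 1 for n = 0 and nothing otherwise.\<close>

definition lip :: "nat \<Rightarrow> complex \<Rightarrow> complex" where
  "lip n z = eval_fps (lip_fps n) (exp (2 * pi * \<i> * z))"

lemma norm_exp_lt_1: assumes "Im z > 0" shows "norm (exp (2 * pi * \<i> * z)) < 1"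
  using assms by (simp add: norm_exp_eq_Re)

text \<open>In the variable q = exp(2 pi i z) the operator d/dz is 2 pi i times q d/dq, which
  multiplies the r-th coefficient by r.\<close>

lemma lip_has_derivative:
  assumes "Im z > 0"
  shows "(lip n has_field_derivative 2 * pi * \<i> * lip (Suc n) z) (at z)"
proof -
  define x where "x = exp (2 * pi * \<i> * z)"
  have x: "norm x < 1" using norm_exp_lt_1[OF assms] by (simp add: x_def)
  then have in_ball: "ereal (norm x) < fps_conv_radius (lip_fps n)"
    using conv_radius_lip_fps[of n] by (metis ereal_less(3) less_le_trans)
  have 1: "eval_fps (lip_fps (Suc n)) x = x * eval_fps (fps_deriv (lip_fps n)) x"
    unfolding lip_fps_Suc using in_ball
    by (subst eval_fps_mult) (auto intro: less_le_trans fps_conv_radius_deriv)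
  have "((\<lambda>z. eval_fps (lip_fps n) (exp (2 * pi * \<i> * z))) has_field_derivative
          eval_fps (fps_deriv (lip_fps n)) x * (x * (2 * pi * \<i>))) (at z)"
    using in_ball unfolding x_def
    by (auto intro!: derivative_eq_intros)
  then show ?thesis unfolding lip_def[abs_def] x_def[symmetric] 1 by (simp add: mult_ac)
qed


lemma lip_0: assumes "Im z > 0" shows "lip 0 z = 1 / (1 - exp (2 * pi * \<i> * z))"
  using norm_exp_lt_1[OF assms]
  by (simp add: lip_def eval_fps_def lip_fps_def suminf_geometric)

text \<open>For n = 0 this is the expansion of pi cot(pi z) as a geometric series in q. Each
  differentiation contributes a factor 2 pi i and flips the sign at 1 - z; the additive constant pi
  i is lost at the first one.\<close>

lemma Polygamma_reflection_lip:
  assumes "Im z > 0"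
  shows "Polygamma n z + (-1) ^ Suc n * Polygamma n (1 - z)
       = (2 * pi * \<i>) ^ Suc n * lip n z - (if n = 0 then pi * \<i> else 0)"
  using assms
proof (induction n arbitrary: z)
  case 0
  then have z: "z \<notin> \<int>" by (auto elim!: Ints_cases)
  have "exp (2 * pi * \<i> * z) \<noteq> 1" using norm_exp_lt_1[OF 0] by (metis norm_one less_irrefl)
  then show ?case using pi_cot_eq[OF z] digamma_reflection[OF z]
    by (simp add: lip_0[OF 0] divide_simps) (auto simp: algebra_simps)
next
  case (Suc n)
  have nonint: "w \<notin> \<int>\<^sub>\<le>\<^sub>0" "1 - w \<notin> \<int>\<^sub>\<le>\<^sub>0" if "Im w > 0" for w
    using that by (auto elim!: nonpos_Ints_cases simp: complex_eq_iff)
  have L: "((\<lambda>z. Polygamma n z + (-1) ^ Suc n * Polygamma n (1 - z)) has_field_derivative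
     (Polygamma (Suc n) z + (-1) ^ Suc (Suc n) * Polygamma (Suc n) (1 - z))) (at z)"
    using nonint[OF Suc.prems] by (auto intro!: derivative_eq_intros)
  have R: "((\<lambda>z. (2 * pi * \<i>) ^ Suc n * lip n z - (if n = 0 then pi * \<i> else 0)) has_field_derivative
     (2 * pi * \<i>) ^ Suc (Suc n) * lip (Suc n) z) (at z)"
    by (auto intro!: derivative_eq_intros lip_has_derivative[OF Suc.prems])
  have "eventually (\<lambda>w. w \<in> {w. Im w > 0}) (nhds z)"
    using Suc.prems by (intro eventually_nhds_in_open open_halfspace_Im_gt) auto
  then have ev: "\<forall>\<^sub>F w in nhds z. Polygamma n w + (-1) ^ Suc n * Polygamma n (1 - w) =
      (2 * pi * \<i>) ^ Suc n * lip n w - (if n = 0 then pi * \<i> else 0)"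
    by eventually_elim (use Suc.IH in auto)
  show ?case using DERIV_unique[OF L DERIV_cong_ev[OF refl ev refl, THEN iffD2, OF R]] by simp
qed

lemma of_rat_fact: "of_rat (fact n) = (fact n :: complex)"
  by (metis of_nat_fact of_rat_of_nat_eq)

text \<open>Euler's evaluation of 2 zeta(k). The coefficient of z^(k - 1) in G(z) = Digamma(1 + z) -
  Digamma(1 - z) is 2 zeta(k), and the reflection formula gives 1 - z G(z) = pi z cot(pi z), whose
  exponential form is governed by the generating series of the Bernoulli numbers.\<close>

lemma zeta_even_bern_coeff:
  assumes "even k" "k \<ge> 2"
  shows "2 * suminf (\<lambda>n. inverse (of_nat (Suc n) ^ k)) = - ((2 * pi * \<i>) ^ k * of_rat (bern_coeff k))"
proof -
  obtain m where k: "k = Suc m" "odd m" using assms by (cases k) auto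
  define G where "G = (\<lambda>z::complex. Digamma (1 + z) - Digamma (1 - z))"
  define F where "F = fps_expansion G 0"
  have nn: "1 + w \<notin> \<int>\<^sub>\<le>\<^sub>0" "1 - w \<notin> \<int>\<^sub>\<le>\<^sub>0" if "w \<in> ball (0::complex) 1" for w
  proof -
    have "Re w < 1" "- Re w < 1" using that abs_Re_le_cmod[of w] by auto
    then show "1 + w \<notin> \<int>\<^sub>\<le>\<^sub>0" "1 - w \<notin> \<int>\<^sub>\<le>\<^sub>0"
      by (auto elim!: nonpos_Ints_cases simp: complex_eq_iff)
  qed
  have "(deriv ^^ n) G w = Polygamma n (1 + w) + (-1) ^ Suc n * Polygamma n (1 - w)"
    if "w \<in> ball 0 1" for n w
    using that
  proof (induction n arbitrary: w)
    case (Suc n)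
    have "eventually (\<lambda>w. w \<in> ball 0 1) (nhds w)"
      using Suc.prems by (intro eventually_nhds_in_open) auto
    then have ev: "\<forall>\<^sub>F w in nhds w. (deriv ^^ n) G w = Polygamma n (1 + w) + (-1) ^ Suc n * Polygamma n (1 - w)"
      by eventually_elim (use Suc.IH in auto)
    have "((\<lambda>w. Polygamma n (1 + w) + (-1) ^ Suc n * Polygamma n (1 - w)) has_field_derivative
       (Polygamma (Suc n) (1 + w) + (-1) ^ Suc (Suc n) * Polygamma (Suc n) (1 - w))) (at w)"
      using nn[OF Suc.prems] by (auto intro!: derivative_eq_intros)
    from DERIV_imp_deriv[OF this] deriv_cong_ev[OF ev refl] show ?case by simp
  qed (simp add: G_def)
  from this[of 0 m] have "(deriv ^^ m) G 0 = 2 * Polygamma m 1"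
    using k by simp
  then have Fm: "fps_nth F m = 2 * suminf (\<lambda>n. inverse (of_nat (Suc n) ^ k))"
  proof -
    have "m \<noteq> 0" using k by (cases m) auto
    moreover have "(- 1 :: complex) ^ Suc m = 1" using k by simp
    ultimately have "Polygamma m 1 = fact m * suminf (\<lambda>n. inverse ((1 + of_nat n :: complex) ^ k))"
      by (simp only: Polygamma_def k(1) if_False mult_1_left)
    with \<open>(deriv ^^ m) G 0 = 2 * Polygamma m 1\<close> show ?thesis
      by (simp add: F_def fps_expansion_def)
  qed
  have "G holomorphic_on ball 0 1"
    unfolding G_def by (intro analytic_imp_holomorphic analytic_intros) (use nn in auto)
  then have "G has_fps_expansion F"
    unfolding F_def by (intro has_fps_expansion_fps_expansion[of "ball 0 1"]) auto
  define w where "w = 2 * pi * \<i>"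
  have w0: "w \<noteq> 0" by (simp add: w_def)
  have 1: "(\<lambda>z. 2 * ((1 - z * G z) * (exp (w * z) - 1))) has_fps_expansion
     fps_const 2 * ((1 - fps_X * F) * (fps_exp w - 1))"
    using \<open>G has_fps_expansion F\<close> by (intro fps_expansion_intros)
  have 2: "(\<lambda>z. w * (z * (exp (w * z) + 1))) has_fps_expansion fps_const w * (fps_X * (fps_exp w + 1))"
    by (intro fps_expansion_intros)
  have "eventually (\<lambda>z. z \<in> ball (0::complex) 1) (nhds 0)"
    by (intro eventually_nhds_in_open) auto
  then have ev: "eventually (\<lambda>z. 2 * ((1 - z * G z) * (exp (w * z) - 1)) =
      w * (z * (exp (w * z) + 1))) (nhds 0)"
  proof eventually_elim
    case (elim z)
    show ?case
    proof (cases "z = 0")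
      case False
      have z: "z \<notin> \<int>"
        using elim False by (auto elim!: Ints_cases simp flip: of_int_abs)
      have "Digamma (1 + z) = Digamma z + 1 / z"
        using Digamma_plus1[OF False] by (simp add: add.commute)
      then have "1 - z * G z = z * (pi * cot (pi * z))"
        unfolding digamma_reflection[OF z, symmetric] G_def using False
        by (simp add: right_diff_distrib distrib_left)
      moreover have "(pi * cot (pi * z)) * (exp (w * z) - 1) = pi * \<i> * (exp (w * z) + 1)"
        using pi_cot_eq[OF z] by (simp add: w_def)
      ultimately have "(1 - z * G z) * (exp (w * z) - 1) = z * (pi * \<i> * (exp (w * z) + 1))"
        by (metis mult.assoc)
      moreover have "pi * \<i> = w / 2" by (simp add: w_def)
      moreover have "2 * (z * (w / 2 * e)) = w * (z * e)" for e by (simp add: field_simps)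
      ultimately show ?thesis by (simp only:)
    qed auto
  qed
  have eq: "fps_const 2 * ((1 - fps_X * F) * (fps_exp w - 1)) = fps_const w * (fps_X * (fps_exp w + 1))"
    by (rule fps_expansion_unique_complex[OF 1 has_fps_expansion_cong[OF ev refl, THEN iffD2, OF 2]])
  \<comment> \<open>\<open>A\<close> is the series (exp(w X) - 1) / (w X), and \<open>B\<close>, its
    inverse, carries the numbers \<open>bern_coeff\<close>. Multiplying the identity by
    \<open>B\<close> after cancelling w X isolates F.\<close>
  define A where "A = Abs_fps (\<lambda>n. w ^ n / fact (n + 1))"
  define B where "B = Abs_fps (\<lambda>n. of_rat (bern_coeff n) * w ^ n)"
  have BA: "B * A = 1"
  proof (rule fps_ext)
    fix n
    show "fps_nth (B * A) n = fps_nth 1 n"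
    proof (cases "n = 0")
      case False
      have "(\<Sum>i=0..n. bern_coeff i / fact (n - i + 1)) = 0"
      proof -
        have "{0..n} = insert n {..<n}" by auto
        with bern_coeff_rec[of n] False show ?thesis by (simp add: Suc_diff_le)
      qed
      then have "(0::complex) = of_rat (\<Sum>i=0..n. bern_coeff i / fact (n - i + 1))" by simp
      also have "\<dots> = (\<Sum>i=0..n. of_rat (bern_coeff i) / fact (n - i + 1))"
        by (simp only: of_rat_sum of_rat_divide of_rat_fact)
      finally have "w ^ n * (\<Sum>i=0..n. of_rat (bern_coeff i) / fact (n - i + 1)) = 0" by simp
      moreover have "fps_nth (B * A) n = w ^ n * (\<Sum>i=0..n. of_rat (bern_coeff i) / fact (n - i + 1))"
        unfolding fps_mult_nth sum_distrib_left
      proof (intro sum.cong refl)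
        fix i assume "i \<in> {0..n}"
        then have "w ^ n = w ^ i * w ^ (n - i)" by (simp flip: power_add)
        then show "fps_nth B i * fps_nth A (n - i) = w ^ n * (of_rat (bern_coeff i) / fact (n - i + 1))"
          by (simp add: A_def B_def)
      qed
      ultimately show ?thesis using False by simp
    qed (simp add: A_def B_def bern_coeff_0)
  qed
  have E: "fps_exp w - 1 = fps_const w * fps_X * A"
  proof (rule fps_ext)
    fix n
    show "fps_nth (fps_exp w - 1) n = fps_nth (fps_const w * fps_X * A) n"
      by (cases n) (simp_all add: A_def mult.assoc fps_X_mult_nth del: fact_Suc)
  qed
  define W where "W = fps_const w"
  have W0: "W \<noteq> 0" using w0 by (simp add: W_def fps_const_eq_0_iff)
  have E': "fps_exp w = W * fps_X * A + 1" using E unfolding W_def by (metis diff_add_cancel)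
  have "(W * fps_X) * (2 * ((1 - fps_X * F) * A)) = (W * fps_X) * (W * fps_X * A + 2)"
    using eq unfolding E' W_def[symmetric] by (simp add: mult_ac add_ac flip: numeral_fps_const)
  then have "2 * ((1 - fps_X * F) * A) = W * fps_X * A + 2"
    using W0 by (subst (asm) mult_cancel_left) simp
  then have "B * (2 * ((1 - fps_X * F) * A)) = B * (W * fps_X * A + 2)" by simp
  then have "2 * (1 - fps_X * F) * (B * A) = W * fps_X * (B * A) + 2 * B"
    by (simp only: distrib_left mult_ac)
  then have "2 * (1 - fps_X * F) = W * fps_X + 2 * B" by (simp add: BA)
  then have "fps_nth (fps_const 2 * (1 - fps_X * F)) k = fps_nth (W * fps_X + fps_const 2 * B) k"
    by (simp only: numeral_fps_const)
  then have "- fps_nth F m = of_rat (bern_coeff k) * w ^ k"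
    using k assms(2) by (auto simp: B_def W_def fps_X_nth fps_X_mult_nth)
  then have "fps_nth F m = - (w ^ k * of_rat (bern_coeff k))" by (metis minus_minus mult.commute)
  then show ?thesis unfolding Fm w_def .
qed


section \<open>Modularity of the Eisenstein series\<close>

lemma has_sum_int_split:
  fixes f :: "int \<Rightarrow> 'a :: {topological_comm_monoid_add}"
  assumes "((\<lambda>n. f (int n)) has_sum a) UNIV" "((\<lambda>n. f (- 1 - int n)) has_sum b) UNIV"
  shows "(f has_sum (a + b)) UNIV"
proof -
  have "bij_betw int UNIV {0..}"
    by (rule bij_betwI[of _ _ _ nat]) auto
  with assms(1) have 1: "(f has_sum a) {0..}"
    using has_sum_reindex_bij_betw[of int UNIV "{0..}" f a] by simp
  have "bij_betw (\<lambda>n. - 1 - int n) UNIV {..<0}"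
    by (rule bij_betwI[of _ _ _ "\<lambda>m. nat (- 1 - m)"]) auto
  with assms(2) have 2: "(f has_sum b) {..<0}"
    using has_sum_reindex_bij_betw[of "\<lambda>n. - 1 - int n" UNIV "{..<0}" f b] by simp
  have "(f has_sum (a + b)) ({0..} \<union> {..<0})"
    by (rule has_sum_Un_disjoint[OF 1 2]) auto
  moreover have "x \<in> {0..} \<union> {..<0}" for x :: int by (cases "x \<ge> 0") simp_all
  then have "{0..} \<union> {..<0} = (UNIV :: int set)" by blast
  ultimately show ?thesis by simp
qed

lemma has_sum_int_split':
  fixes f :: "int \<Rightarrow> 'a :: {topological_comm_monoid_add}"
  assumes "((\<lambda>n. f (int (Suc n))) has_sum a) UNIV" "((\<lambda>n. f (- int (Suc n))) has_sum b) UNIV"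
  shows "(f has_sum (f 0 + a + b)) UNIV"
proof -
  have "((\<lambda>n. f (int n)) has_sum a) (range Suc)"
    using assms(1) by (subst has_sum_reindex) (auto simp: o_def)
  then have "((\<lambda>n. f (int n)) has_sum (f 0 + a)) (insert 0 (range Suc))"
    using has_sum_insert[of 0 "range Suc" "\<lambda>n. f (int n)" a] by simp
  moreover have "insert 0 (range Suc) = UNIV" by (auto intro: nat.exhaust)
  ultimately have "((\<lambda>n. f (int n)) has_sum (f 0 + a)) UNIV" by simp
  moreover have "- int (Suc n) = - 1 - int n" for n by simp
  ultimately show ?thesis using has_sum_int_split[of f] assms(2) by simp
qed

lemma summable_on_inverse_1_plus_square: "(\<lambda>n::int. inverse (1 + of_int n ^ 2 :: real)) summable_on UNIV"
proof -
  have s: "summable (\<lambda>n. inverse (real (Suc n) ^ 2))"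
    using inverse_power_summable[of 2, where ?'a = real] by (subst summable_Suc_iff) auto
  have "norm (inverse (1 + real (Suc n) ^ 2)) \<le> inverse (real (Suc n) ^ 2)" for n
  proof -
    have "real (Suc n) ^ 2 > 0" by simp
    then have "inverse (1 + real (Suc n) ^ 2) \<le> inverse (real (Suc n) ^ 2)"
      by (intro le_imp_inverse_le) auto
    then show ?thesis by (simp add: add_nonneg_nonneg del: of_nat_Suc)
  qed
  then have "summable (\<lambda>n. inverse (1 + real (Suc n) ^ 2))"
    by (intro summable_comparison_test'[OF s, of 0])
  then have "(\<lambda>n. inverse (1 + real (Suc n) ^ 2)) summable_on UNIV"
    by (intro summable_on_UNIV_nonneg_real_iff[THEN iffD2]) (simp_all add: add_nonneg_nonneg del: of_nat_Suc)
  then obtain a where "((\<lambda>n. inverse (1 + real (Suc n) ^ 2)) has_sum a) UNIV"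
    by (auto simp: summable_on_def)
  then have "((\<lambda>n. inverse (1 + of_int (int (Suc n)) ^ 2 :: real)) has_sum a) UNIV"
    "((\<lambda>n. inverse (1 + of_int (- int (Suc n)) ^ 2 :: real)) has_sum a) UNIV"
    by (simp_all add: power2_eq_square algebra_simps)
  from has_sum_int_split'[OF this] show ?thesis by (auto simp: summable_on_def)
qed

lemma lattice_norm_bound:
  assumes "Im \<tau> > 0"
  obtains c where "c > 0" "\<And>m n::int. norm (of_int m * \<tau> + of_int n) ^ 2 \<ge> c * (of_int m ^ 2 + of_int n ^ 2)"
proof
  define x y where "x = Re \<tau>" and "y = Im \<tau>"
  have y: "y > 0" using assms by (simp add: y_def)
  \<comment> \<open>The constant results from n^2 <= 2 (m x + n)^2 + 2 (m x)^2 and m^2 = (m y)^2 /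
    y^2, where m x + n and m y are the real and imaginary parts.\<close>
  define c where "c = inverse (2 + (2 * x ^ 2 + 1) / y ^ 2)"
  have pos: "2 + (2 * x ^ 2 + 1) / y ^ 2 > 0" using y by (intro add_pos_nonneg) auto
  then show "c > 0" by (simp add: c_def)
  fix m n :: int
  define M N where "M = real_of_int m" and "N = real_of_int n"
  have eq: "norm (of_int m * \<tau> + of_int n) ^ 2 = (M * x + N) ^ 2 + (M * y) ^ 2"
    by (simp add: cmod_power2 M_def N_def x_def y_def)
  have "N ^ 2 \<le> 2 * (M * x + N) ^ 2 + 2 * (M * x) ^ 2"
    using sum_squares_bound[of "M * x + N" "- (M * x)"] zero_le_power2[of "2 * M * x + N"]
    by (simp add: power2_eq_square algebra_simps)
  moreover have "(M * x) ^ 2 = x ^ 2 / y ^ 2 * (M * y) ^ 2" "M ^ 2 = 1 / y ^ 2 * (M * y) ^ 2"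
    using y by (simp_all add: power_mult_distrib)
  moreover have "(2 * x ^ 2 + 1) / y ^ 2 * (M * y) ^ 2 = 2 * (x ^ 2 / y ^ 2 * (M * y) ^ 2) + 1 / y ^ 2 * (M * y) ^ 2"
    by (simp only: add_divide_distrib distrib_right times_divide_eq_right[symmetric] mult.assoc)
  ultimately have "M ^ 2 + N ^ 2 \<le> 2 * (M * x + N) ^ 2 + (2 * x ^ 2 + 1) / y ^ 2 * (M * y) ^ 2"
    by linarith
  also have "\<dots> \<le> (2 + (2 * x ^ 2 + 1) / y ^ 2) * ((M * x + N) ^ 2 + (M * y) ^ 2)"
    using y by (simp add: distrib_left distrib_right)
  finally show "norm (of_int m * \<tau> + of_int n) ^ 2 \<ge> c * (of_int m ^ 2 + of_int n ^ 2)"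
    unfolding eq M_def[symmetric] N_def[symmetric] c_def
    using pos by (simp add: field_simps)
qed

lemma lattice_nonzero:
  assumes "Im \<tau> > 0" "(m, n) \<noteq> (0, 0)"
  shows "of_int m * \<tau> + of_int n \<noteq> (0 :: complex)"
  using assms by (auto simp: complex_eq_iff)

text \<open>For k > 0 the value at (0, 0) is inverse 0 = 0, so sums may run over all pairs of
  integers without excluding the origin.\<close>

definition eis_term :: "nat \<Rightarrow> complex \<Rightarrow> int \<times> int \<Rightarrow> complex" where
  "eis_term k \<tau> = (\<lambda>(m, n). inverse ((of_int m * \<tau> + of_int n) ^ k))"

text \<open>The majorant is a multiple of the product of 1 / (1 + m^2) and 1 / (1 + n^2). With s =
  m^2 + n^2 >= 1 one has (1 + m^2)(1 + n^2) <= 4 s^2, and four of the k factors of |m \<tau> + n|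
  absorb s^2; the other k - 4 are bounded below by a constant.\<close>

lemma eis_term_abs_summable:
  assumes "Im \<tau> > 0" "k \<ge> 4"
  shows "(\<lambda>x. norm (eis_term k \<tau> x)) summable_on UNIV"
proof -
  obtain c where c: "c > 0"
    "\<And>m n::int. norm (of_int m * \<tau> + of_int n) ^ 2 \<ge> c * (of_int m ^ 2 + of_int n ^ 2)"
    using lattice_norm_bound[OF assms(1)] by metis
  define g where "g = (\<lambda>n::int. inverse (1 + of_int n ^ 2 :: real))"
  obtain a where a: "(g has_sum a) UNIV"
    using summable_on_inverse_1_plus_square by (auto simp: summable_on_def g_def)
  have "(\<lambda>(m, n). g m * g n) summable_on UNIV \<times> UNIV"
    by (rule summable_on_SigmaI[where g = "\<lambda>m. g m * a"])
       (use a has_sum_cmult_left[OF a, of a] in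
        \<open>auto intro!: has_sum_cmult_right simp: summable_on_def g_def\<close>)
  then have s: "(\<lambda>(m, n). (4 * inverse (c ^ 2) * inverse (sqrt c ^ (k - 4))) * (g m * g n)) summable_on UNIV"
    using summable_on_cmult_right[of "\<lambda>(m, n). g m * g n"] by (simp add: case_prod_unfold)
  show ?thesis
  proof (rule Infinite_Sum.abs_summable_on_comparison_test'[OF s], clarify)
    fix m n :: int
    define w where "w = of_int m * \<tau> + of_int n"
    define s where "s = real_of_int m ^ 2 + real_of_int n ^ 2"
    show "norm (eis_term k \<tau> (m, n)) \<le> 4 * inverse (c ^ 2) * inverse (sqrt c ^ (k - 4)) * (g m * g n)"
    proof (cases "(m, n) = (0, 0)")
      case True
      then show ?thesis using assms c by (auto simp: eis_term_def g_def power_0_left)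
    next
      case False
      then have "m ^ 2 + n ^ 2 \<ge> 1"
        by (metis Pair_inject int_one_le_iff_zero_less sum_power2_gt_zero_iff)
      then have s1: "s \<ge> 1" unfolding s_def by (metis of_int_1_le_iff of_int_add of_int_power)
      have w2: "norm w ^ 2 \<ge> c * s" using c(2)[of m n] by (simp add: w_def s_def)
      have "c \<le> c * s" using s1 c by simp
      then have "sqrt c \<le> norm w"
        using w2 by (intro real_le_lsqrt) auto
      then have A: "sqrt c ^ (k - 4) \<le> norm w ^ (k - 4)"
        using c by (intro power_mono) auto
      have "(c * s) ^ 2 \<le> (norm w ^ 2) ^ 2"
        using w2 c s1 by (intro power_mono) auto
      then have B: "c ^ 2 * s ^ 2 \<le> norm w ^ 4"
        by (simp add: power_mult_distrib flip: power_mult)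
      have C: "(1 + of_int m ^ 2) * (1 + of_int n ^ 2) \<le> 4 * s ^ 2"
      proof -
        have "(1 + real_of_int m ^ 2) * (1 + of_int n ^ 2) = 1 + s + of_int m ^ 2 * of_int n ^ 2"
          by (simp add: s_def algebra_simps)
        moreover have "1 \<le> s ^ 2" "s \<le> s ^ 2" using s1 by (auto simp: self_le_power)
        moreover have "real_of_int m ^ 2 * of_int n ^ 2 \<le> s ^ 2"
          by (simp add: s_def power2_sum zero_le_mult_iff)
        ultimately show ?thesis by linarith
      qed
      have "sqrt c ^ (k - 4) * c ^ 2 * ((1 + of_int m ^ 2) * (1 + of_int n ^ 2)) \<le>
          sqrt c ^ (k - 4) * c ^ 2 * (4 * s ^ 2)"
        using c by (intro mult_left_mono C) auto
      also have "\<dots> = 4 * (sqrt c ^ (k - 4) * (c ^ 2 * s ^ 2))" by simp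
      also have "\<dots> \<le> 4 * (norm w ^ (k - 4) * norm w ^ 4)"
        by (intro mult_left_mono mult_mono A B) (use c in auto)
      also have "\<dots> = 4 * norm w ^ k" using assms by (simp flip: power_add)
      finally have fin: "sqrt c ^ (k - 4) * c ^ 2 * ((1 + of_int m ^ 2) * (1 + of_int n ^ 2)) \<le> 4 * norm w ^ k" .
      define bb where "bb = sqrt c ^ (k - 4) * c ^ 2 * ((1 + real_of_int m ^ 2) * (1 + real_of_int n ^ 2))"
      have "bb > 0" using c unfolding bb_def by (intro mult_pos_pos add_pos_nonneg) auto
      moreover have "bb / 4 \<le> norm w ^ k" using fin by (simp add: bb_def)
      ultimately have "inverse (norm w ^ k) \<le> inverse (bb / 4)"
        by (intro le_imp_inverse_le) auto
      also have "inverse (bb / 4) = 4 * inverse bb" unfolding inverse_divide by (rule divide_inverse)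
      also have "\<dots> = 4 * inverse (c ^ 2) * inverse (sqrt c ^ (k - 4)) * (g m * g n)"
        unfolding bb_def g_def inverse_mult_distrib by (simp only: mult_ac)
      finally show ?thesis by (simp add: eis_term_def w_def norm_inverse norm_power)
    qed
  qed
qed

lemma eis_term_summable:
  assumes "Im \<tau> > 0" "k \<ge> 4"
  shows "eis_term k \<tau> summable_on UNIV"
  using abs_summable_summable[OF eis_term_abs_summable[OF assms]] .

text \<open>The terms with n >= 0 sum to a polygamma value at w and those with n < 0 to one at 1 -
  w; because k is even, both occur with the sign that the reflection formula requires.\<close>

lemma lipschitz_formula:
  assumes "Im w > 0" "even k" "k \<ge> 4"
  shows "((\<lambda>n::int. inverse ((w + of_int n) ^ k)) has_sum ((2 * pi * \<i>) ^ k / fact (k - 1) * lip (k - 1) w)) UNIV"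
proof -
  have "(\<lambda>n. eis_term k w (1, n)) summable_on UNIV"
    using summable_on_SigmaD1[of "curry (eis_term k w)" UNIV "\<lambda>_. UNIV" 1]
      eis_term_summable[OF assms(1,3)] by (simp add: curry_def)
  then have S: "(\<lambda>n::int. inverse ((w + of_int n) ^ k)) summable_on UNIV"
    by (simp add: eis_term_def)
  obtain m where m: "k = Suc m" "odd m" "m > 0" using assms by (cases k) (auto intro: Suc_lessD)
  have 1: "(\<lambda>n. inverse ((w + of_nat n) ^ k)) summable_on UNIV"
  proof -
    have "(\<lambda>n::int. inverse ((w + of_int n) ^ k)) summable_on range int"
      by (rule summable_on_subset[OF S]) auto
    then show ?thesis by (subst (asm) summable_on_reindex) (auto simp: o_def)
  qed
  have 2: "(\<lambda>n. inverse ((w + of_int (- 1 - int n)) ^ k)) summable_on UNIV"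
  proof -
    have "(\<lambda>n::int. inverse ((w + of_int n) ^ k)) summable_on range (\<lambda>n. - 1 - int n)"
      by (rule summable_on_subset[OF S]) auto
    then show ?thesis by (subst (asm) summable_on_reindex) (auto simp: o_def inj_on_def)
  qed
  have e: "(w + of_int (- 1 - int n)) ^ k = (1 - w + of_nat n) ^ k" for n
  proof -
    have "w + of_int (- 1 - int n) = - (1 - w + of_nat n)" by simp
    then show ?thesis using assms(2) by (metis power_minus_even)
  qed
  have P: "Polygamma m v = fact m * suminf (\<lambda>n. inverse ((v + of_nat n) ^ k))" for v :: complex
    using m unfolding Polygamma_def by auto
  have v1: "((\<lambda>n. inverse ((w + of_nat n) ^ k)) has_sum (Polygamma m w / fact m)) UNIV"
    using has_sum_infsum[OF 1] has_sum_imp_sums[OF has_sum_infsum[OF 1]]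
    by (simp add: P sums_iff)
  have v2: "((\<lambda>n. inverse ((w + of_int (- 1 - int n)) ^ k)) has_sum (Polygamma m (1 - w) / fact m)) UNIV"
    using has_sum_infsum[OF 2] has_sum_imp_sums[OF has_sum_infsum[OF 2]] unfolding e
    by (simp add: P sums_iff)
  have "((\<lambda>n::int. inverse ((w + of_int n) ^ k)) has_sum (Polygamma m w / fact m + Polygamma m (1 - w) / fact m)) UNIV"
    by (rule has_sum_int_split) (use v1 v2 in auto)
  moreover have "Polygamma m w / fact m + Polygamma m (1 - w) / fact m = (2 * pi * \<i>) ^ k / fact (k - 1) * lip (k - 1) w"
    using Polygamma_reflection_lip[OF assms(1), of m] m by (simp add: add_divide_distrib[symmetric])
  ultimately show ?thesis by simp
qed

text \<open>The constant term \<open>- B\<^sub>k / (2 k)\<close> belonging to the coefficients \<open>\<sigma>\<^sub>k\<^sub>-\<^sub>1(n)\<close>.\<close>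

definition eis_const :: "nat \<Rightarrow> rat" where
  "eis_const k = - fact (k - 1) * bern_coeff k / 2"

definition eis_fps :: "nat \<Rightarrow> complex fps" where
  "eis_fps k = Abs_fps (\<lambda>n. if n = 0 then of_rat (eis_const k) else of_nat (\<Sum>r | r dvd n. r ^ (k - 1)))"

definition eis :: "nat \<Rightarrow> complex \<Rightarrow> complex" where
  "eis k \<tau> = eval_fps (eis_fps k) (exp (2 * pi * \<i> * \<tau>))"

lemma divisor_sum_le: fixes n :: nat assumes "n > 0" shows "(\<Sum>r | r dvd n. r ^ j) \<le> n ^ Suc j"
proof -
  have "{r. r dvd n} \<subseteq> {1..n}" using assms dvd_imp_le[of _ n] dvd_pos_nat[of n] by (fastforce simp: Suc_le_eq)
  then have "(\<Sum>r | r dvd n. r ^ j) \<le> (\<Sum>r\<in>{1..n}. r ^ j)" by (intro sum_mono2) auto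
  also have "\<dots> \<le> (\<Sum>r\<in>{1..n}. n ^ j)" by (intro sum_mono power_mono) auto
  finally show ?thesis by simp
qed

lemma conv_radius_eis_fps: "fps_conv_radius (eis_fps k) \<ge> 1"
  unfolding fps_conv_radius_def
proof (rule conv_radius_geI_ex')
  fix r :: real assume r: "0 < r" "ereal r < 1"
  then have "r < 1" by (simp add: one_ereal_def)
  have "ereal r < fps_conv_radius (lip_fps (Suc (k - 1)))"
    using r(2) conv_radius_lip_fps[of "Suc (k-1)"] by (rule less_le_trans)
  then have "summable (\<lambda>n. norm (fps_nth (lip_fps (Suc (k - 1))) n * of_real r ^ n))"
    using r unfolding fps_conv_radius_def by (intro abs_summable_in_conv_radius) auto
  then have s: "summable (\<lambda>n. real n ^ Suc (k - 1) * r ^ n)"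
    using r by (simp add: lip_fps_def norm_mult norm_power)
  show "summable (\<lambda>n. fps_nth (eis_fps k) n * of_real r ^ n)"
  proof (rule summable_comparison_test'[OF s, of 1])
    fix n :: nat assume n: "n \<ge> 1"
    have "real (\<Sum>r | r dvd n. r ^ (k - 1)) \<le> real (n ^ Suc (k - 1))"
      using divisor_sum_le[of n "k - 1"] n by (subst of_nat_le_iff) auto
    then show "norm (fps_nth (eis_fps k) n * of_real r ^ n) \<le> real n ^ Suc (k - 1) * r ^ n"
      using n r by (simp add: eis_fps_def norm_mult norm_power mult_right_mono del: of_nat_sum power_Suc)
  qed
qed

lemma eis_sums:
  assumes "Im \<tau> > 0"
  shows "(\<lambda>n. fps_nth (eis_fps k) n * exp (2 * pi * \<i> * \<tau>) ^ n) sums eis k \<tau>"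
    and "summable (\<lambda>n. norm (fps_nth (eis_fps k) n * exp (2 * pi * \<i> * \<tau>) ^ n))"
proof -
  have "ereal (norm (exp (2 * pi * \<i> * \<tau>))) < fps_conv_radius (eis_fps k)"
    using norm_exp_lt_1[OF assms] conv_radius_eis_fps[of k] by (metis ereal_less(3) less_le_trans)
  then show "summable (\<lambda>n. norm (fps_nth (eis_fps k) n * exp (2 * pi * \<i> * \<tau>) ^ n))"
    unfolding fps_conv_radius_def by (rule abs_summable_in_conv_radius)
  then show "(\<lambda>n. fps_nth (eis_fps k) n * exp (2 * pi * \<i> * \<tau>) ^ n) sums eis k \<tau>"
    unfolding eis_def eval_fps_def by (rule summable_sums[OF summable_norm_cancel])
qed

lemma lip_has_sum:
  assumes "Im w > 0" "j > 0"
  shows "((\<lambda>r. of_nat r ^ j * exp (2 * pi * \<i> * w) ^ r) has_sum lip j w) {1..}"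
proof -
  have "ereal (norm (exp (2 * pi * \<i> * w))) < fps_conv_radius (lip_fps j)"
    using norm_exp_lt_1[OF assms(1)] conv_radius_lip_fps[of j] by (metis ereal_less(3) less_le_trans)
  then have "summable (\<lambda>n. norm (fps_nth (lip_fps j) n * exp (2 * pi * \<i> * w) ^ n))"
    unfolding fps_conv_radius_def by (rule abs_summable_in_conv_radius)
  moreover from this have "(\<lambda>n. fps_nth (lip_fps j) n * exp (2 * pi * \<i> * w) ^ n) sums lip j w"
    unfolding lip_def eval_fps_def by (rule summable_sums[OF summable_norm_cancel])
  ultimately have "((\<lambda>r. of_nat r ^ j * exp (2 * pi * \<i> * w) ^ r) has_sum lip j w) UNIV"
    using norm_summable_imp_has_sum[of "\<lambda>n. fps_nth (lip_fps j) n * exp (2 * pi * \<i> * w) ^ n"]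
    by (simp add: lip_fps_def)
  then show ?thesis
    by (rule has_sum_cong_neutral[THEN iffD1, rotated -1]) (use assms(2) in \<open>auto simp: not_le\<close>)
qed

text \<open>The double sum of r^(k - 1) q^(m r) is regrouped by n = m r. Absolute summability is
  verified in the grouping by divisors r of n, where it is the convergence of the q-series, and is
  then carried to the grouping by m.\<close>

lemma eis_lip_has_sum:
  assumes "Im \<tau> > 0" "k \<ge> 2"
  shows "((\<lambda>m. lip (k - 1) (of_nat m * \<tau>)) has_sum (eis k \<tau> - of_rat (eis_const k))) {1..}"
proof -
  define q where "q = exp (2 * pi * \<i> * \<tau>)"
  define F where "F = (\<lambda>(n, r). of_nat r ^ (k - 1) * q ^ n :: complex)"
  define E where "E = (\<lambda>n. fps_nth (eis_fps k) n * q ^ n)"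
  have fin: "finite {r. r dvd n}" if "n \<in> {1..}" for n :: nat using that by auto
  have inner: "((\<lambda>r. F (n, r)) has_sum E n) {r. r dvd n}" if "n \<in> {1..}" for n
    using has_sum_finite[OF fin[OF that], of "\<lambda>r. F (n, r)"] that
    by (simp add: F_def E_def eis_fps_def sum_distrib_right)
  have innern: "((\<lambda>r. norm (F (n, r))) has_sum norm (E n)) {r. r dvd n}" if n: "n \<in> {1..}" for n
  proof -
    have "E n = of_nat (\<Sum>r | r dvd n. r ^ (k - 1)) * q ^ n"
      using n by (simp add: E_def eis_fps_def)
    then have "norm (E n) = real (\<Sum>r | r dvd n. r ^ (k - 1)) * norm q ^ n"
      by (simp only: norm_mult norm_of_nat norm_power)
    then show ?thesis
      using has_sum_finite[OF fin[OF that], of "\<lambda>r. norm (F (n, r))"]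
      by (simp add: F_def norm_mult norm_power sum_distrib_right)
  qed
  have E: "(E has_sum eis k \<tau>) UNIV"
    unfolding E_def q_def by (rule norm_summable_imp_has_sum) (use eis_sums[OF assms(1)] in auto)
  then have "(E has_sum (eis k \<tau> - E 0)) (UNIV - {0})"
    using has_sum_Diff[OF E, of "{0}" "E 0"] has_sum_finite[of "{0}" E] by simp
  moreover have "UNIV - {0::nat} = {1..}" by auto
  ultimately have E1: "(E has_sum (eis k \<tau> - of_rat (eis_const k))) {1..}"
    by (simp add: E_def eis_fps_def)
  have "(\<lambda>n. norm (E n)) summable_on UNIV"
    using eis_sums(2)[OF assms(1), of k] unfolding E_def q_def
    by (subst summable_on_UNIV_nonneg_real_iff) auto
  then have "(\<lambda>n. norm (E n)) summable_on {1..}" by (rule summable_on_subset) auto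
  then have "(\<lambda>x. norm (F x)) summable_on (SIGMA n:{1..}. {r. r dvd n})"
    using innern by (intro summable_on_SigmaI[where g = "\<lambda>n. norm (E n)"]) auto
  then have sF: "F summable_on (SIGMA n:{1..}. {r. r dvd n})" by (rule abs_summable_summable)
  have hF: "(F has_sum (eis k \<tau> - of_rat (eis_const k))) (SIGMA n:{1..}. {r. r dvd n})"
    by (rule has_sum_SigmaI[OF inner E1 sF])
  have bij: "bij_betw (\<lambda>(m, r). (m * r, r)) ({1..} \<times> {1..}) (SIGMA n:{1..}. {r::nat. r dvd n})"
    by (rule bij_betwI[of _ _ _ "\<lambda>(n, r). (n div r, r)"])
       (auto simp: Suc_le_eq dvd_pos_nat dvd_imp_le div_greater_zero_iff intro: dvd_pos_nat)
  have h2: "((\<lambda>(m, r). of_nat r ^ (k - 1) * q ^ (m * r)) has_sum (eis k \<tau> - of_rat (eis_const k))) ({1..} \<times> {1..})"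
    using has_sum_reindex_bij_betw[OF bij, of F] hF by (simp add: F_def case_prod_unfold)
  show ?thesis
  proof (rule has_sum_SigmaD[OF h2])
    fix m :: nat assume m: "m \<in> {1..}"
    have "exp (2 * pi * \<i> * (of_nat m * \<tau>)) = q ^ m"
      by (simp add: q_def exp_of_nat_mult[symmetric] mult_ac)
    then show "((\<lambda>r. (case (m, r) of (m, r) \<Rightarrow> of_nat r ^ (k - 1) * q ^ (m * r))) has_sum
          lip (k - 1) (of_nat m * \<tau>)) {1..}"
      using lip_has_sum[of "of_nat m * \<tau>" "k - 1"] m assms by (simp add: power_mult)
  qed
qed

text \<open>The lattice is summed row by row. The row m = 0 is 2 zeta(k) and gives the constant
  term; the rows m and -m coincide because k is even, and the Lipschitz formula at |m| \<tau> turns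
  each into a q-series.\<close>

theorem eis_has_sum:
  assumes "Im \<tau> > 0" "even k" "k \<ge> 4"
  shows "(eis_term k \<tau> has_sum (2 * (2 * pi * \<i>) ^ k / fact (k - 1) * eis k \<tau>)) UNIV"
proof -
  define C where "C = (2 * pi * \<i>) ^ k / fact (k - 1)"
  define L where "L = eis k \<tau> - of_rat (eis_const k)"
  define g where "g = (\<lambda>m::int. if m = 0 then 2 * C * of_rat (eis_const k)
      else C * lip (k - 1) (of_nat (nat \<bar>m\<bar>) * \<tau>))"
  have row: "((\<lambda>n. eis_term k \<tau> (m, n)) has_sum g m) UNIV" for m
  proof (cases "m = 0")
    case True
    define A where "A = suminf (\<lambda>n. inverse (of_nat (Suc n) ^ k) :: complex)"
    have s: "summable (\<lambda>n. norm (inverse (of_nat (Suc n) ^ k) :: complex))"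
    proof -
      have "summable (\<lambda>n. inverse (real (Suc n) ^ k))"
        using inverse_power_summable[of k, where ?'a = real] assms by (subst summable_Suc_iff) auto
      then show ?thesis by (simp only: norm_inverse norm_power norm_of_nat)
    qed
    have "((\<lambda>n. inverse (of_nat (Suc n) ^ k)) has_sum A) UNIV"
      unfolding A_def by (rule norm_summable_imp_has_sum[OF s summable_sums[OF summable_norm_cancel[OF s]]])
    then have "((\<lambda>n. inverse (of_int (int (Suc n)) ^ k)) has_sum A) UNIV"
      "((\<lambda>n. inverse (of_int (- int (Suc n)) ^ k)) has_sum A) UNIV"
      using assms(2) by (simp_all del: of_nat_Suc)
    from has_sum_int_split'[OF this]
    have "((\<lambda>n::int. inverse (of_int n ^ k)) has_sum (2 * A)) UNIV"
      using assms by (simp add: power_0_left)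
    moreover have "2 * A = g m"
      using True zeta_even_bern_coeff[OF assms(2)] assms(3)
      by (simp add: A_def g_def C_def eis_const_def of_rat_divide of_rat_mult of_rat_minus of_rat_fact)
    ultimately show ?thesis using True by (simp add: eis_term_def)
  next
    case False
    define w where "w = of_nat (nat \<bar>m\<bar>) * \<tau>"
    have w: "Im w > 0" using False assms by (simp add: w_def)
    have L: "((\<lambda>n::int. inverse ((w + of_int n) ^ k)) has_sum g m) UNIV"
      using lipschitz_formula[OF w assms(2,3)] False by (simp add: C_def g_def w_def)
    show ?thesis
    proof (cases "m > 0")
      case True
      then have "w = of_int m * \<tau>" by (simp add: w_def)
      then show ?thesis using L by (simp add: eis_term_def)
    next
      case neg: False
      have bij: "bij_betw (\<lambda>n::int. - n) UNIV UNIV" by (rule bij_uminus)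
      have "w = - of_int m * \<tau>" using neg by (simp add: w_def)
      then have "w + of_int (- n) = - (of_int m * \<tau> + of_int n)" for n by simp
      then have "(w + of_int (- n)) ^ k = (of_int m * \<tau> + of_int n) ^ k" for n
        using assms(2) by (metis power_minus_even)
      then show ?thesis
        using L has_sum_reindex_bij_betw[OF bij, of "\<lambda>n::int. inverse ((w + of_int n) ^ k)" "g m"]
        by (simp add: eis_term_def)
    qed
  qed
  have "((\<lambda>m. lip (k - 1) (of_nat m * \<tau>)) has_sum L) (range Suc)"
    using eis_lip_has_sum[OF assms(1), of k] assms(3) unfolding L_def
    by (simp add: atLeast_Suc_greaterThan greaterThan_0)
  then have "((\<lambda>n. C * lip (k - 1) (of_nat (Suc n) * \<tau>)) has_sum (C * L)) UNIV"
    by (subst (asm) has_sum_reindex) (auto simp: o_def simp del: of_nat_Suc intro: has_sum_cmult_right)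
  then have "((\<lambda>n. g (int (Suc n))) has_sum (C * L)) UNIV" "((\<lambda>n. g (- int (Suc n))) has_sum (C * L)) UNIV"
    by (simp_all add: g_def nat_add_distrib)
  from has_sum_int_split'[OF this] have "(g has_sum (2 * C * eis k \<tau>)) UNIV"
    by (simp add: g_def L_def algebra_simps)
  then have "(eis_term k \<tau> has_sum (2 * C * eis k \<tau>)) (UNIV \<times> UNIV)"
    using eis_term_summable[OF assms(1,3)] row by (intro has_sum_SigmaI[where g = g]) auto
  then show ?thesis by (simp add: C_def)
qed

text \<open>Right multiplication by the matrix permutes the pairs (m, n), and every term changes by
  the same factor (c \<tau> + d)^k.\<close>

lemma eis_modular:
  fixes a b c d :: int
  assumes "Im \<tau> > 0" "even k" "k \<ge> 4" "a * d - b * c = 1"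
  shows "eis k ((of_int a * \<tau> + of_int b) / (of_int c * \<tau> + of_int d)) = (of_int c * \<tau> + of_int d) ^ k * eis k \<tau>"
proof -
  define j where "j = of_int c * \<tau> + of_int d"
  define \<tau>' where "\<tau>' = (of_int a * \<tau> + of_int b) / j"
  have "(c, d) \<noteq> (0, 0)" using assms(4) by auto
  then have j: "j \<noteq> 0" using lattice_nonzero[OF assms(1)] by (simp add: j_def)
  have "Im ((of_int a * \<tau> + of_int b) * cnj j) = of_int (a * d - b * c) * Im \<tau>"
    by (simp add: j_def algebra_simps)
  then have "Im \<tau>' = Im \<tau> / norm j ^ 2"
    using assms(4) by (simp add: \<tau>'_def complex_div_cnj[of _ j] Im_divide_of_real)
  then have im: "Im \<tau>' > 0" using j assms by simp
  define h where "h = (\<lambda>(m, n). (m * a + n * c, m * b + n * d))"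
  have bij: "bij_betw h UNIV UNIV"
  proof (rule bij_betwI[of _ _ _ "\<lambda>(m, n). (m * d - n * c, n * a - m * b)"])
    have H: "a * (d * m) = m + b * (c * m)" for m
    proof -
      have "a * (d * m) = (a * d) * m" by simp
      also have "a * d = 1 + b * c" using assms(4) by simp
      finally show ?thesis by (simp add: distrib_right)
    qed
    show "(\<lambda>(m, n). (m * d - n * c, n * a - m * b)) (h x) = x" "h ((\<lambda>(m, n). (m * d - n * c, n * a - m * b)) x) = x" for x
      by (auto simp: h_def case_prod_unfold algebra_simps prod_eq_iff H)
  qed auto
  have "eis_term k \<tau>' x = j ^ k * eis_term k \<tau> (h x)" for x
  proof -
    obtain m n where x: "x = (m, n)" by force
    have "of_int m * \<tau>' + of_int n = (of_int (m * a + n * c) * \<tau> + of_int (m * b + n * d)) / j"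
    proof -
      have "of_int m * \<tau>' + of_int n = (of_int m * (of_int a * \<tau> + of_int b) + of_int n * j) / j"
      proof -
        have 1: "of_int m * \<tau>' = (of_int m * (of_int a * \<tau> + of_int b)) / j"
          unfolding \<tau>'_def by (rule times_divide_eq_right)
        have 2: "of_int n = of_int n * j / j" using j by simp
        show ?thesis unfolding 1 by (subst 2) (rule add_divide_distrib[symmetric])
      qed
      also have "of_int m * (of_int a * \<tau> + of_int b) + of_int n * j =
          of_int (m * a + n * c) * \<tau> + of_int (m * b + n * d)"
        by (simp add: j_def algebra_simps)
      finally show ?thesis .
    qed
    then show ?thesis unfolding eis_term_def x h_def prod.case
      by (simp only: power_divide inverse_divide) (simp only: divide_inverse)
  qed
  then have eq: "eis_term k \<tau>' = (\<lambda>x. j ^ k * eis_term k \<tau> (h x))" by blast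
  have "(eis_term k \<tau>' has_sum (j ^ k * (2 * (2 * pi * \<i>) ^ k / fact (k - 1) * eis k \<tau>))) UNIV"
    unfolding eq
    by (intro has_sum_cmult_right has_sum_reindex_bij_betw[OF bij, THEN iffD2] eis_has_sum assms)
  from has_sum_unique[OF this eis_has_sum[OF im assms(2,3)]]
  show ?thesis by (simp add: \<tau>'_def j_def)
qed


section \<open>Lucas congruences from a polynomial identity\<close>

text \<open>A subring \<open>R\<close> with an ideal \<open>I\<close> whose residue ring consists of roots of \<open>x\<^sup>p = x\<close>; power series
  over the residue field \<open>\<int>/p\<close>, which is no type, are handled as congruences modulo \<open>I\<close>.\<close>

locale residue_ring_mod_p =
  fixes R I :: "complex set" and p :: nat
  assumes zero_R: "0 \<in> R" and one_R: "1 \<in> R"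
    and add_R: "x \<in> R \<Longrightarrow> y \<in> R \<Longrightarrow> x + y \<in> R"
    and mult_R: "x \<in> R \<Longrightarrow> y \<in> R \<Longrightarrow> x * y \<in> R"
    and uminus_R: "x \<in> R \<Longrightarrow> - x \<in> R"
    and I_subset: "I \<subseteq> R"
    and zero_I: "0 \<in> I"
    and add_I: "x \<in> I \<Longrightarrow> y \<in> I \<Longrightarrow> x + y \<in> I"
    and mult_I: "x \<in> R \<Longrightarrow> y \<in> I \<Longrightarrow> x * y \<in> I"
    and p_I: "of_nat p \<in> I"
    and frob: "x \<in> R \<Longrightarrow> x ^ p - x \<in> I"
    and prime_p: "Factorial_Ring.prime p"
begin

lemma p_pos: "p > 0" using prime_p by (simp add: prime_gt_0_nat)

lemma sum_R: "(\<And>i. i \<in> A \<Longrightarrow> f i \<in> R) \<Longrightarrow> sum f A \<in> R"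
  by (induction A rule: infinite_finite_induct) (auto intro: zero_R add_R)

lemma prod_R: "(\<And>i. i \<in> A \<Longrightarrow> f i \<in> R) \<Longrightarrow> prod f A \<in> R"
  by (induction A rule: infinite_finite_induct) (auto intro: one_R mult_R)

lemma sum_I: "(\<And>i. i \<in> A \<Longrightarrow> f i \<in> I) \<Longrightarrow> sum f A \<in> I"
  by (induction A rule: infinite_finite_induct) (auto intro: zero_I add_I)

lemma uminus_I: "x \<in> I \<Longrightarrow> - x \<in> I"
  using mult_I[of "- 1" x] uminus_R[OF one_R] by simp

lemma diff_I: "x \<in> I \<Longrightarrow> y \<in> I \<Longrightarrow> x - y \<in> I"
  using add_I[of x "- y"] uminus_I[of y] by simp

lemma diff_R: "x \<in> R \<Longrightarrow> y \<in> R \<Longrightarrow> x - y \<in> R"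
  using add_R[of x "- y"] uminus_R[of y] by simp

lemma of_nat_R: "of_nat n \<in> R"
  by (induction n) (auto intro: zero_R one_R add_R)

lemma of_int_R: "of_int n \<in> R"
  by (cases n) (auto intro: of_nat_R uminus_R simp del: of_nat_Suc)

lemma of_int_dvd_I: assumes "int p dvd n" shows "of_int n \<in> I"
proof -
  obtain m where "n = m * int p" using assms by (metis dvdE mult.commute)
  then show ?thesis using mult_I[OF of_int_R p_I, of m] by simp
qed

text \<open>By Bezout an integer prime to p is invertible modulo p, hence modulo \<open>I\<close>,
  which contains p.\<close>

lemma cancel_unit:
  assumes "x \<in> R" "of_int M * x \<in> I" "\<not> int p dvd M"
  shows "x \<in> I"
proof -
  have "coprime M (int p)"
    using assms(3) prime_p by (metis coprime_commute prime_imp_coprime prime_nat_int_transfer)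
  then obtain a b where "a * M + b * int p = 1"
    by (metis bezout_int coprime_imp_gcd_eq_1)
  then have "of_int (a * M + b * int p) * x = x" by simp
  then have "x = of_int a * (of_int M * x) + (of_int b * x) * of_nat p"
    by (simp add: algebra_simps)
  moreover have "of_int a * (of_int M * x) + (of_int b * x) * of_nat p \<in> I"
    by (intro add_I mult_I of_int_R assms mult_R p_I)
  ultimately show ?thesis by simp
qed

definition RS :: "complex fps set" where "RS = {f. \<forall>n. fps_nth f n \<in> R}"
definition IS :: "complex fps set" where "IS = {f. \<forall>n. fps_nth f n \<in> I}"

lemma RSD: "f \<in> RS \<Longrightarrow> fps_nth f n \<in> R" by (simp add: RS_def)
lemma ISD: "f \<in> IS \<Longrightarrow> fps_nth f n \<in> I" by (simp add: IS_def)

lemma IS_RS: "f \<in> IS \<Longrightarrow> f \<in> RS" using I_subset by (auto simp: IS_def RS_def)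

lemma RS_closed:
  "0 \<in> RS" "1 \<in> RS" "f \<in> RS \<Longrightarrow> g \<in> RS \<Longrightarrow> f + g \<in> RS" "f \<in> RS \<Longrightarrow> g \<in> RS \<Longrightarrow> f - g \<in> RS"
  "f \<in> RS \<Longrightarrow> g \<in> RS \<Longrightarrow> f * g \<in> RS" "c \<in> R \<Longrightarrow> fps_const c \<in> RS" "fps_X \<in> RS"
  by (auto simp: RS_def fps_mult_nth intro!: zero_R one_R add_R diff_R sum_R mult_R)

lemma RS_power: "f \<in> RS \<Longrightarrow> f ^ n \<in> RS"
  by (induction n) (auto intro: RS_closed)

lemma RS_sum: "(\<And>i. i \<in> A \<Longrightarrow> f i \<in> RS) \<Longrightarrow> sum f A \<in> RS"
  by (induction A rule: infinite_finite_induct) (auto intro: RS_closed)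

lemma IS_closed:
  "0 \<in> IS" "f \<in> IS \<Longrightarrow> g \<in> IS \<Longrightarrow> f + g \<in> IS" "f \<in> IS \<Longrightarrow> g \<in> IS \<Longrightarrow> f - g \<in> IS"
  "f \<in> RS \<Longrightarrow> g \<in> IS \<Longrightarrow> f * g \<in> IS" "g \<in> IS \<Longrightarrow> f \<in> RS \<Longrightarrow> g * f \<in> IS"
proof -
  show 1: "f * g \<in> IS" if "f \<in> RS" "g \<in> IS" for f g
    using that by (auto simp: RS_def IS_def fps_mult_nth intro!: sum_I mult_I)
  show "g * f \<in> IS" if "g \<in> IS" "f \<in> RS" using 1[OF that(2,1)] by (simp add: mult.commute)
qed (auto simp: IS_def intro!: zero_I add_I diff_I)

lemma IS_sum: "(\<And>i. i \<in> A \<Longrightarrow> f i \<in> IS) \<Longrightarrow> sum f A \<in> IS"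
  by (induction A rule: infinite_finite_induct) (auto intro: IS_closed)

lemma RS_inverse:
  assumes "f \<in> RS" "fps_nth f 0 = 1"
  shows "inverse f \<in> RS"
proof -
  have "fps_nth (inverse f) n \<in> R" for n
  proof (induction n rule: less_induct)
    case (less n)
    show ?case
    proof (cases "n = 0")
      case False
      have "(\<Sum>i=0..n. fps_nth (inverse f) i * fps_nth f (n - i)) = fps_nth (inverse f * f) n"
        by (simp add: fps_mult_nth)
      also have "inverse f * f = 1" by (rule inverse_mult_eq_1) (simp add: assms)
      finally have "(\<Sum>i=0..n. fps_nth (inverse f) i * fps_nth f (n - i)) = 0" using False by simp
      moreover have "{0..n} = insert n {..<n}" by auto
      ultimately have "fps_nth (inverse f) n = - (\<Sum>i<n. fps_nth (inverse f) i * fps_nth f (n - i))"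
        using assms(2) by (simp add: eq_neg_iff_add_eq_0)
      also have "\<dots> \<in> R"
        by (intro uminus_R sum_R mult_R RSD[OF assms(1)] less.IH) auto
      finally show ?thesis .
    qed (simp add: assms one_R)
  qed
  then show ?thesis by (simp add: RS_def)
qed

lemma cong_mult: "f - f' \<in> IS \<Longrightarrow> g - g' \<in> IS \<Longrightarrow> f \<in> RS \<Longrightarrow> g' \<in> RS \<Longrightarrow> f * g - f' * g' \<in> IS"
proof -
  assume a: "f - f' \<in> IS" "g - g' \<in> IS" "f \<in> RS" "g' \<in> RS"
  have "f * g - f' * g' = f * (g - g') + (f - f') * g'" by (simp add: algebra_simps)
  then show ?thesis using IS_closed(2)[OF IS_closed(4)[OF a(3,2)] IS_closed(5)[OF a(1,4)]] by simp
qed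

lemma cong_power: "f - g \<in> IS \<Longrightarrow> f \<in> RS \<Longrightarrow> g \<in> RS \<Longrightarrow> f ^ n - g ^ n \<in> IS"
  by (induction n) (simp_all add: IS_closed(1) cong_mult RS_power)

lemma cong_trans: "f - g \<in> IS \<Longrightarrow> g - h \<in> IS \<Longrightarrow> f - h \<in> IS"
  using IS_closed(2)[of "f - g" "g - h"] by simp

lemma frob_add:
  assumes "f \<in> RS" "g \<in> RS"
  shows "(f + g) ^ p - (f ^ p + g ^ p) \<in> IS"
proof -
  have "(f + g) ^ p = (\<Sum>k\<le>p. of_nat (p choose k) * f ^ k * g ^ (p - k))"
    by (rule binomial_ring)
  also have "{..p} = insert 0 (insert p {1..<p})" using p_pos by auto
  finally have "(f + g) ^ p - (f ^ p + g ^ p) = (\<Sum>k\<in>{1..<p}. of_nat (p choose k) * f ^ k * g ^ (p - k))"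
    using p_pos by simp
  also have "\<dots> \<in> IS"
  proof (intro IS_sum)
    fix k assume k: "k \<in> {1..<p}"
    have "p dvd p choose k" using k by (intro dvd_choose_prime prime_p) auto
    then have "of_int (int (p choose k)) \<in> I" by (intro of_int_dvd_I) auto
    then have "of_nat (p choose k) \<in> IS"
      by (auto simp: IS_def zero_I simp flip: fps_of_nat)
    then show "of_nat (p choose k) * f ^ k * g ^ (p - k) \<in> IS"
      by (intro IS_closed(5) RS_power assms)
  qed
  finally show ?thesis .
qed

lemma frob_sum:
  assumes "finite A" "\<And>i. i \<in> A \<Longrightarrow> f i \<in> RS"
  shows "(\<Sum>i\<in>A. f i) ^ p - (\<Sum>i\<in>A. f i ^ p) \<in> IS"
  using assms
proof (induction A rule: finite_induct)
  case empty
  then show ?case using p_pos by (simp add: IS_closed power_0_left)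
next
  case (insert x A)
  have "(f x + (\<Sum>i\<in>A. f i)) ^ p - (f x ^ p + (\<Sum>i\<in>A. f i) ^ p) \<in> IS"
    using insert by (intro frob_add RS_sum) auto
  moreover have "(f x ^ p + (\<Sum>i\<in>A. f i) ^ p) - (f x ^ p + (\<Sum>i\<in>A. f i ^ p)) \<in> IS"
    using insert by simp
  ultimately show ?case using insert(1,2) by (auto intro: cong_trans)
qed

lemma fps_dilate_nth:
  "m > 0 \<Longrightarrow> fps_nth (f oo fps_X ^ m) n = (if m dvd n then fps_nth f (n div m) else (0::complex))"
  by (simp add: fps_nth_compose_X_power)

text \<open>The n-th coefficient of f^p depends only on the truncation T of f after X^n, since f - T
  is divisible by X^(n + 1). For the finite sum T the p-th power is additive modulo
  \<open>I\<close>, and it fixes the coefficients modulo \<open>I\<close> by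
  \<open>frob\<close>.\<close>

lemma frob_fps:
  assumes "f \<in> RS"
  shows "f ^ p - (f oo fps_X ^ p) \<in> IS"
proof -
  have "fps_nth (f ^ p - (f oo fps_X ^ p)) n \<in> I" for n
  proof -
    define T where "T = (\<Sum>i\<le>n. fps_const (fps_nth f i) * fps_X ^ i)"
    define G where "G = fps_shift (Suc n) f"
    have Tn: "fps_nth T j = (if j \<le> n then fps_nth f j else 0)" for j
      by (auto simp: T_def fps_sum_nth fps_X_power_nth if_distrib cong: if_cong)
    have TRS: "T \<in> RS" unfolding T_def by (intro RS_sum RS_closed RS_power RSD assms)
    have GT: "f - T = fps_X ^ Suc n * G"
      by (rule fps_ext) (auto simp: Tn G_def fps_X_power_mult_nth simp del: power_Suc)
    obtain H where H: "f ^ p - T ^ p = (f - T) * H"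
      using power_diff_sumr2[of f p T] by metis
    have 1: "fps_nth (f ^ p) n = fps_nth (T ^ p) n"
    proof -
      have "fps_nth (f ^ p - T ^ p) n = 0" unfolding H GT mult.assoc by (subst fps_X_power_mult_nth) simp
      then show ?thesis by simp
    qed
    have "T ^ p - (\<Sum>i\<le>n. (fps_const (fps_nth f i) * fps_X ^ i) ^ p) \<in> IS"
      unfolding T_def by (intro frob_sum RS_closed RS_power RSD assms) auto
    moreover have "(\<Sum>i\<le>n. (fps_const (fps_nth f i) * fps_X ^ i) ^ p) -
        (\<Sum>i\<le>n. fps_const (fps_nth f i) * fps_X ^ (i * p)) \<in> IS"
    proof -
      have "(\<Sum>i\<le>n. (fps_const (fps_nth f i) * fps_X ^ i) ^ p) - (\<Sum>i\<le>n. fps_const (fps_nth f i) * fps_X ^ (i * p))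
          = (\<Sum>i\<le>n. fps_const (fps_nth f i ^ p - fps_nth f i) * fps_X ^ (i * p))"
        unfolding sum_subtractf[symmetric]
        by (intro sum.cong refl)
           (simp add: power_mult_distrib fps_const_power power_mult left_diff_distrib flip: fps_const_sub)
      also have "\<dots> \<in> IS"
        by (intro IS_sum IS_closed RS_power RS_closed) (auto simp: IS_def zero_I intro: frob RSD assms)
      finally show ?thesis .
    qed
    ultimately have "T ^ p - (\<Sum>i\<le>n. fps_const (fps_nth f i) * fps_X ^ (i * p)) \<in> IS"
      by (rule cong_trans)
    from ISD[OF this, of n]
    have "fps_nth (T ^ p) n - (\<Sum>i\<le>n. if n = i * p then fps_nth f i else 0) \<in> I"
      by (simp add: fps_sum_nth fps_X_power_nth if_distrib cong: if_cong)
    moreover have "(\<Sum>i\<le>n. if n = i * p then fps_nth f i else 0) = fps_nth (f oo fps_X ^ p) n"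
    proof (cases "p dvd n")
      case True
      then obtain j where j: "n = j * p" by (metis dvd_def mult.commute)
      have "j \<le> n" using j p_pos by (cases p) auto
      have "(\<Sum>i\<le>n. if n = i * p then fps_nth f i else 0) = (\<Sum>i\<le>n. if i = j then fps_nth f i else 0)"
        using j p_pos by (intro sum.cong) auto
      also have "\<dots> = fps_nth f j" using \<open>j \<le> n\<close> by simp
      finally show ?thesis using j p_pos by (simp add: fps_dilate_nth)
    next
      case False
      then show ?thesis using p_pos by (auto simp: fps_dilate_nth intro!: sum.neutral)
    qed
    ultimately show ?thesis using 1 by simp
  qed
  then show ?thesis by (simp add: IS_def)
qed

lemma RS_dilate: "f \<in> RS \<Longrightarrow> m > 0 \<Longrightarrow> f oo fps_X ^ m \<in> RS"
  by (auto simp: RS_def fps_dilate_nth zero_R)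

lemma frob_fps_iter:
  assumes "f \<in> RS"
  shows "f ^ (p ^ j) - (f oo fps_X ^ (p ^ j)) \<in> IS"
proof (induction j)
  case 0
  then show ?case by (simp add: IS_closed)
next
  case (Suc j)
  have pj: "p ^ j > 0" and pSj: "p ^ Suc j > 0" using p_pos by simp_all
  define g where "g = f oo fps_X ^ (p ^ j)"
  have g: "g \<in> RS" using RS_dilate[OF assms pj] by (simp add: g_def)
  have "(f ^ (p ^ j)) ^ p - g ^ p \<in> IS"
    using Suc g assms by (intro cong_power RS_power) (auto simp: g_def)
  moreover have "g ^ p - (g oo fps_X ^ p) \<in> IS" by (rule frob_fps[OF g])
  ultimately have "(f ^ (p ^ j)) ^ p - (g oo fps_X ^ p) \<in> IS" by (rule cong_trans)
  moreover have "g oo fps_X ^ p = f oo fps_X ^ (p ^ Suc j)"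
  proof (rule fps_ext)
    fix n
    have "p ^ Suc j dvd n \<longleftrightarrow> p dvd n \<and> p ^ j dvd n div p"
    proof (cases "p dvd n")
      case True
      then obtain m where "n = p * m" by blast
      then show ?thesis using p_pos by simp
    next
      case False
      then show ?thesis using dvd_mult_left[of p "p ^ j" n] by auto
    qed
    then show "fps_nth (g oo fps_X ^ p) n = fps_nth (f oo fps_X ^ (p ^ Suc j)) n"
      unfolding g_def fps_dilate_nth[OF p_pos] fps_dilate_nth[OF pj] fps_dilate_nth[OF pSj]
      by (auto simp: div_mult2_eq)
  qed
  ultimately show ?case by (simp add: power_mult[symmetric] mult.commute)
qed

text \<open>Put m = p^j, V = F^(p - 1) and U = 1 / V. Modulo \<open>I\<close> the power V^m is
  V(x^m), so P is congruent to M U(x^m). The coefficient of U at i appears in P at i m, which lies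
  beyond the degree bound as soon as i >= p; hence U is a polynomial of degree below p modulo
  \<open>I\<close>. Finally F = F^p U is congruent to F(x^p) U(x).\<close>

lemma pair_congruence:
  assumes F: "F \<in> RS" "fps_nth F 0 = 1" and P: "P \<in> RS" "\<And>i. i > (p - 1) * p ^ j \<Longrightarrow> fps_nth P i = 0"
    and M: "\<not> int p dvd M" and eq: "F ^ ((p - 1) * p ^ j) * P - of_int M \<in> IS"
    and n0: "n0 < p"
  shows "fps_nth F (n0 + p * n) - fps_nth F n0 * fps_nth F n \<in> I"
proof -
  define m where "m = p ^ j"
  have m0: "m > 0" using p_pos by (simp add: m_def)
  define V where "V = F ^ (p - 1)"
  define U where "U = inverse V"
  have V: "V \<in> RS" "fps_nth V 0 = 1" using F by (auto simp: V_def RS_power fps_power_zeroth)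
  have U: "U \<in> RS" using RS_inverse[OF V] by (simp add: U_def)
  have VU: "V * U = 1" unfolding U_def by (rule inverse_mult_eq_1') (simp add: V)
  have MRS: "of_int M \<in> RS" by (auto simp: RS_def of_int_R zero_R simp flip: fps_of_int)
  define Vm Um where "Vm = V oo fps_X ^ m" and "Um = U oo fps_X ^ m"
  have RSm: "Vm \<in> RS" "Um \<in> RS" using V U m0 by (auto simp: Vm_def Um_def RS_dilate)
  have "Vm * Um = (V * U) oo fps_X ^ m"
    unfolding Vm_def Um_def using m0 by (intro fps_compose_mult_distrib[symmetric]) (simp add: fps_X_power_nth)
  then have VUm: "Vm * Um = 1" by (simp add: VU)
  have "V ^ m - Vm \<in> IS" unfolding Vm_def m_def by (rule frob_fps_iter[OF V(1)])
  then have "Vm - V ^ m \<in> IS" using IS_closed(3)[OF IS_closed(1)] by fastforce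
  then have "Vm * P - V ^ m * P \<in> IS" using P RSm by (intro cong_mult) (auto simp: IS_closed)
  moreover have "V ^ m * P - of_int M \<in> IS"
    using eq by (simp add: V_def m_def power_mult[symmetric])
  ultimately have "Vm * P - of_int M \<in> IS" by (rule cong_trans)
  then have "Um * (Vm * P - of_int M) \<in> IS" using RSm by (intro IS_closed(4))
  also have "Um * (Vm * P - of_int M) = (Vm * Um) * P - Um * of_int M" by (simp add: algebra_simps)
  finally have PU: "P - Um * of_int M \<in> IS" using VUm by simp
  have Ubig: "fps_nth U i \<in> I" if "i \<ge> p" for i
  proof -
    have "(p - 1) * m < i * m" using that m0 p_pos by simp
    then have "fps_nth P (i * m) = 0" using P(2) by (simp add: m_def)
    then have "fps_nth (Um * fps_const (of_int M)) (i * m) \<in> I"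
      using uminus_I[OF ISD[OF PU, of "i * m"]] by (simp add: fps_of_int)
    then have "of_int M * fps_nth U i \<in> I"
      using m0 by (simp add: Um_def fps_dilate_nth mult.commute)
    then show ?thesis by (rule cancel_unit[OF RSD[OF U] _ M])
  qed
  have pp: "Suc (p - 1) = p" using p_pos by simp
  have "F = F ^ p * U"
  proof -
    have "F ^ p = F * V" unfolding V_def by (metis pp power_Suc)
    then show ?thesis using VU by (simp add: mult.assoc)
  qed
  moreover have "F ^ p * U - (F oo fps_X ^ p) * U \<in> IS"
    using frob_fps[OF F(1)] F U by (intro cong_mult RS_power) (auto simp: IS_closed)
  ultimately have FU: "F - (F oo fps_X ^ p) * U \<in> IS" by simp
  \<comment> \<open>In the convolution only the index p b survives: a multiple p c with c < b leaves
    an index >= p for U, whose coefficient is in \<open>I\<close>, and c > b exceeds a + p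
    b.\<close>
  have key: "fps_nth F (a + p * b) - fps_nth F b * fps_nth U a \<in> I" if a: "a < p" for a b
  proof -
    define N where "N = a + p * b"
    have "fps_nth ((F oo fps_X ^ p) * U) N = (\<Sum>i=0..N. (if p dvd i then fps_nth F (i div p) else 0) * fps_nth U (N - i))"
      using p_pos by (simp add: fps_mult_nth fps_dilate_nth)
    also have "\<dots> = fps_nth F b * fps_nth U a +
        (\<Sum>i\<in>{0..N} - {p * b}. (if p dvd i then fps_nth F (i div p) else 0) * fps_nth U (N - i))"
      using p_pos by (subst sum.remove[of _ "p * b"]) (auto simp: N_def)
    finally have "fps_nth ((F oo fps_X ^ p) * U) N - fps_nth F b * fps_nth U a =
        (\<Sum>i\<in>{0..N} - {p * b}. (if p dvd i then fps_nth F (i div p) else 0) * fps_nth U (N - i))"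
      by simp
    also have "\<dots> \<in> I"
    proof (intro sum_I)
      fix i assume i: "i \<in> {0..N} - {p * b}"
      show "(if p dvd i then fps_nth F (i div p) else 0) * fps_nth U (N - i) \<in> I"
      proof (cases "p dvd i")
        case True
        then obtain c where c: "i = p * c" by auto
        have "c < b"
        proof (rule ccontr)
          assume "\<not> c < b"
          with c i have "c \<ge> Suc b" by auto
          then have "p * Suc b \<le> p * c" by (rule mult_le_mono2)
          then show False using i c a by (simp add: N_def)
        qed
        then have "p * Suc c \<le> p * b" by (intro mult_le_mono2) simp
        then have "N - i \<ge> p" using c by (simp add: N_def)
        then show ?thesis using Ubig RSD[OF F(1)] True by (auto intro: mult_I)
      qed (simp add: zero_I)
    qed
    finally have "fps_nth ((F oo fps_X ^ p) * U) N - fps_nth F b * fps_nth U a \<in> I" .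
    from add_I[OF ISD[OF FU, of N] this] show ?thesis by (simp add: N_def)
  qed
  \<comment> \<open>Taking b = 0 shows that U agrees with F on the digits below p, so U can be
    eliminated.\<close>
  have 1: "fps_nth F n0 - fps_nth U n0 \<in> I" using key[OF n0, of 0] F(2) by simp
  have "fps_nth F n * (fps_nth F n0 - fps_nth U n0) \<in> I"
    using 1 RSD[OF F(1)] by (intro mult_I)
  from diff_I[OF key[OF n0, of n] this] show ?thesis by (simp add: algebra_simps)
qed

text \<open>Because \<open>tq\<close> starts with X, composition with it acts on coefficients by a
  unitriangular matrix over \<open>R\<close>, which is inverted recursively. The set
  \<open>S\<close> is \<open>R\<close> for integrality statements and \<open>I\<close> for
  congruences.\<close>

lemma fps_compose_unitriangular:
  assumes tq: "tq \<in> RS" "fps_nth tq 0 = 0" "fps_nth tq 1 = 1"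
    and S: "\<And>x y. x \<in> S \<Longrightarrow> y \<in> S \<Longrightarrow> x - y \<in> S" "\<And>x y. x \<in> S \<Longrightarrow> y \<in> R \<Longrightarrow> x * y \<in> S" "0 \<in> S"
    and G: "\<And>n. fps_nth (G oo tq) n \<in> S"
  shows "fps_nth G n \<in> S"
proof (induction n rule: less_induct)
  case (less n)
  have diag: "fps_nth (tq ^ n) n = 1"
  proof -
    have "tq = fps_X * fps_shift 1 tq"
      by (rule fps_ext) (auto simp: fps_X_mult_nth tq)
    then have "tq ^ n = fps_X ^ n * fps_shift 1 tq ^ n" by (metis power_mult_distrib)
    then show ?thesis using tq(3) by (simp add: fps_X_power_mult_nth fps_power_zeroth)
  qed
  have "{0..n} = insert n {..<n}" by auto
  then have eq: "fps_nth (G oo tq) n = fps_nth G n + (\<Sum>i<n. fps_nth G i * fps_nth (tq ^ i) n)"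
    by (simp add: fps_compose_nth diag)
  have neg: "x \<in> S \<Longrightarrow> - x \<in> S" for x using S(1)[OF S(3), of x] by simp
  have addS: "x \<in> S \<Longrightarrow> y \<in> S \<Longrightarrow> x + y \<in> S" for x y using S(1)[of x "- y"] neg[of y] by simp
  have sumS: "(\<And>i. i \<in> A \<Longrightarrow> f i \<in> S) \<Longrightarrow> sum f A \<in> S" for A :: "nat set" and f
    by (induction A rule: infinite_finite_induct) (auto intro: S(3) addS)
  have "(\<Sum>i<n. fps_nth G i * fps_nth (tq ^ i) n) \<in> S"
    by (intro sumS S(2) less.IH RSD RS_power tq) auto
  from S(1)[OF G[of n] this] show ?case by (simp add: eq)
qed

text \<open>The identity in q is pulled back along the substitution x = t(q) to one for F itself;
  then the congruence for a + p b strips off the lowest digit, by induction on the number of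
  digits.\<close>

theorem digit_congruence:
  assumes tq: "tq \<in> RS" "fps_nth tq 0 = 0" "fps_nth tq 1 = 1"
    and Zq: "Zq \<in> RS" "fps_nth Zq 0 = 1" and F: "F oo tq = Zq"
    and k: "k = (p - 1) * p ^ j"
    and E: "E - of_int M \<in> IS" "\<not> int p dvd M"
    and eq: "E = Zq ^ k * (\<Sum>i\<le>k. fps_const (c i) * tq ^ i)"
    and n: "n = (\<Sum>i\<le>s. ns i * p ^ i)" "\<And>i. i \<le> s \<Longrightarrow> ns i < p"
  shows "fps_nth F n - (\<Prod>i\<le>s. fps_nth F (ns i)) \<in> I" and "\<And>n. fps_nth F n \<in> R"
proof -
  define P where "P = (\<Sum>i\<le>k. fps_const (c i) * fps_X ^ i)"
  have Pt: "P oo tq = (\<Sum>i\<le>k. fps_const (c i) * tq ^ i)"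
    unfolding P_def
    by (simp add: fps_compose_sum_distrib fps_compose_mult_distrib[OF tq(2)] fps_X_power_compose[OF tq(2)]
        fps_compose_power[OF tq(2), symmetric] tq(2))
  have F_R: "fps_nth F n \<in> R" for n
    by (rule fps_compose_unitriangular[OF tq, where S = R]) (auto intro: diff_R mult_R zero_R simp: F RSD[OF Zq(1)])
  then show "\<And>n. fps_nth F n \<in> R" .
  have F_RS: "F \<in> RS" using F_R by (simp add: RS_def)
  have F0: "fps_nth F 0 = 1" using arg_cong[OF F, of "\<lambda>f. fps_nth f 0"] Zq(2) by simp
  have MRS: "of_int M \<in> RS" by (auto simp: RS_def of_int_R zero_R simp flip: fps_of_int)
  have ERS: "E \<in> RS" using RS_closed(3)[OF IS_RS[OF E(1)] MRS] by simp
  have Zk: "Zq ^ k \<in> RS" "fps_nth (Zq ^ k) 0 = 1" using Zq by (auto simp: RS_power fps_power_zeroth)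
  \<comment> \<open>The \<open>c i\<close> are merely complex numbers. That P has coefficients in
    \<open>R\<close> is deduced here by solving for P(t), as Zq^k has constant term 1 and so is
    invertible over \<open>R\<close>.\<close>
  have "inverse (Zq ^ k) * E = (inverse (Zq ^ k) * Zq ^ k) * (P oo tq)"
    by (simp add: eq Pt mult.assoc)
  also have "inverse (Zq ^ k) * Zq ^ k = 1" by (rule inverse_mult_eq_1) (use Zk in simp)
  finally have PtRS: "P oo tq \<in> RS" using RS_closed(5)[OF RS_inverse[OF Zk] ERS] by simp
  have "fps_nth P n \<in> R" for n
    by (rule fps_compose_unitriangular[OF tq, where S = R]) (auto intro: diff_R mult_R zero_R RSD[OF PtRS])
  then have P_RS: "P \<in> RS" by (simp add: RS_def)
  have P_big: "fps_nth P i = 0" if "i > k" for i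
    using that by (auto simp: P_def fps_sum_nth fps_X_power_nth intro!: sum.neutral)
  have "(F ^ k * P - of_int M) oo tq = E - of_int M"
    by (simp add: fps_compose_sub_distrib fps_compose_mult_distrib[OF tq(2)] fps_compose_power[OF tq(2), symmetric]
        F Pt eq flip: fps_of_int)
  then have ct: "fps_nth ((F ^ k * P - of_int M) oo tq) n \<in> I" for n using ISD[OF E(1)] by simp
  have mult_I': "x * y \<in> I" if "x \<in> I" "y \<in> R" for x y
    using mult_I[OF that(2,1)] by (simp add: mult.commute)
  have "fps_nth (F ^ k * P - of_int M) n \<in> I" for n
    by (rule fps_compose_unitriangular[OF tq, where S = I]) (auto intro: diff_I zero_I mult_I' ct)
  then have FP: "F ^ k * P - of_int M \<in> IS" by (simp add: IS_def)
  have pair: "fps_nth F (a + p * b) - fps_nth F a * fps_nth F b \<in> I" if "a < p" for a b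
    by (rule pair_congruence[OF F_RS F0 P_RS _ E(2) _ that, of j b]) (use P_big FP in \<open>simp_all add: k\<close>)
  show "fps_nth F n - (\<Prod>i\<le>s. fps_nth F (ns i)) \<in> I"
    using n
  proof (induction s arbitrary: n ns)
    case 0
    then show ?case by (simp add: zero_I)
  next
    case (Suc s)
    define b where "b = (\<Sum>i\<le>s. ns (Suc i) * p ^ i)"
    have nb: "n = ns 0 + p * b"
      unfolding Suc.prems(1) b_def by (subst sum.atMost_Suc_shift) (simp add: sum_distrib_left mult_ac)
    have c1: "fps_nth F n - fps_nth F (ns 0) * fps_nth F b \<in> I"
      unfolding nb using Suc.prems(2) by (intro pair) simp
    have c2: "fps_nth F (ns 0) * (fps_nth F b - (\<Prod>i\<le>s. fps_nth F (ns (Suc i)))) \<in> I"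
      by (intro mult_I F_R Suc.IH[of b "\<lambda>i. ns (Suc i)"]) (use Suc.prems(2) in \<open>auto simp: b_def\<close>)
    have "fps_nth F n - fps_nth F (ns 0) * (\<Prod>i\<le>s. fps_nth F (ns (Suc i))) \<in> I"
      using add_I[OF c1 c2] by (simp add: right_diff_distrib)
    then show ?case by (subst prod.atMost_Suc_shift)
  qed
qed

end


section \<open>Reduction of the coefficient ring modulo p through its embedding into the p-adic
  integers\<close>

lemma padic_ring_simps:
  "x \<oplus>\<^bsub>padic_int_ring p\<^esub> y = (\<lambda>n. (x n + y n) mod int p ^ n)"
  "x \<otimes>\<^bsub>padic_int_ring p\<^esub> y = (\<lambda>n. (x n * y n) mod int p ^ n)"
  "\<zero>\<^bsub>padic_int_ring p\<^esub> = (\<lambda>n. 0)" "\<one>\<^bsub>padic_int_ring p\<^esub> = (\<lambda>n. 1 mod int p ^ n)"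
  by (simp_all add: padic_int_ring_def)

lemma padic_range: "x \<in> carrier (padic_int_ring p) \<Longrightarrow> x n \<in> {0..<int p ^ n}"
  by (auto simp: padic_int_ring_def)

lemma padic_nat_mult_one:
  assumes "p > 0"
  shows "[(m::nat)] \<cdot>\<^bsub>padic_int_ring p\<^esub> \<one>\<^bsub>padic_int_ring p\<^esub> = (\<lambda>n. int m mod int p ^ n)"
proof (induction m)
  case 0
  then show ?case by (simp add: add_pow_def nat_pow_def padic_ring_simps)
next
  case (Suc m)
  interpret cring "padic_int_ring p" by (rule padic_int_ring_cring[OF assms])
  have "[Suc m] \<cdot>\<^bsub>padic_int_ring p\<^esub> \<one>\<^bsub>padic_int_ring p\<^esub> =
      [m] \<cdot>\<^bsub>padic_int_ring p\<^esub> \<one>\<^bsub>padic_int_ring p\<^esub> \<oplus>\<^bsub>padic_int_ring p\<^esub> \<one>\<^bsub>padic_int_ring p\<^esub>"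
    by simp
  then show ?case unfolding Suc unfolding padic_ring_simps by (simp add: mod_simps add.commute)
qed

text \<open>Division by p costs one level of precision: at level n the quotient is y(n + 1) / p,
  which makes sense because every y(n + 1) reduces to y(1) = 0 modulo p.\<close>

lemma padic_in_ideal_p:
  assumes p: "p > 0" and y: "y \<in> carrier (padic_int_ring p)" "y 1 = 0"
  shows "y \<in> PIdl\<^bsub>padic_int_ring p\<^esub> ([p] \<cdot>\<^bsub>padic_int_ring p\<^esub> \<one>\<^bsub>padic_int_ring p\<^esub>)"
proof -
  interpret cring "padic_int_ring p" by (rule padic_int_ring_cring[OF p])
  have dvd: "int p dvd y (Suc n)" for n
  proof (induction n)
    case (Suc n)
    have "y (Suc (Suc n)) mod int p ^ Suc n = y (Suc n)" using padic_reduce[OF y(1)] by blast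
    then have "y (Suc (Suc n)) mod int p ^ Suc n mod int p = 0" using Suc by simp
    then show ?case by (simp add: mod_mod_cancel mod_eq_0_iff_dvd)
  qed (use y in simp)
  define g where "g = (\<lambda>n. y (Suc n) div int p)"
  have gy: "y (Suc n) = int p * g n" for n using dvd[of n] by (simp add: g_def)
  have "[g (Suc n) = g n] (mod int p ^ n)" for n
  proof -
    have "[int p * g (Suc n) = int p * g n] (mod int p * int p ^ n)"
      using padic_cong[OF y(1), of "Suc n"] by (simp add: gy)
    then show ?thesis using p by (simp add: cong_iff_dvd_diff flip: right_diff_distrib)
  qed
  then have z: "(\<lambda>n. g n mod int p ^ n) \<in> carrier (padic_int_ring p)" by (rule padic_closedI[OF p])
  have yn: "y n = (g n mod int p ^ n * (int p mod int p ^ n)) mod int p ^ n" for n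
  proof -
    have "y n = y (Suc n) mod int p ^ n" using padic_reduce[OF y(1)] by simp
    then show ?thesis by (simp add: gy mod_simps mult.commute)
  qed
  have "y = (\<lambda>n. g n mod int p ^ n) \<otimes>\<^bsub>padic_int_ring p\<^esub> ([p] \<cdot>\<^bsub>padic_int_ring p\<^esub> \<one>\<^bsub>padic_int_ring p\<^esub>)"
    unfolding padic_nat_mult_one[OF p] unfolding padic_ring_simps(2) using yn by (rule ext)
  then show ?thesis using z unfolding cgenideal_def by blast
qed

lemma fermat_int:
  assumes "Factorial_Ring.prime p" "x \<ge> 0"
  shows "x ^ p mod int p = x mod int p"
proof -
  obtain a where a: "x = int a" using assms(2) by (metis nonneg_int_cases)
  have "a ^ p mod p = a mod p"
  proof (cases "p dvd a")
    case True
    then have "p dvd a ^ p" using assms(1) by (simp add: prime_gt_0_nat dvd_power_iff_le dvd_trans[OF _ dvd_power])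
    with True show ?thesis by (simp add: mod_eq_0_iff_dvd)
  next
    case False
    then have "[a ^ (p - 1) * a = 1 * a] (mod p)"
      by (intro cong_mult cong_refl fermat_theorem assms)
    moreover have "a ^ (p - 1) * a = a ^ p"
      using prime_gt_0_nat[OF assms(1)] by (metis power_minus_mult)
    ultimately show ?thesis by (simp add: cong_def)
  qed
  then show ?thesis unfolding a by (metis of_nat_mod of_nat_power)
qed

context
  fixes R :: "complex set" and p :: nat and \<phi> :: "complex \<Rightarrow> nat \<Rightarrow> int"
  assumes R: "subring R (ring_of_type_algebra :: complex ring)"
    and p: "Factorial_Ring.prime p" and emb: "padic_embedding R p \<phi>"
begin

text \<open>The preimage of the maximal ideal, so that the residue ring of \<open>R\<close> embeds
  into the field with p elements.\<close>

definition padic_kernel :: "complex set" where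
  "padic_kernel = {x \<in> R. \<phi> x \<in> PIdl\<^bsub>padic_int_ring p\<^esub> ([p] \<cdot>\<^bsub>padic_int_ring p\<^esub> \<one>\<^bsub>padic_int_ring p\<^esub>)}"

lemma subring_R:
  "0 \<in> R" "1 \<in> R" "x \<in> R \<Longrightarrow> y \<in> R \<Longrightarrow> x + y \<in> R" "x \<in> R \<Longrightarrow> y \<in> R \<Longrightarrow> x * y \<in> R" "x \<in> R \<Longrightarrow> - x \<in> R"
proof -
  interpret S: subring R "ring_of_type_algebra :: complex ring" by (rule R)
  interpret cring "ring_of_type_algebra :: complex ring" by (rule cring_from_type_algebra)
  show "0 \<in> R" using S.subgroup_axioms subgroup.one_closed by (fastforce simp: ring_of_type_algebra_def)
  show "1 \<in> R" using S.one_closed by (simp add: ring_of_type_algebra_def)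
  show "x + y \<in> R" if "x \<in> R" "y \<in> R" for x y
    using subgroup.m_closed[OF S.subgroup_axioms that] by (simp add: ring_of_type_algebra_def)
  show mult: "x * y \<in> R" if "x \<in> R" "y \<in> R" for x y
    using S.m_closed[OF that] by (simp add: ring_of_type_algebra_def)
  have "\<ominus>\<^bsub>ring_of_type_algebra\<^esub> x = - x" for x :: complex
    by (rule minus_equality) (auto simp: ring_of_type_algebra_def)
  then show "- x \<in> R" if "x \<in> R"
    using subgroup.m_inv_closed[OF S.subgroup_axioms that] by (simp add: a_inv_def)
qed

lemma phi_hom:
  "x \<in> R \<Longrightarrow> \<phi> x \<in> carrier (padic_int_ring p)"
  "x \<in> R \<Longrightarrow> y \<in> R \<Longrightarrow> \<phi> (x * y) = \<phi> x \<otimes>\<^bsub>padic_int_ring p\<^esub> \<phi> y"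
  "x \<in> R \<Longrightarrow> y \<in> R \<Longrightarrow> \<phi> (x + y) = \<phi> x \<oplus>\<^bsub>padic_int_ring p\<^esub> \<phi> y"
  "\<phi> 1 = \<one>\<^bsub>padic_int_ring p\<^esub>"
  using emb by (auto simp: padic_embedding_def ring_hom_def ring_of_type_algebra_def)

lemma phi_zero: "\<phi> 0 = \<zero>\<^bsub>padic_int_ring p\<^esub>"
proof -
  interpret cring "padic_int_ring p" by (rule padic_int_ring_cring[OF prime_gt_0_nat[OF p]])
  show ?thesis using phi_hom(3)[of 0 0] phi_hom(1)[of 0] subring_R(1) by simp
qed

lemma phi_diff:
  assumes "x \<in> R" "y \<in> R"
  shows "\<phi> (x - y) = \<phi> x \<ominus>\<^bsub>padic_int_ring p\<^esub> \<phi> y"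
proof -
  interpret cring "padic_int_ring p" by (rule padic_int_ring_cring[OF prime_gt_0_nat[OF p]])
  have "\<phi> (- y) \<oplus>\<^bsub>padic_int_ring p\<^esub> \<phi> y = \<zero>\<^bsub>padic_int_ring p\<^esub>"
    using phi_hom(3)[of "- y" y] assms subring_R(5) phi_zero by simp
  then have "\<phi> (- y) = \<ominus>\<^bsub>padic_int_ring p\<^esub> \<phi> y"
    using assms subring_R(5) phi_hom(1) by (metis minus_equality)
  then show ?thesis using phi_hom(3)[of x "- y"] assms subring_R(5) by (simp add: a_minus_def)
qed

text \<open>Only the Frobenius axiom has content. The component with index 1 of a p-adic integer is
  its residue modulo p; Fermat's theorem makes that component of the image of x^p - x vanish, and an
  element with this property is a multiple of p.\<close>

lemma residue_ring_padic: "residue_ring_mod_p R padic_kernel p"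
proof -
  have p0: "p > 0" by (rule prime_gt_0_nat[OF p])
  interpret cring "padic_int_ring p" by (rule padic_int_ring_cring[OF p0])
  define J where "J = PIdl\<^bsub>padic_int_ring p\<^esub> ([p] \<cdot>\<^bsub>padic_int_ring p\<^esub> \<one>\<^bsub>padic_int_ring p\<^esub>)"
  have pc: "[p] \<cdot>\<^bsub>padic_int_ring p\<^esub> \<one>\<^bsub>padic_int_ring p\<^esub> \<in> carrier (padic_int_ring p)" by simp
  interpret J: ideal J "padic_int_ring p" unfolding J_def by (rule cgenideal_ideal[OF pc])
  have nat_R: "of_nat n \<in> R \<and> \<phi> (of_nat n) = [n] \<cdot>\<^bsub>padic_int_ring p\<^esub> \<one>\<^bsub>padic_int_ring p\<^esub>" for n
  proof (induction n)
    case (Suc n)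
    then have "\<phi> (of_nat n + 1) = \<phi> (of_nat n) \<oplus>\<^bsub>padic_int_ring p\<^esub> \<phi> 1"
      by (intro phi_hom(3)) (auto simp: subring_R)
    then show ?case using Suc subring_R by (simp add: phi_hom(4) add.commute)
  qed (simp add: subring_R phi_zero)
  have pow: "x ^ n \<in> R \<and> \<phi> (x ^ n) 1 = \<phi> x 1 ^ n mod int p" if "x \<in> R" for x n
  proof (induction n)
    case (Suc n)
    then have "\<phi> (x * x ^ n) = \<phi> x \<otimes>\<^bsub>padic_int_ring p\<^esub> \<phi> (x ^ n)"
      by (intro phi_hom(2)) (use that in auto)
    then show ?case using Suc subring_R that by (simp add: padic_ring_simps mod_simps)
  qed (simp add: subring_R phi_hom(4) padic_ring_simps)
  show ?thesis
  proof
    fix x assume x: "x \<in> R"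
    have diff: "x ^ p - x \<in> R" using subring_R(3)[of "x ^ p" "- x"] subring_R(5) pow[OF x] x by simp
    have c: "\<phi> (x ^ p - x) \<in> carrier (padic_int_ring p)" "\<phi> x \<in> carrier (padic_int_ring p)"
      using phi_hom(1) diff x by auto
    have "\<phi> (x ^ p - x + x) = \<phi> (x ^ p - x) \<oplus>\<^bsub>padic_int_ring p\<^esub> \<phi> x"
      by (rule phi_hom(3)[OF diff x])
    then have "\<phi> (x ^ p) 1 = (\<phi> (x ^ p - x) 1 + \<phi> x 1) mod int p"
      by (simp add: padic_ring_simps)
    then have "(\<phi> (x ^ p - x) 1 + \<phi> x 1) mod int p = \<phi> x 1 mod int p"
      using pow[OF x, of p] fermat_int[OF p, of "\<phi> x 1"] padic_range[OF c(2), of 1] by simp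
    then have "int p dvd \<phi> (x ^ p - x) 1" by (simp add: mod_eq_dvd_iff)
    moreover have "\<phi> (x ^ p - x) 1 \<in> {0..<int p}" using padic_range[OF c(1), of 1] by simp
    ultimately have "\<phi> (x ^ p - x) 1 = 0" by (metis atLeastLessThan_iff le_less zdvd_not_zless)
    then show "x ^ p - x \<in> padic_kernel"
      unfolding padic_kernel_def using padic_in_ideal_p[OF p0 c(1)] diff by simp
  next
    show "padic_kernel \<subseteq> R" by (auto simp: padic_kernel_def)
    show "0 \<in> padic_kernel"
      unfolding padic_kernel_def J_def[symmetric] using subring_R phi_zero by simp
    show "of_nat p \<in> padic_kernel"
      using nat_R[of p] cgenideal_self[OF pc] by (simp add: padic_kernel_def)
  next
    fix x y assume "x \<in> padic_kernel" "y \<in> padic_kernel"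
    then show "x + y \<in> padic_kernel"
      unfolding padic_kernel_def J_def[symmetric] using subring_R(3) phi_hom(3) by auto
  next
    fix x y assume "x \<in> R" "y \<in> padic_kernel"
    then show "x * y \<in> padic_kernel"
      unfolding padic_kernel_def J_def[symmetric] using subring_R(4) phi_hom(1,2) J.I_l_closed by auto
  qed (use subring_R p in auto)
qed

lemma phi_prod:
  assumes "\<And>n. a n \<in> R"
  shows "(\<Otimes>\<^bsub>padic_int_ring p\<^esub>i\<in>{..s::nat}. \<phi> (a i)) = \<phi> (\<Prod>i\<le>s. a i)"
proof -
  interpret cring "padic_int_ring p" by (rule padic_int_ring_cring[OF prime_gt_0_nat[OF p]])
  interpret residue_ring_mod_p R padic_kernel p by (rule residue_ring_padic)
  show ?thesis
  proof (induction s)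
    case 0
    then show ?case using phi_hom(1)[OF assms] by (simp add: finprod_insert)
  next
    case (Suc s)
    have "{..Suc s} = insert (Suc s) {..s}" by auto
    then have "(\<Otimes>\<^bsub>padic_int_ring p\<^esub>i\<in>{..Suc s}. \<phi> (a i)) = \<phi> (a (Suc s)) \<otimes>\<^bsub>padic_int_ring p\<^esub> \<phi> (\<Prod>i\<le>s. a i)"
      using phi_hom(1)[OF assms] Suc by (simp add: finprod_insert)
    also have "\<dots> = \<phi> (a (Suc s) * (\<Prod>i\<le>s. a i))"
      by (rule phi_hom(2)[symmetric]) (auto intro: assms prod_R)
    finally show ?case by (simp add: mult.commute)
  qed
qed

theorem lucas_from_expansion:
  assumes tq: "\<And>n. fps_nth tq n \<in> R" "fps_nth tq 0 = 0" "fps_nth tq 1 = 1"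
    and Zq: "\<And>n. fps_nth Zq n \<in> R" "fps_nth Zq 0 = 1"
    and T: "Abs_fps T oo tq = Zq"
    and k: "k = (p - 1) * p ^ j"
    and M: "\<not> int p dvd M"
    and eq: "of_int M + of_nat p * Abs_fps (\<lambda>n. of_int (b n)) = Zq ^ k * (\<Sum>i\<le>k. fps_const (c i) * tq ^ i)"
  shows "lucas_congruences p (\<lambda>n. \<phi> (T n))"
proof -
  interpret residue_ring_mod_p R padic_kernel p by (rule residue_ring_padic)
  have "fps_nth (of_nat p * Abs_fps (\<lambda>n. of_int (b n))) n \<in> padic_kernel" for n
    using mult_I[OF of_int_R p_I, of "b n"] by (simp add: mult.commute flip: fps_of_nat)
  then have E: "(of_int M + of_nat p * Abs_fps (\<lambda>n. of_int (b n))) - of_int M \<in> IS" by (simp add: IS_def)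
  have RS: "tq \<in> RS" "Zq \<in> RS" using tq Zq by (auto simp: RS_def)
  note dc = digit_congruence[OF RS(1) tq(2,3) RS(2) Zq(2) T k E M eq]
  \<comment> \<open>The second conclusion of \<open>digit_congruence\<close> does not involve the
    digits, so the one-digit expansion of 0 is supplied to discharge the premises.\<close>
  have TR: "T n \<in> R" for n
    using dc(2)[of "\<Sum>i\<le>0. (\<lambda>_. 0) i * p ^ i" "\<lambda>_. 0" 0 n] p_pos by simp
  show ?thesis unfolding lucas_congruences_def
  proof (intro allI impI)
    fix n s ns assume ns: "(\<forall>i\<le>s. ns i \<le> p - 1) \<and> n = (\<Sum>i\<le>s. ns i * p ^ i)"
    then have nsp: "ns i < p" if "i \<le> s" for i
    proof -
      have "ns i \<le> p - 1" using ns that by blast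
      then show ?thesis using p_pos by linarith
    qed
    have PR: "(\<Prod>i\<le>s. T (ns i)) \<in> R" by (intro prod_R TR)
    have "T n - (\<Prod>i\<le>s. T (ns i)) \<in> padic_kernel"
      using dc(1)[of n ns s] ns nsp by simp
    then show "padic_cong_mod_p p (\<phi> (T n)) (\<Otimes>\<^bsub>padic_int_ring p\<^esub>i\<in>{..s}. \<phi> (T (ns i)))"
      unfolding phi_prod[OF TR] padic_cong_mod_p_def
      using phi_diff[OF TR PR, of n] by (simp add: padic_kernel_def)
  qed
qed

end


section \<open>Functions of a nonconstant holomorphic map\<close>

text \<open>\<open>D\<close> is not assumed connected, so nonconstancy is stated near each point and
  the open mapping theorem is applied on small balls.\<close>

lemma nonconstant_open_map:
  fixes t :: "complex \<Rightarrow> complex"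
  assumes hol: "t holomorphic_on D" and D: "open D"
    and nc: "\<And>z. z \<in> D \<Longrightarrow> \<forall>\<^sub>F w in at z. t w \<noteq> t z"
    and U: "open U" "U \<subseteq> D"
  shows "open (t ` U)"
  unfolding open_subopen[of "t ` U"]
proof (intro ballI)
  fix y assume "y \<in> t ` U"
  then obtain z where z: "z \<in> U" and y: "y = t z" by blast
  then obtain r where r: "r > 0" "ball z r \<subseteq> U" using U(1) open_contains_ball by blast
  have "open (t ` ball z r)"
  proof (rule open_mapping_thm[where S = "ball z r"])
    show "t holomorphic_on ball z r" using hol r U by (meson holomorphic_on_subset subset_trans)
    show "\<not> t constant_on ball z r"
    proof
      assume "t constant_on ball z r"
      then have eq: "t w = t z" if "w \<in> ball z r" for w
        using that r by (auto simp: constant_on_def)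
      have "\<forall>\<^sub>F w in at z. t w \<noteq> t z" using nc z U by auto
      moreover have "\<forall>\<^sub>F w in at z. w \<in> ball z r" by (rule eventually_at_in_open') (use r in auto)
      ultimately have "\<forall>\<^sub>F w in at z. False" by eventually_elim (use eq in auto)
      then show False by simp
    qed
  qed auto
  then show "\<exists>T. open T \<and> y \<in> T \<and> T \<subseteq> t ` U"
    using r y by (intro exI[of _ "t ` ball z r"]) auto
qed

lemma factor_through_open_map:
  fixes t f :: "complex \<Rightarrow> complex"
  assumes holt: "t holomorphic_on D" and holf: "f holomorphic_on D" and D: "open D"
    and nc: "\<And>z. z \<in> D \<Longrightarrow> \<forall>\<^sub>F w in at z. t w \<noteq> t z"
    and h: "\<And>z. z \<in> D \<Longrightarrow> h (t z) = f z"
  shows "h holomorphic_on t ` D"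
proof -
  note om = nonconstant_open_map[OF holt D nc]
  have contf: "continuous_on D f" using holf by (rule holomorphic_on_imp_continuous_on)
  have cont: "isCont h (t z)" if z: "z \<in> D" for z
    unfolding continuous_at_eps_delta
  proof (intro allI impI)
    fix e :: real assume e: "e > 0"
    have "open (D \<inter> f -` ball (f z) e)"
      by (rule continuous_open_preimage[OF contf D open_ball])
    then have "open (f -` ball (f z) e \<inter> D)" by (simp add: Int_commute)
    then have "open (t ` (f -` ball (f z) e \<inter> D))" by (intro om) auto
    moreover have "t z \<in> t ` (f -` ball (f z) e \<inter> D)" using z e by auto
    ultimately obtain d where d: "d > 0" "ball (t z) d \<subseteq> t ` (f -` ball (f z) e \<inter> D)"
      using open_contains_ball by blast
    have "dist (h w) (h (t z)) < e" if "dist w (t z) < d" for w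
    proof -
      have "w \<in> ball (t z) d" using that by (simp add: dist_commute)
      then obtain v where "w = t v" "v \<in> D" "dist (f z) (f v) < e" using d by auto
      then show ?thesis using h z by (simp add: dist_commute)
    qed
    with d show "\<exists>d>0. \<forall>w. dist w (t z) < d \<longrightarrow> dist (h w) (h (t z)) < e" by auto
  qed
  have regular: "h field_differentiable (at (t z))" if z: "z \<in> D" "deriv t z \<noteq> 0" for z
  proof -
    obtain r where r: "r > 0" "ball z r \<subseteq> D" "inj_on t (ball z r)"
      using has_complex_derivative_locally_injective[OF holt z(1) D z(2)] by metis
    have holB: "t holomorphic_on ball z r" by (rule holomorphic_on_subset[OF holt r(2)])
    obtain g where g: "g holomorphic_on t ` ball z r" "\<And>w. w \<in> ball z r \<Longrightarrow> g (t w) = w"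
      using holomorphic_has_inverse[OF holB open_ball r(3)] by metis
    have "f \<circ> g holomorphic_on t ` ball z r"
      by (rule holomorphic_on_compose_gen[OF g(1) holf]) (use g(2) r in auto)
    then have "h holomorphic_on t ` ball z r"
      by (rule holomorphic_transform) (use g(2) h r in auto)
    moreover have "open (t ` ball z r)" by (rule om) (use r in auto)
    ultimately show ?thesis
      using r by (intro holomorphic_on_imp_differentiable_at[of h "t ` ball z r"]) auto
  qed
  have "h field_differentiable (at (t z))" if z: "z \<in> D" for z
  proof (cases "deriv t z = 0")
    case True
    obtain r0 where r0: "r0 > 0" "ball z r0 \<subseteq> D" using z D open_contains_ball by blast
    have hd: "deriv t holomorphic_on ball z r0"
      using holomorphic_on_subset[OF holt r0(2)] by (intro holomorphic_deriv) auto
    have "\<exists>w\<in>ball z r0. deriv t w \<noteq> 0"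
    proof (rule ccontr)
      assume *: "\<not> ?thesis"
      have "t constant_on ball z r0"
      proof -
        have "(t has_field_derivative 0) (at w within ball z r0)" if "w \<in> ball z r0" for w
          using holomorphic_derivI[OF holomorphic_on_subset[OF holt r0(2)] open_ball that] * that
          by (metis has_field_derivative_at_within)
        then show ?thesis using has_field_derivative_zero_constant[of "ball z r0" t]
          by (auto simp: constant_on_def)
      qed
      then have eq: "t w = t z" if "w \<in> ball z r0" for w
        using that r0 by (auto simp: constant_on_def)
      have "\<forall>\<^sub>F w in at z. t w \<noteq> t z" using nc z by auto
      moreover have "\<forall>\<^sub>F w in at z. w \<in> ball z r0" by (rule eventually_at_in_open') (use r0 in auto)
      ultimately have "\<forall>\<^sub>F w in at z. False" by eventually_elim (use eq in auto)
      then show False by simp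
    qed
    then obtain b where b: "b \<in> ball z r0" "deriv t b \<noteq> 0" by auto
    obtain r where r: "r > 0" "ball z r \<subseteq> ball z r0" "\<And>w. w \<in> ball z r - {z} \<Longrightarrow> deriv t w \<noteq> 0"
      using isolated_zeros[OF hd open_ball connected_ball _ True b] r0 by auto
    have o: "open (t ` ball z r)" by (rule om) (use r r0 in auto)
    have "h holomorphic_on t ` ball z r"
    proof (rule no_isolated_singularity)
      show "continuous_on (t ` ball z r) h"
        using cont r r0 by (intro continuous_at_imp_continuous_on) auto
      show "h holomorphic_on t ` ball z r - {t z}"
      proof (rule holomorphic_onI)
        fix w assume "w \<in> t ` ball z r - {t z}"
        then obtain v where "v \<in> ball z r" "w = t v" "t v \<noteq> t z" by blast
        then have v: "v \<in> ball z r - {z}" "w = t v" by auto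
        moreover have "v \<in> D" using \<open>v \<in> ball z r\<close> r r0 by blast
        ultimately have "h field_differentiable at w" using regular[of v] r by auto
        then show "h field_differentiable at w within t ` ball z r - {t z}"
          by (rule field_differentiable_at_within)
      qed
    qed (use o in auto)
    then show ?thesis
      using r o by (intro holomorphic_on_imp_differentiable_at[of h "t ` ball z r"]) auto
  qed (use regular z in auto)
  then show ?thesis
    by (metis (no_types, lifting) field_differentiable_at_within holomorphic_onI imageE)
qed

text \<open>f descends to a function h on the image of t. Since f is constant on fibres, the bounds
  in \<open>miss\<close> and \<open>inf\<close> are needed at one preimage only. The first lets h
  extend over the values missed by t, the second bounds the resulting entire function by a multiple
  of |w|^k for large |w|.\<close>

theorem polynomial_in_open_map:
  fixes t f :: "complex \<Rightarrow> complex"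
  assumes holt: "t holomorphic_on D" and holf: "f holomorphic_on D" and D: "open D"
    and nc: "\<And>z. z \<in> D \<Longrightarrow> \<forall>\<^sub>F w in at z. t w \<noteq> t z"
    and fib: "\<And>z z'. z \<in> D \<Longrightarrow> z' \<in> D \<Longrightarrow> t z = t z' \<Longrightarrow> f z = f z'"
    and miss: "\<And>c. c \<notin> t ` D \<Longrightarrow> \<exists>r>0. \<exists>C. \<forall>w. 0 < dist w c \<and> dist w c < r \<longrightarrow> (\<exists>z\<in>D. t z = w \<and> norm (f z) \<le> C)"
    and inf: "\<exists>r C. \<forall>w. norm w > r \<longrightarrow> (\<exists>z\<in>D. t z = w \<and> norm (f z) \<le> C * norm w ^ k)"
  shows "\<exists>a. \<forall>z\<in>D. f z = (\<Sum>i\<le>k. a i * t z ^ i)"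
proof -
  define h where "h = (\<lambda>w. f (SOME z. z \<in> D \<and> t z = w))"
  have h: "h (t z) = f z" if "z \<in> D" for z
  proof -
    have "(SOME z'. z' \<in> D \<and> t z' = t z) \<in> D \<and> t (SOME z'. z' \<in> D \<and> t z' = t z) = t z"
      by (rule someI[of _ z]) (use that in auto)
    then show ?thesis unfolding h_def using fib that by blast
  qed
  have hol: "h holomorphic_on t ` D" by (rule factor_through_open_map[OF holt holf D nc h])
  have oW: "open (t ` D)" by (rule nonconstant_open_map[OF holt D nc D order_refl])
  have an: "h analytic_on {w}" if "w \<in> t ` D" for w
    using hol oW that by (metis analytic_at)
  \<comment> \<open>At values not attained by t the choice in \<open>h\<close> is arbitrary;
    \<open>remove_sings\<close> replaces it by the limit.\<close>
  define H where "H = remove_sings h"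
  have Heq: "H w = h w" if "w \<in> t ` D" for w unfolding H_def using an[OF that] by (rule remove_sings_at_analytic)
  have "H analytic_on {c}" for c
  proof (cases "c \<in> t ` D")
    case True
    then show ?thesis unfolding H_def using an by (intro remove_sings_analytic_on)
  next
    case False
    from miss[OF this] obtain r C where r: "r > 0"
      "\<And>w. 0 < dist w c \<Longrightarrow> dist w c < r \<Longrightarrow> (\<exists>z\<in>D. t z = w \<and> norm (f z) \<le> C)" by blast
    have sub: "w \<in> t ` D" "norm (h w) \<le> C" if "w \<in> ball c r - {c}" for w
      using r(2)[of w] that h by (auto simp: dist_commute)
    have hh: "h holomorphic_on ball c r - {c}"
      by (rule holomorphic_on_subset[OF hol]) (use sub(1) in blast)
    have "\<forall>\<^sub>F w in at c. w \<in> ball c r - {c}" using r by (intro eventually_at_in_open) auto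
    then have "\<forall>\<^sub>F w in at c. norm (h w) \<le> C" by eventually_elim (rule sub)
    then have "\<exists>B. \<forall>\<^sub>F w in at c. norm (h w) \<le> B" by blast
    then obtain g where g: "g holomorphic_on ball c r" "\<And>w. w \<in> ball c r - {c} \<Longrightarrow> g w = h w"
      using holomorphic_on_extend_bounded[OF hh] r by auto
    have "g \<midarrow>c\<rightarrow> g c"
      using g(1) r by (metis centre_in_ball continuous_on_eq_continuous_at holomorphic_on_imp_continuous_on isContD open_ball)
    moreover have "\<forall>\<^sub>F w in at c. g w = h w"
      using \<open>\<forall>\<^sub>F w in at c. w \<in> ball c r - {c}\<close> by eventually_elim (rule g(2))
    ultimately have lim: "h \<midarrow>c\<rightarrow> g c" by (rule Lim_transform_eventually)
    have "isolated_singularity_at h c"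
      unfolding isolated_singularity_at_def using r hh by (intro exI[of _ r]) (auto simp: analytic_on_open open_Diff)
    then show ?thesis unfolding H_def by (rule remove_sings_analytic_at[OF _ lim])
  qed
  then have "H holomorphic_on UNIV"
    using analytic_imp_holomorphic analytic_on_analytic_at by blast
  moreover obtain r C where rC: "\<And>w. norm w > r \<Longrightarrow> \<exists>z\<in>D. t z = w \<and> norm (f z) \<le> C * norm w ^ k"
    using inf by blast
  have "norm (H w) \<le> C * norm w ^ k" if "r + 1 \<le> norm w" for w
  proof -
    have "r < norm w" using that by linarith
    then obtain z where "z \<in> D" "t z = w" "norm (f z) \<le> C * norm w ^ k" using rC by blast
    then show ?thesis using Heq[of w] h by auto
  qed
  ultimately have "H w = (\<Sum>i\<le>k. (deriv ^^ i) H 0 / fact i * w ^ i)" for w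
    by (rule Liouville_polynomial)
  then have "f z = (\<Sum>i\<le>k. (deriv ^^ i) H 0 / fact i * t z ^ i)" if "z \<in> D" for z
    using Heq[of "t z"] h that by auto
  then show ?thesis by (intro exI[of _ "\<lambda>i. (deriv ^^ i) H 0 / fact i"]) auto
qed


section \<open>Moebius transformations and cusps\<close>

abbreviation m11 :: "real^2^2 \<Rightarrow> real" where "m11 A \<equiv> A$1$1"
abbreviation m12 :: "real^2^2 \<Rightarrow> real" where "m12 A \<equiv> A$1$2"
abbreviation m21 :: "real^2^2 \<Rightarrow> real" where "m21 A \<equiv> A$2$1"
abbreviation m22 :: "real^2^2 \<Rightarrow> real" where "m22 A \<equiv> A$2$2"

definition mden :: "real^2^2 \<Rightarrow> complex \<Rightarrow> complex" where
  "mden A \<tau> = of_real (m21 A) * \<tau> + of_real (m22 A)"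

lemma mat2_nth [simp]:
  "m11 (mat2 a b c d) = a" "m12 (mat2 a b c d) = b" "m21 (mat2 a b c d) = c" "m22 (mat2 a b c d) = d"
  by (simp_all add: mat2_def)

lemma mat2_eqI:
  fixes A B :: "real^2^2"
  shows "m11 A = m11 B \<Longrightarrow> m12 A = m12 B \<Longrightarrow> m21 A = m21 B \<Longrightarrow> m22 A = m22 B \<Longrightarrow> A = B"
  by (simp add: vec_eq_iff forall_2)

lemma mult_nth2:
  "m11 (A ** B) = m11 A * m11 B + m12 A * m21 B" "m12 (A ** B) = m11 A * m12 B + m12 A * m22 B"
  "m21 (A ** B) = m21 A * m11 B + m22 A * m21 B" "m22 (A ** B) = m21 A * m12 B + m22 A * m22 B"
  by (simp_all add: matrix_matrix_mult_def sum_2)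

lemma det_entries: "det A = m11 A * m22 A - m12 A * m21 A"
  by (simp add: det_2)

lemma mden_nonzero:
  assumes "det A > 0" "Im \<tau> > 0"
  shows "mden A \<tau> \<noteq> 0"
proof
  assume "mden A \<tau> = 0"
  then have "m21 A * Im \<tau> = 0" "m21 A * Re \<tau> + m22 A = 0" by (auto simp: mden_def complex_eq_iff)
  then have "m21 A = 0" "m22 A = 0" using assms by auto
  then show False using assms by (simp add: det_2)
qed

lemma Im_moebius:
  "Im (moebius A \<tau>) = det A * Im \<tau> / norm (mden A \<tau>) ^ 2"
proof -
  have "Im ((of_real (m11 A) * \<tau> + of_real (m12 A)) * cnj (mden A \<tau>)) = det A * Im \<tau>"
    by (simp add: mden_def det_2 algebra_simps)
  moreover have "moebius A \<tau> = (of_real (m11 A) * \<tau> + of_real (m12 A)) * cnj (mden A \<tau>) / of_real (norm (mden A \<tau>) ^ 2)"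
    unfolding moebius_def mden_def[symmetric] by (subst complex_div_cnj) simp
  ultimately show ?thesis by (metis Im_divide_of_real)
qed

lemma Im_moebius_pos: "det A > 0 \<Longrightarrow> Im \<tau> > 0 \<Longrightarrow> Im (moebius A \<tau>) > 0"
  using mden_nonzero by (simp add: Im_moebius)

lemma mden_mult:
  assumes "mden B \<tau> \<noteq> 0"
  shows "mden (A ** B) \<tau> = mden A (moebius B \<tau>) * mden B \<tau>"
proof -
  have "moebius B \<tau> * mden B \<tau> = of_real (m11 B) * \<tau> + of_real (m12 B)"
    using assms by (simp add: moebius_def mden_def)
  then have "mden A (moebius B \<tau>) * mden B \<tau> =
      of_real (m21 A) * (of_real (m11 B) * \<tau> + of_real (m12 B)) + of_real (m22 A) * mden B \<tau>"
    by (metis mden_def distrib_right mult.assoc)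
  then show ?thesis by (simp add: mden_def mult_nth2 algebra_simps)
qed

lemma moebius_mult:
  assumes "mden B \<tau> \<noteq> 0"
  shows "moebius (A ** B) \<tau> = moebius A (moebius B \<tau>)"
proof -
  have 1: "moebius B \<tau> * mden B \<tau> = of_real (m11 B) * \<tau> + of_real (m12 B)"
    using assms by (simp add: moebius_def mden_def)
  have "moebius A (moebius B \<tau>) = ((of_real (m11 A) * moebius B \<tau> + of_real (m12 A)) * mden B \<tau>) /
      (mden A (moebius B \<tau>) * mden B \<tau>)"
    using assms by (simp add: moebius_def mden_def)
  also have "(of_real (m11 A) * moebius B \<tau> + of_real (m12 A)) * mden B \<tau> =
      of_real (m11 A) * (of_real (m11 B) * \<tau> + of_real (m12 B)) + of_real (m12 A) * mden B \<tau>"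
    by (simp only: distrib_right mult.assoc 1)
  also have "\<dots> = of_real (m11 (A ** B)) * \<tau> + of_real (m12 (A ** B))"
    by (simp add: mden_def mult_nth2 algebra_simps)
  finally show ?thesis
    unfolding mden_mult[OF assms, symmetric] by (simp add: moebius_def mden_def)
qed

lemma mden_scale: "mden (r *\<^sub>R A) \<tau> = of_real r * mden A \<tau>"
  by (simp add: mden_def algebra_simps)

lemma moebius_scale:
  assumes "r \<noteq> 0"
  shows "moebius (r *\<^sub>R A) \<tau> = moebius A \<tau>"
proof -
  have "moebius (r *\<^sub>R A) \<tau> = (of_real r * (of_real (m11 A) * \<tau> + of_real (m12 A))) / (of_real r * (of_real (m21 A) * \<tau> + of_real (m22 A)))"
    by (simp add: moebius_def algebra_simps)
  then show ?thesis using assms by (simp add: moebius_def)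
qed

lemma moebius_one: "moebius (mat 1) \<tau> = \<tau>" "mden (mat 1) \<tau> = 1"
  by (simp_all add: moebius_def mden_def mat_def)

text \<open>The third premise says that B and C send infinity to the same point. Then the inverse of
  B times C fixes infinity, so it is upper triangular and C \<tau> = B(a \<tau> + b). The diagonal
  entries are exported as expressions in the entries of B and C because integrality is read off from
  them later.\<close>

lemma upper_affine:
  fixes B C :: "real^2^2"
  assumes "det C > 0" "det B > 0" "m11 C * m21 B = m21 C * m11 B"
  obtains a b d where "a > 0"
    "d = (m11 B * m22 C - m21 B * m12 C) / det B" "a * d = (m22 B * m11 C - m12 B * m21 C) / det B"
    "a * d ^ 2 = det C / det B" "C = B ** mat2 (a * d) (b * d) 0 d"
    "\<And>\<tau>. Im \<tau> > 0 \<Longrightarrow> moebius C \<tau> = moebius B (of_real a * \<tau> + of_real b)"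
    "\<And>\<tau>. mden C \<tau> = of_real d * mden B (of_real a * \<tau> + of_real b)"
proof -
  define u11 u12 u22 where "u11 = m22 B * m11 C - m12 B * m21 C"
    and "u12 = m22 B * m12 C - m12 B * m22 C" and "u22 = m11 B * m22 C - m21 B * m12 C"
  define D where "D = det B"
  have D: "D > 0" "D = m11 B * m22 B - m12 B * m21 B" using assms by (auto simp: D_def det_2)
  have e11: "m11 B * u11 = D * m11 C"
    unfolding u11_def D(2) using assms(3) by (simp add: algebra_simps)
  have e21: "m21 B * u11 = D * m21 C"
    unfolding u11_def D(2) using assms(3) by (simp add: algebra_simps)
  have e12: "m11 B * u12 + m12 B * u22 = D * m12 C"
    unfolding u12_def u22_def D(2) by (simp add: algebra_simps)
  have e22: "m21 B * u12 + m22 B * u22 = D * m22 C"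
    unfolding u12_def u22_def D(2) by (simp add: algebra_simps)
  have "u11 * u22 = D * det C"
  proof -
    have "m11 B * (u11 * u22) = m11 B * (D * det C) \<and> m21 B * (u11 * u22) = m21 B * (D * det C)"
      unfolding mult.assoc[symmetric] e11 e21
      using assms(3) by (simp add: u22_def det_2 algebra_simps)
    moreover have "m11 B \<noteq> 0 \<or> m21 B \<noteq> 0" using D by auto
    ultimately show ?thesis by auto
  qed
  then have pos: "u11 * u22 > 0" using D assms by simp
  then have nz: "u11 \<noteq> 0" "u22 \<noteq> 0" by auto
  define a b d where "a = u11 / u22" and "b = u12 / u22" and "d = u22 / D"
  have "a > 0" using pos nz by (simp add: a_def zero_less_divide_iff zero_less_mult_iff)
  moreover have "a * d = u11 / D" using nz by (simp add: a_def d_def)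
  moreover have "a * d ^ 2 = det C / D"
    using nz D \<open>u11 * u22 = D * det C\<close> by (simp add: a_def d_def power2_eq_square field_simps)
  moreover have "m21 B * a * d = m21 C" "m21 B * b * d + m22 B * d = m22 C"
    "m11 B * a * d = m11 C" "m11 B * b * d + m12 B * d = m12 C"
  proof -
    have ad: "a * d = u11 / D" "b * d = u12 / D" using nz by (simp_all add: a_def b_def d_def)
    have D0: "D \<noteq> 0" using D(1) by simp
    show "m21 B * a * d = m21 C" "m11 B * a * d = m11 C"
      unfolding mult.assoc ad times_divide_eq_right e11 e21 using D0 by simp_all
    have "m21 B * b * d + m22 B * d = (m21 B * u12 + m22 B * u22) / D"
      "m11 B * b * d + m12 B * d = (m11 B * u12 + m12 B * u22) / D"
      unfolding mult.assoc ad(2) by (simp_all add: d_def add_divide_distrib)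
    then show "m21 B * b * d + m22 B * d = m22 C" "m11 B * b * d + m12 B * d = m12 C"
      unfolding e12 e22 using D0 by simp_all
  qed
  note ent = this
  have md: "mden C \<tau> = of_real d * mden B (of_real a * \<tau> + of_real b)" for \<tau>
    unfolding mden_def ent[symmetric] by (simp add: algebra_simps)
  have mn: "of_real (m11 C) * \<tau> + of_real (m12 C) =
      of_real d * (of_real (m11 B) * (of_real a * \<tau> + of_real b) + of_real (m12 B))" for \<tau> :: complex
    unfolding ent[symmetric] by (simp add: algebra_simps)
  have d0: "d \<noteq> 0" using nz D by (simp add: d_def)
  have mo: "moebius C \<tau> = moebius B (of_real a * \<tau> + of_real b)" for \<tau>
    using md[of \<tau>] mn[of \<tau>] d0 unfolding moebius_def mden_def by simp
  show thesis
  proof (rule that[of a d b])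
    show "a > 0" by fact
    show "d = (m11 B * m22 C - m21 B * m12 C) / det B" by (simp add: d_def u22_def D_def)
    show "a * d = (m22 B * m11 C - m12 B * m21 C) / det B"
      using \<open>a * d = u11 / D\<close> by (simp add: u11_def D_def)
    show "a * d ^ 2 = det C / det B" using \<open>a * d ^ 2 = det C / D\<close> by (simp add: D_def)
    show "C = B ** mat2 (a * d) (b * d) 0 d"
      by (rule mat2_eqI) (use ent in \<open>simp_all add: mult_nth2 mult.assoc\<close>)
  qed (rule mo md)+
qed

lemma moebius_ext_None_eq:
  assumes "moebius_ext A None = moebius_ext B None"
  shows "m11 A * m21 B = m21 A * m11 B"
proof (cases "m21 A = 0 \<or> m21 B = 0")
  case True
  then show ?thesis using assms by (auto simp: moebius_ext_def split: if_splits)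
next
  case False
  then have "complex_of_real (m11 A / m21 A) = of_real (m11 B / m21 B)"
    using assms by (simp add: moebius_ext_def del: of_real_divide)
  then have "m11 A / m21 A = m11 B / m21 B" by (simp only: of_real_eq_iff)
  then show ?thesis using False by (simp add: frac_eq_eq mult.commute)
qed

lemma moebius_ext_of_real:
  "moebius_ext A (Some (of_real q)) = (if m21 A * q + m22 A = 0 then None
     else Some (of_real ((m11 A * q + m12 A) / (m21 A * q + m22 A))))"
proof -
  have "of_real (m21 A) * of_real q + of_real (m22 A) = (of_real (m21 A * q + m22 A) :: complex)"
    "of_real (m11 A) * of_real q + of_real (m12 A) = (of_real (m11 A * q + m12 A) :: complex)"
    by simp_all
  then show ?thesis
    unfolding moebius_ext_def moebius_def option.case by (simp only: of_real_eq_0_iff of_real_divide)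
qed

lemma moebius_ext_mult_None:
  assumes "det A > 0" "det B > 0"
  shows "moebius_ext (A ** B) None = moebius_ext A (moebius_ext B None)"
proof (cases "m21 B = 0")
  case True
  then have "m11 B \<noteq> 0" using assms by (auto simp: det_2)
  then show ?thesis using True by (simp add: moebius_ext_def mult_nth2)
next
  case False
  define q where "q = m11 B / m21 B"
  have 1: "m11 (A ** B) = (m11 A * q + m12 A) * m21 B" "m21 (A ** B) = (m21 A * q + m22 A) * m21 B"
    using False by (simp_all add: mult_nth2 q_def distrib_right)
  have "moebius_ext B None = Some (of_real q)" using False by (simp add: moebius_ext_def q_def)
  moreover have "moebius_ext (A ** B) None = moebius_ext A (Some (of_real q))"
    unfolding moebius_ext_of_real unfolding moebius_ext_def option.case 1 using False by simp
  ultimately show ?thesis by simp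
qed

lemma moebius_ext_Some:
  assumes "det A > 0" "Im z > 0"
  shows "moebius_ext A (Some z) = Some (moebius A z)"
  using mden_nonzero[OF assms] by (simp add: moebius_ext_def mden_def)

section \<open>Cusps as the orbit of infinity under the modular group, and neighbourhoods of i
  infinity\<close>

definition cusps :: "complex option set" where
  "cusps = insert None (Some ` range (of_rat :: rat \<Rightarrow> complex))"

lemma cusp_not_half_plane: "x \<in> cusps \<Longrightarrow> x \<notin> Some ` upper_half_plane"
proof -
  have "Im (of_rat r) = 0" for r
    by (cases r) (simp add: of_rat_rat complex_is_Real_iff[symmetric])
  then show "x \<in> cusps \<Longrightarrow> x \<notin> Some ` upper_half_plane"
    by (auto simp: cusps_def upper_half_plane_def)
qed

lemma extended_half_plane_eq: "extended_half_plane = Some ` upper_half_plane \<union> cusps"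
  by (auto simp: extended_half_plane_def cusps_def)

lemma SL2Z_iff: "A \<in> SL2Z \<longleftrightarrow> (\<exists>(a::int) (b::int) (c::int) (d::int). A = mat2 (of_int a) (of_int b) (of_int c) (of_int d) \<and> a * d - b * c = 1)"
  unfolding Gamma0_def by auto

lemma SL2Z_det: "A \<in> SL2Z \<Longrightarrow> det A = 1"
proof -
  assume "A \<in> SL2Z"
  then obtain a b c d :: int where A: "A = mat2 a b c d" "a * d - b * c = 1" unfolding SL2Z_iff by auto
  have "det A = of_int (a * d - b * c)" by (simp add: A(1) det_2)
  then show ?thesis by (simp add: A(2))
qed

lemma moebius_ext_int_cusp:
  fixes a b c d :: int
  assumes "r \<noteq> 0"
  shows "moebius_ext (r *\<^sub>R mat2 a b c d) None \<in> cusps"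
proof (cases "c = 0")
  case False
  have "complex_of_rat (of_int a / of_int c) = of_real (of_int a / of_int c)"
    by (simp add: of_rat_divide)
  then have "complex_of_real (of_int a / of_int c) \<in> range of_rat" by (metis rangeI)
  moreover have "m11 (r *\<^sub>R mat2 a b c d) / m21 (r *\<^sub>R mat2 a b c d) = of_int a / of_int c"
    using assms False by simp
  moreover have "m21 (r *\<^sub>R mat2 a b c d) \<noteq> 0" using assms False by simp
  ultimately show ?thesis unfolding moebius_ext_def cusps_def option.case by (simp del: of_real_divide)
qed (simp add: moebius_ext_def cusps_def)

lemma cusp_SL2Z:
  assumes "x \<in> cusps"
  obtains A where "A \<in> SL2Z" "moebius_ext A None = x"
proof (cases x)
  case None
  have "mat2 (of_int 1) (of_int 0) (of_int 0) (of_int 1) \<in> SL2Z" unfolding SL2Z_iff by fastforce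
  then show ?thesis using that None by (fastforce simp: moebius_ext_def)
next
  case (Some z)
  then obtain q :: rat where q: "z = of_rat q" using assms by (auto simp: cusps_def)
  obtain a c :: int where ac: "q = of_int a / of_int c" "c > 0" "coprime a c"
    using quotient_of_div[of q] quotient_of_denom_pos quotient_of_coprime
    by (metis prod.collapse)
  obtain d b where "d * a + b * c = 1" using ac(3) by (metis bezout_int coprime_imp_gcd_eq_1)
  then have "mat2 a (- b) c d \<in> SL2Z" unfolding SL2Z_iff
    by (intro exI[of _ a] exI[of _ "- b"] exI[of _ c] exI[of _ d]) (simp add: mult.commute)
  moreover have "moebius_ext (mat2 a (- b) c d) None = x"
    using ac Some q by (simp add: moebius_ext_def of_rat_divide)
  ultimately show ?thesis using that by blast
qed

lemma eventually_at_ii_inf: "eventually P at_ii_inf \<longleftrightarrow> (\<exists>Y>0. \<forall>\<tau>. Im \<tau> > Y \<longrightarrow> P \<tau>)"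
proof
  assume "eventually P at_ii_inf"
  then obtain Y where Y: "\<forall>\<tau>. Im \<tau> > Y \<longrightarrow> P \<tau>"
    by (auto simp: at_ii_inf_def eventually_filtercomap eventually_at_top_dense)
  then show "\<exists>Y>0. \<forall>\<tau>. Im \<tau> > Y \<longrightarrow> P \<tau>" by (intro exI[of _ "max Y 1"]) auto
next
  assume "\<exists>Y>0. \<forall>\<tau>. Im \<tau> > Y \<longrightarrow> P \<tau>"
  then obtain Y where "\<forall>\<tau>. Im \<tau> > Y \<longrightarrow> P \<tau>" by blast
  then show "eventually P at_ii_inf"
    unfolding at_ii_inf_def eventually_filtercomap
    by (intro exI[of _ "\<lambda>x. x > Y"]) (auto simp: eventually_gt_at_top)
qed

lemma at_ii_inf_neq_bot: "at_ii_inf \<noteq> bot"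
  unfolding trivial_limit_def eventually_at_ii_inf
  by (metis complex.sel(2) less_add_one)

lemma filterlim_affine_at_ii_inf:
  assumes "a > 0"
  shows "filterlim (\<lambda>\<tau>. of_real a * \<tau> + of_real b) at_ii_inf at_ii_inf"
  unfolding filterlim_iff
proof (intro allI impI)
  fix P assume "eventually P at_ii_inf"
  then obtain Y where Y: "Y > 0" "\<forall>\<tau>. Im \<tau> > Y \<longrightarrow> P \<tau>" by (auto simp: eventually_at_ii_inf)
  then show "\<forall>\<^sub>F \<tau> in at_ii_inf. P (of_real a * \<tau> + of_real b)"
    unfolding eventually_at_ii_inf using assms
    by (intro exI[of _ "Y / a"]) (auto simp: field_simps)
qed

lemma filterlim_at_ii_inf_affine_iff:
  assumes "a > 0" and eq: "\<And>\<tau>. Im \<tau> > 0 \<Longrightarrow> f \<tau> = g (of_real a * \<tau> + of_real b)"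
  shows "filterlim f F at_ii_inf \<longleftrightarrow> filterlim g F at_ii_inf"
proof -
  have "\<forall>\<^sub>F \<tau> in at_ii_inf. Im \<tau> > 0" unfolding eventually_at_ii_inf by (intro exI[of _ 1]) auto
  then have ev: "\<forall>\<^sub>F \<tau> in at_ii_inf. f \<tau> = g (of_real a * \<tau> + of_real b)" by eventually_elim (rule eq)
  show ?thesis
  proof
    assume "filterlim g F at_ii_inf"
    from filterlim_compose[OF this filterlim_affine_at_ii_inf[OF assms(1), of b]]
    show "filterlim f F at_ii_inf" by (subst filterlim_cong[OF refl refl ev])
  next
    assume f: "filterlim f F at_ii_inf"
    have i: "1 / a > 0" using assms by simp
    have "filterlim (\<lambda>\<tau>. g (of_real a * \<tau> + of_real b)) F at_ii_inf"
      using f by (subst (asm) filterlim_cong[OF refl refl ev])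
    from filterlim_compose[OF this filterlim_affine_at_ii_inf[OF i, of "- b / a"]]
    show "filterlim g F at_ii_inf" using assms(1) by (simp add: algebra_simps)
  qed
qed

section \<open>The local parameter at a cusp of width h, with h = 1 for q-expansions\<close>

definition nome :: "real \<Rightarrow> complex \<Rightarrow> complex" where
  "nome h \<tau> = exp (2 * pi * \<i> * \<tau> / of_real h)"

lemma norm_nome: "norm (nome h \<tau>) = exp (- 2 * pi * Im \<tau> / h)"
  by (simp add: nome_def norm_exp_eq_Re Re_divide_of_real)

lemma nome_nonzero [simp]: "nome h \<tau> \<noteq> 0" by (simp add: nome_def)

lemma filterlim_nome:
  assumes "h > 0" shows "filterlim (nome h) (at 0) at_ii_inf"
proof (rule filterlim_atI)
  show "(nome h \<longlongrightarrow> 0) at_ii_inf"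
    unfolding tendsto_iff eventually_at_ii_inf
  proof (intro allI impI)
    fix e :: real assume e: "e > 0"
    have "norm (nome h \<tau>) < e" if "Im \<tau> > max 1 (- h * ln e / (2 * pi))" for \<tau>
    proof -
      have "- 2 * pi * Im \<tau> / h < ln e" using that assms by (simp add: field_simps)
      then have "exp (- 2 * pi * Im \<tau> / h) < exp (ln e)" by (simp only: exp_less_cancel_iff)
      then show ?thesis using e by (simp add: norm_nome)
    qed
    then show "\<exists>Y>0. \<forall>\<tau>. Y < Im \<tau> \<longrightarrow> dist (nome h \<tau>) 0 < e"
      by (intro exI[of _ "max 1 (- h * ln e / (2 * pi))"]) auto
  qed
qed simp

lemma nome_surj:
  assumes "h > 0" "w \<noteq> 0" "norm w < exp (- 2 * pi * Y / h)"
  obtains \<tau> where "Im \<tau> > Y" "nome h \<tau> = w"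
proof -
  define \<tau> where "\<tau> = of_real h * Ln w / (2 * pi * \<i>)"
  have n: "nome h \<tau> = w" using assms(1,2) by (simp add: nome_def \<tau>_def)
  then have "exp (- 2 * pi * Im \<tau> / h) < exp (- 2 * pi * Y / h)" using assms(3) norm_nome[of h \<tau>] by simp
  then have "- 2 * pi * Im \<tau> / h < - 2 * pi * Y / h" by (simp only: exp_less_cancel_iff)
  then have "Im \<tau> > Y" using assms(1) by (simp add: divide_less_cancel)
  then show ?thesis using n that by blast
qed

text \<open>The parameter maps each half-plane Im \<tau> > Y onto a punctured disc around 0, so
  properties transfer in both directions.\<close>

lemma eventually_nome:
  assumes "h > 0"
  shows "(\<forall>\<^sub>F \<tau> in at_ii_inf. P (nome h \<tau>)) \<longleftrightarrow> eventually P (at 0)"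
proof
  assume "\<forall>\<^sub>F \<tau> in at_ii_inf. P (nome h \<tau>)"
  then obtain Y where Y: "\<forall>\<tau>. Im \<tau> > Y \<longrightarrow> P (nome h \<tau>)" by (auto simp: eventually_at_ii_inf)
  have "P w" if "w \<noteq> 0" "dist w 0 < exp (- 2 * pi * Y / h)" for w
    using nome_surj[OF assms that(1), of Y] that Y by auto
  then show "eventually P (at 0)"
    unfolding eventually_at by (intro exI[of _ "exp (- 2 * pi * Y / h)"]) auto
next
  assume "eventually P (at 0)"
  then show "\<forall>\<^sub>F \<tau> in at_ii_inf. P (nome h \<tau>)"
    using filterlim_nome[OF assms] by (auto simp: filterlim_iff)
qed

lemma q_expansion_eval:
  assumes "has_q_expansion f F"
  shows "fps_conv_radius F > 0" "\<forall>\<^sub>F \<tau> in at_ii_inf. f \<tau> = eval_fps F (nome 1 \<tau>)"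
proof -
  obtain Y where Y: "\<And>\<tau>. Im \<tau> > Y \<Longrightarrow> (\<lambda>n. fps_nth F n * nome 1 \<tau> ^ n) sums f \<tau>"
    using assms unfolding has_q_expansion_def eventually_at_ii_inf nome_def by auto
  have "Im (Complex 0 (Y + 1)) > Y" by simp
  from Y[OF this] have "summable (\<lambda>n. fps_nth F n * nome 1 (Complex 0 (Y + 1)) ^ n)" by (rule sums_summable)
  then have "ereal (norm (nome 1 (Complex 0 (Y + 1)))) \<le> fps_conv_radius F"
    unfolding fps_conv_radius_def by (rule conv_radius_geI)
  moreover have "ereal (norm (nome 1 (Complex 0 (Y + 1)))) > 0" by simp
  ultimately show "fps_conv_radius F > 0" by (rule less_le_trans[rotated])
  show "\<forall>\<^sub>F \<tau> in at_ii_inf. f \<tau> = eval_fps F (nome 1 \<tau>)"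
    using assms unfolding has_q_expansion_def eval_fps_def nome_def
    by (rule eventually_mono) (simp add: sums_iff)
qed

lemma fps_eqI_at_ii_inf:
  assumes "fps_conv_radius F > 0" "fps_conv_radius G > 0"
    and ev: "\<forall>\<^sub>F \<tau> in at_ii_inf. eval_fps F (nome 1 \<tau>) = eval_fps G (nome 1 \<tau>)"
  shows "F = G"
proof -
  have "\<forall>\<^sub>F w in at 0. eval_fps F w = eval_fps G w"
    using ev eventually_nome[of 1 "\<lambda>w. eval_fps F w = eval_fps G w"] by simp
  have c: "isCont (eval_fps F) 0" "isCont (eval_fps G) 0"
    using assms by (auto intro!: continuous_eval_fps simp: zero_ereal_def)
  have "eval_fps G \<midarrow>0\<rightarrow> eval_fps F 0"
    by (rule Lim_transform_eventually[OF isContD[OF c(1)]]) fact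
  then have "eval_fps F 0 = eval_fps G 0" using isContD[OF c(2)] by (rule LIM_unique)
  with \<open>\<forall>\<^sub>F w in at 0. eval_fps F w = eval_fps G w\<close>
  have ev': "\<forall>\<^sub>F w in nhds 0. eval_fps F w = eval_fps G w"
    by (simp add: eventually_nhds_conv_at)
  have "eval_fps F has_fps_expansion F" "eval_fps G has_fps_expansion G"
    using assms by (auto intro: eval_fps_has_fps_expansion)
  then show ?thesis
    using has_fps_expansion_cong[OF ev' refl] fps_expansion_unique_complex by metis
qed

lemma slash_det_1:
  assumes "det A = 1"
  shows "slash k F A \<tau> = mden A \<tau> powi (- k) * F (moebius A \<tau>)"
  using assms by (simp add: slash_def mden_def)


section \<open>Expansions at points and cusps\<close>

lemma analytic_factor:
  fixes g :: "complex \<Rightarrow> complex"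
  assumes an: "g analytic_on {0}" and nz: "\<not> (\<forall>\<^sub>F w in at 0. g w = 0)"
  obtains m g1 where "g1 analytic_on {0}" "g1 0 \<noteq> 0" "\<forall>\<^sub>F w in at 0. g w = w ^ m * g1 w"
proof -
  define F where "F = fps_expansion g 0"
  have F: "g has_fps_expansion F" unfolding F_def by (rule analytic_at_imp_has_fps_expansion_0[OF an])
  then have R: "fps_conv_radius F > 0" and ev: "\<forall>\<^sub>F w in nhds 0. eval_fps F w = g w"
    by (auto simp: has_fps_expansion_def)
  have F0: "F \<noteq> 0"
  proof
    assume "F = 0"
    then have "\<forall>\<^sub>F w in nhds 0. g w = 0" using ev by (auto elim: eventually_mono)
    then have "\<forall>\<^sub>F w in at 0. g w = 0" by (auto simp: eventually_at_filter elim: eventually_mono)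
    with nz show False by simp
  qed
  define m where "m = subdegree F"
  define G where "G = fps_shift m F"
  have RG: "fps_conv_radius G > 0" using R by (simp add: G_def)
  show ?thesis
  proof (rule that[of "eval_fps G" m])
    show "eval_fps G analytic_on {0}" using RG by (intro analytic_on_eval_fps) (auto simp: zero_ereal_def)
    show "eval_fps G 0 \<noteq> 0" using F0 by (simp add: eval_fps_at_0 G_def m_def)
    have "\<forall>\<^sub>F w in nhds 0. w \<in> eball 0 (fps_conv_radius F)"
      using R by (intro eventually_nhds_in_open) (auto simp: zero_ereal_def)
    with ev have "\<forall>\<^sub>F w in nhds 0. w \<noteq> 0 \<longrightarrow> g w = w ^ m * eval_fps G w"
    proof eventually_elim
      case (elim w)
      then show ?case using eval_fps_shift[of m F w] by (auto simp: G_def m_def)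
    qed
    then show "\<forall>\<^sub>F w in at 0. g w = w ^ m * eval_fps G w" by (simp add: eventually_at_filter)
  qed
qed

text \<open>A form of the open mapping theorem that keeps track of the preimage: all values close to
  g(a) are taken within distance \<rho> of a. It produces points near a pole or deep in a cusp with
  a prescribed value of t.\<close>

lemma analytic_cover:
  fixes g :: "complex \<Rightarrow> complex"
  assumes an: "g analytic_on {a}" and nc: "\<not> (\<forall>\<^sub>F w in at a. g w = g a)" and "\<rho> > 0"
  obtains r where "r > 0" "\<And>v. dist v (g a) < r \<Longrightarrow> \<exists>w\<in>ball a \<rho>. g w = v"
proof -
  obtain B where B: "open B" "a \<in> B" "g holomorphic_on B" using an by (auto simp: analytic_at)
  obtain s where s: "s > 0" "ball a s \<subseteq> B" using B open_contains_ball by blast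
  define s' where "s' = min s \<rho>"
  have s': "s' > 0" "ball a s' \<subseteq> B" "ball a s' \<subseteq> ball a \<rho>" using s assms by (auto simp: s'_def)
  have "\<not> g constant_on ball a s'"
  proof
    assume "g constant_on ball a s'"
    then have eq: "g w = g a" if "w \<in> ball a s'" for w using that s' by (auto simp: constant_on_def)
    have "\<forall>\<^sub>F w in at a. w \<in> ball a s'" by (rule eventually_at_in_open') (use s' in auto)
    then have "\<forall>\<^sub>F w in at a. g w = g a" by eventually_elim (rule eq)
    with nc show False by simp
  qed
  then have "open (g ` ball a s')"
    by (intro open_mapping_thm[where S = "ball a s'"] holomorphic_on_subset[OF B(3) s'(2)]) auto
  moreover have "g a \<in> g ` ball a s'" using s' by auto
  ultimately obtain r where r: "r > 0" "ball (g a) r \<subseteq> g ` ball a s'" using open_contains_ball by blast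
  show ?thesis
  proof (rule that[OF r(1)])
    fix v assume "dist v (g a) < r"
    then have "v \<in> g ` ball a s'" using r(2) by (auto simp: dist_commute)
    then show "\<exists>w\<in>ball a \<rho>. g w = v" using s'(3) by blast
  qed
qed

lemma matrix_inv_both:
  fixes A :: "real^2^2"
  assumes "det A \<noteq> 0"
  shows "matrix_inv A ** A = mat 1" "A ** matrix_inv A = mat 1"
proof -
  have "invertible A" using assms by (simp add: invertible_det_nz)
  then have "A ** matrix_inv A = mat 1 \<and> matrix_inv A ** A = mat 1"
    unfolding invertible_def matrix_inv_def by (rule someI_ex)
  then show "matrix_inv A ** A = mat 1" "A ** matrix_inv A = mat 1" by simp_all
qed

text \<open>Conjugation is replaced by an equation free of inverses, which is easier to combine with
  products of matrices.\<close>

lemma slash_width_char: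
  fixes A M :: "real^2^2"
  assumes "det A = 1"
  shows "A ** M ** matrix_inv A \<in> G \<longleftrightarrow> (\<exists>K\<in>G. K ** A = A ** M)"
proof -
  have "det A \<noteq> 0" using assms by simp
  note mi = matrix_inv_both[OF this]
  show ?thesis
  proof
    assume *: "A ** M ** matrix_inv A \<in> G"
    have "(A ** M ** matrix_inv A) ** A = A ** M" by (simp add: matrix_mul_assoc[symmetric] mi)
    with * show "\<exists>K\<in>G. K ** A = A ** M" by blast
  next
    assume "\<exists>K\<in>G. K ** A = A ** M"
    then obtain K where K: "K \<in> G" "K ** A = A ** M" by blast
    have "A ** M ** matrix_inv A = K ** (A ** matrix_inv A)"
      by (simp add: K(2)[symmetric] matrix_mul_assoc)
    with K show "A ** M ** matrix_inv A \<in> G" by (simp add: mi)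
  qed
qed

text \<open>The upper triangular factor has equal diagonal entries and hence commutes with
  translations and scalars, so it disappears from the conjugated translation.\<close>

lemma cusp_width_upper:
  assumes "det A = 1" "det (A ** mat2 d b 0 d) = 1"
  shows "cusp_width G (A ** mat2 d b 0 d) = cusp_width G A"
proof -
  define U where "U = mat2 d b 0 d"
  have "det U \<noteq> 0" using assms by (auto simp: det_mul U_def)
  note inv = matrix_inv_both(2)[OF this]
  have comm: "U ** (r *\<^sub>R mat2 1 h 0 1) = (r *\<^sub>R mat2 1 h 0 1) ** U" for r h
    by (rule mat2_eqI) (simp_all add: mult_nth2 U_def algebra_simps)
  have cancel: "K ** U = L ** U \<longleftrightarrow> K = L" for K L
  proof
    assume "K ** U = L ** U"
    then have "K ** U ** matrix_inv U = L ** U ** matrix_inv U" by simp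
    then show "K = L" by (simp add: matrix_mul_assoc[symmetric] inv)
  qed simp
  have "K ** (A ** U) = (A ** U) ** (r *\<^sub>R mat2 1 h 0 1) \<longleftrightarrow> K ** A = A ** (r *\<^sub>R mat2 1 h 0 1)" for K r h
    unfolding matrix_mul_assoc[of A U, symmetric] comm by (simp add: matrix_mul_assoc cancel)
  then show ?thesis
    unfolding cusp_width_def U_def[symmetric] slash_width_char[OF assms(1)]
      slash_width_char[OF assms(2)[unfolded U_def[symmetric]]] by simp
qed

lemma tendsto_analytic_nome:
  assumes "g analytic_on {0}" "h > 0"
  shows "((\<lambda>\<tau>. g (nome h \<tau>)) \<longlongrightarrow> g 0) at_ii_inf"
  by (rule filterlim_compose[OF _ filterlim_nome[OF assms(2)]])
     (use analytic_at_imp_isCont[OF assms(1)] in \<open>simp add: isCont_def\<close>)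

text \<open>A maps a neighbourhood of i infinity to an open part of the upper half-plane, where F
  cannot be constantly c. The matrix B in the proof is the adjugate of A, its inverse up to a
  scalar, which suffices for the action on points.\<close>

lemma moebius_frequent:
  assumes A: "det A > 0" and F: "\<And>z. Im z > 0 \<Longrightarrow> \<forall>\<^sub>F w in at z. F w \<noteq> c"
  shows "\<not> (\<forall>\<^sub>F \<tau> in at_ii_inf. F (moebius A \<tau>) = c)"
proof
  assume "\<forall>\<^sub>F \<tau> in at_ii_inf. F (moebius A \<tau>) = c"
  then obtain Y where Y: "Y > 0" "\<And>\<tau>. Im \<tau> > Y \<Longrightarrow> F (moebius A \<tau>) = c"
    by (auto simp: eventually_at_ii_inf)
  define B where "B = mat2 (m22 A) (- m12 A) (- m21 A) (m11 A)"
  have dB: "det B > 0" using A by (simp add: det_entries B_def mult.commute)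
  have AB: "A ** B = det A *\<^sub>R mat 1" "B ** A = det A *\<^sub>R mat 1"
    by (rule mat2_eqI; simp add: mult_nth2 B_def det_entries mat_def)+
  define \<tau>0 where "\<tau>0 = Complex 0 (Y + 1)"
  define z where "z = moebius A \<tau>0"
  have \<tau>0: "Im \<tau>0 > Y" "Im \<tau>0 > 0" using Y(1) by (auto simp: \<tau>0_def)
  have z: "Im z > 0" unfolding z_def using A \<tau>0 by (intro Im_moebius_pos)
  have Bz: "moebius B z = \<tau>0"
    using moebius_mult[OF mden_nonzero[OF A \<tau>0(2)], of B] A
    by (simp add: z_def AB moebius_scale moebius_one)
  have AB': "moebius A (moebius B w) = w" if "Im w > 0" for w
    using moebius_mult[OF mden_nonzero[OF dB that], of A] A by (simp add: AB moebius_scale moebius_one)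
  have "isCont (moebius B) z"
    unfolding moebius_def using mden_nonzero[OF dB z]
    by (intro continuous_intros) (auto simp: mden_def)
  then have "((\<lambda>w. Im (moebius B w)) \<longlongrightarrow> Im (moebius B z)) (at z)"
    by (intro tendsto_Im) (simp add: isCont_def)
  then have "\<forall>\<^sub>F w in at z. Im (moebius B w) > Y"
    using \<tau>0(1) Bz by (intro order_tendstoD(1)) auto
  moreover have "\<forall>\<^sub>F w in at z. w \<in> {w. Im w > 0}"
    using z by (intro eventually_at_in_open' open_halfspace_Im_gt) auto
  ultimately have "\<forall>\<^sub>F w in at z. F w = c"
  proof eventually_elim
    case (elim w)
    then show ?case using Y(2)[of "moebius B w"] AB' by simp
  qed
  with F[OF z] have "\<forall>\<^sub>F w in at z. False" by eventually_elim auto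
  then show False by simp
qed

lemma avoid_const:
  assumes "f nicely_meromorphic_on upper_half_plane" "has_q_expansion f F" "F \<noteq> fps_const c" "Im z > 0"
  shows "\<forall>\<^sub>F w in at z. f w \<noteq> c"
proof -
  have o: "open upper_half_plane" "connected upper_half_plane"
    unfolding upper_half_plane_def
    by (auto intro: open_halfspace_Im_gt convex_connected convex_halfspace_Im_gt)
  have "(\<forall>w\<in>upper_half_plane. f w = c) \<or> (\<forall>\<^sub>\<approx>w\<in>upper_half_plane. f w \<noteq> c)"
    by (rule nicely_meromorphic_imp_constant_or_avoid[OF assms(1) o])
  then show ?thesis
  proof
    assume const: "\<forall>w\<in>upper_half_plane. f w = c"
    have "\<forall>\<^sub>F \<tau> in at_ii_inf. Im \<tau> > 0" unfolding eventually_at_ii_inf by (intro exI[of _ 1]) auto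
    with q_expansion_eval(2)[OF assms(2)]
    have "\<forall>\<^sub>F \<tau> in at_ii_inf. eval_fps F (nome 1 \<tau>) = eval_fps (fps_const c) (nome 1 \<tau>)"
      by eventually_elim (use const in \<open>auto simp: upper_half_plane_def\<close>)
    then have "F = fps_const c"
      by (intro fps_eqI_at_ii_inf q_expansion_eval(1)[OF assms(2)]) auto
    with assms(3) show ?thesis by simp
  next
    assume "\<forall>\<^sub>\<approx>w\<in>upper_half_plane. f w \<noteq> c"
    then show ?thesis
      by (rule eventually_cosparse_imp_eventually_at) (use assms(4) in \<open>simp add: upper_half_plane_def\<close>)
  qed
qed

lemma SL2Z_cusp: "A \<in> SL2Z \<Longrightarrow> moebius_ext A None \<in> cusps"
proof -
  assume "A \<in> SL2Z"
  then obtain a b c d :: int where "A = mat2 (of_int a) (of_int b) (of_int c) (of_int d)" unfolding SL2Z_iff by auto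
  then show ?thesis using moebius_ext_int_cusp[of 1 a b c d] by simp
qed

text \<open>The diagonal entries d and a d of the triangular factor are integers with product 1, so
  both equal 1 or both equal -1, which forces a = 1.\<close>

lemma SL2Z_affine:
  assumes A: "A \<in> SL2Z" and A': "A' \<in> SL2Z" and x: "moebius_ext A' None = moebius_ext A None"
  obtains b d where "norm d = 1" "A' = A ** mat2 d b 0 d"
    "\<And>\<tau>. Im \<tau> > 0 \<Longrightarrow> moebius A' \<tau> = moebius A (\<tau> + of_real (b * d))"
    "\<And>\<tau>. mden A' \<tau> = of_real d * mden A (\<tau> + of_real (b * d))"
proof -
  have dA: "det A = 1" "det A' = 1" by (rule SL2Z_det A A')+
  have prem: "det A' > 0" "det A > 0" "m11 A' * m21 A = m21 A' * m11 A"
    using dA moebius_ext_None_eq[OF x] by simp_all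
  show thesis
  proof (rule upper_affine[OF prem])
    fix a b d
    assume abd: "d = (m11 A * m22 A' - m21 A * m12 A') / det A" "a * d = (m22 A * m11 A' - m12 A * m21 A') / det A"
      "a * d ^ 2 = det A' / det A" "A' = A ** mat2 (a * d) (b * d) 0 d"
      and mo: "\<And>\<tau>. Im \<tau> > 0 \<Longrightarrow> moebius A' \<tau> = moebius A (of_real a * \<tau> + of_real b)"
      and md: "\<And>\<tau>. mden A' \<tau> = of_real d * mden A (of_real a * \<tau> + of_real b)"
    have ints: "m11 B \<in> \<int>" "m12 B \<in> \<int>" "m21 B \<in> \<int>" "m22 B \<in> \<int>" if "B \<in> SL2Z" for B
      using that by (auto simp: Gamma0_def)
    have "d \<in> \<int>"
      unfolding abd(1) dA using ints[OF A] ints[OF A'] by (auto intro!: Ints_diff Ints_mult)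
    moreover have "a * d \<in> \<int>"
      unfolding abd(2) dA using ints[OF A] ints[OF A'] by (auto intro!: Ints_diff Ints_mult)
    ultimately obtain m n where mn: "d = of_int n" "a * d = of_int m" by (auto elim!: Ints_cases)
    have "a * d * d = 1" using abd(3) dA by (simp add: power2_eq_square)
    then have "of_int (m * n) = (1::real)" using mn by simp
    then have "m * n = 1" by linarith
    then have mn1: "m = n" "n = 1 \<or> n = -1" by (auto simp: zmult_eq_1_iff)
    then have d: "d \<noteq> 0" "norm d = 1" "d * d = 1" using mn(1) by auto
    have a1: "a = 1" using mn mn1(1) d(1) by simp
    have b: "(b * d) * d = b" using d(3) by simp
    show thesis
      by (rule that[of d "b * d"]) (use d abd(4) mo md in \<open>simp_all add: a1 b\<close>)
  qed
qed

text \<open>This shows that the \<open>THE\<close> in \<open>order_at\<close> denotes. Two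
  representatives of a cusp differ by a sign and a translation, invisible in absolute values up to a
  shift of the argument. The quotient of the two expansions has absolute value exp(c Im \<tau>) with
  c proportional to the difference of the exponents, and a finite nonzero limit forces c =
  0.\<close>

lemma cusp_expansion_order:
  assumes A: "A \<in> SL2Z" and h: "cusp_width G A > 0" and e: "cusp_expansion G k F A \<alpha> g" and g0: "g 0 \<noteq> 0"
  shows "order_at G k F (moebius_ext A None) = \<alpha>"
proof -
  define h where "h = cusp_width G A"
  have dA: "det A = 1" by (rule SL2Z_det[OF A])
  have "\<alpha>' = \<alpha>" if A': "A' \<in> SL2Z" and x: "moebius_ext A' None = moebius_ext A None"
    and e': "cusp_expansion G k F A' \<alpha>' g'" and g0': "g' 0 \<noteq> 0" for A' \<alpha>' g'
  proof -
    have dA': "det A' = 1" by (rule SL2Z_det[OF A'])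
    obtain b0 d where "norm d = 1" and AU: "A' = A ** mat2 d b0 0 d"
      and mo: "\<And>\<tau>. Im \<tau> > 0 \<Longrightarrow> moebius A' \<tau> = moebius A (\<tau> + of_real (b0 * d))"
      and md: "\<And>\<tau>. mden A' \<tau> = of_real d * mden A (\<tau> + of_real (b0 * d))"
      using SL2Z_affine[OF A A' x] by metis
    define b where "b = b0 * d"
    have w: "cusp_width G A' = h"
      using cusp_width_upper[of A d b0 G] dA dA' AU by (simp add: h_def)
    have sl: "norm (slash k F A' \<tau>) = norm (slash k F A (\<tau> + of_real b))" if "Im \<tau> > 0" for \<tau>
      unfolding slash_det_1[OF dA] slash_det_1[OF dA'] mo[OF that] md b_def
      using \<open>norm d = 1\<close> by (simp only: norm_mult norm_power_int norm_of_real) simp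
    have E: "\<forall>\<^sub>F \<tau> in at_ii_inf. slash k F A \<tau> = exp (2 * pi * \<i> * of_real \<alpha> * \<tau> / of_real h) * g (nome h \<tau>)"
      using e by (simp add: cusp_expansion_def h_def nome_def)
    have E': "\<forall>\<^sub>F \<tau> in at_ii_inf. slash k F A' \<tau> = exp (2 * pi * \<i> * of_real \<alpha>' * \<tau> / of_real h) * g' (nome h \<tau>)"
      using e' by (simp add: cusp_expansion_def w nome_def)
    have fa: "filterlim (\<lambda>\<tau>. \<tau> + of_real b) at_ii_inf at_ii_inf"
      using filterlim_affine_at_ii_inf[of 1 b] by simp
    have Eb: "\<forall>\<^sub>F \<tau> in at_ii_inf. slash k F A (\<tau> + of_real b) =
        exp (2 * pi * \<i> * of_real \<alpha> * (\<tau> + of_real b) / of_real h) * g (nome h (\<tau> + of_real b))"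
      using E fa by (auto simp: filterlim_iff)
    have an: "g analytic_on {0}" "g' analytic_on {0}" using e e' by (auto simp: cusp_expansion_def)
    have hp: "h > 0" using h by (simp add: h_def)
    have l1: "((\<lambda>\<tau>. norm (g (nome h (\<tau> + of_real b)))) \<longlongrightarrow> norm (g 0)) at_ii_inf"
      by (intro tendsto_norm filterlim_compose[OF tendsto_analytic_nome[OF an(1) hp] fa])
    have l2: "((\<lambda>\<tau>. norm (g' (nome h \<tau>))) \<longlongrightarrow> norm (g' 0)) at_ii_inf"
      by (intro tendsto_norm tendsto_analytic_nome[OF an(2) hp])
    have lim: "((\<lambda>\<tau>. norm (g (nome h (\<tau> + of_real b))) / norm (g' (nome h \<tau>))) \<longlongrightarrow> norm (g 0) / norm (g' 0)) at_ii_inf"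
      by (intro tendsto_divide l1 l2) (use g0' in auto)
    have pos: "norm (g 0) / norm (g' 0) > 0" using g0 g0' by simp
    define c where "c = 2 * pi * (\<alpha> - \<alpha>') / h"
    have "\<forall>\<^sub>F \<tau> in at_ii_inf. Im \<tau> > 0" unfolding eventually_at_ii_inf by (intro exI[of _ 1]) auto
    moreover have "\<forall>\<^sub>F \<tau> in at_ii_inf. norm (g' (nome h \<tau>)) > 0"
      using order_tendstoD(1)[OF l2, of 0] g0' by simp
    ultimately have "\<forall>\<^sub>F \<tau> in at_ii_inf. norm (g (nome h (\<tau> + of_real b))) / norm (g' (nome h \<tau>)) = exp (c * Im \<tau>)"
      using E' Eb
    proof eventually_elim
      case (elim \<tau>)
      have "exp (- (2 * pi * \<alpha>' * Im \<tau> / h)) * norm (g' (nome h \<tau>)) =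
          exp (- (2 * pi * \<alpha> * Im \<tau> / h)) * norm (g (nome h (\<tau> + of_real b)))"
        using sl[OF elim(1)] unfolding elim(3,4)
        by (simp add: norm_mult norm_exp_eq_Re Re_divide_of_real)
      then have "norm (g (nome h (\<tau> + of_real b))) / norm (g' (nome h \<tau>)) =
          exp (- (2 * pi * \<alpha>' * Im \<tau> / h)) / exp (- (2 * pi * \<alpha> * Im \<tau> / h))"
        using elim(2) by (simp add: frac_eq_eq mult.commute)
      also have "\<dots> = exp (c * Im \<tau>)"
      proof -
        have "c * Im \<tau> = (2 * pi * \<alpha> / h) * Im \<tau> - (2 * pi * \<alpha>' / h) * Im \<tau>"
          by (simp only: c_def right_diff_distrib diff_divide_distrib left_diff_distrib)
        then have "c * Im \<tau> = - (2 * pi * \<alpha>' * Im \<tau> / h) - - (2 * pi * \<alpha> * Im \<tau> / h)"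
          by simp
        then show ?thesis by (simp only: exp_diff)
      qed
      finally show ?case .
    qed
    then have lim': "((\<lambda>\<tau>. exp (c * Im \<tau>)) \<longlongrightarrow> norm (g 0) / norm (g' 0)) at_ii_inf"
      using lim by (rule Lim_transform_eventually[rotated])
    have "filterlim Im at_top at_ii_inf" unfolding at_ii_inf_def by (rule filterlim_filtercomap)
    have "c = 0"
    proof (rule ccontr)
      assume "c \<noteq> 0"
      then consider "c > 0" | "c < 0" by linarith
      then show False
      proof cases
        case 1
        then have "filterlim (\<lambda>\<tau>. exp (c * Im \<tau>)) at_top at_ii_inf"
          by (intro filterlim_compose[OF exp_at_top] filterlim_tendsto_pos_mult_at_top[OF tendsto_const _ \<open>filterlim Im at_top at_ii_inf\<close>])
        then show False using not_tendsto_and_filterlim_at_infinity[OF at_ii_inf_neq_bot lim']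
          filterlim_at_top_imp_at_infinity by blast
      next
        case 2
        then have "filterlim (\<lambda>\<tau>. c * Im \<tau>) at_bot at_ii_inf"
          by (intro filterlim_tendsto_neg_mult_at_bot[OF tendsto_const _ \<open>filterlim Im at_top at_ii_inf\<close>])
        then have "((\<lambda>\<tau>. exp (c * Im \<tau>)) \<longlongrightarrow> 0) at_ii_inf"
          by (intro filterlim_compose[OF exp_at_bot])
        then have "norm (g 0) / norm (g' 0) = 0" using tendsto_unique[OF at_ii_inf_neq_bot lim'] by simp
        with pos show False by simp
      qed
    qed
    then show ?thesis using hp by (simp add: c_def)
  qed
  then have uniq: "\<alpha>' = \<alpha>" if "\<exists>A\<in>SL2Z. moebius_ext A None = x \<and> (\<exists>g. cusp_expansion G k F A \<alpha>' g \<and> g 0 \<noteq> 0)"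
      and "x = moebius_ext A None" for \<alpha>' x
    using that by blast
  have nx: "moebius_ext A None \<notin> Some ` upper_half_plane"
    by (rule cusp_not_half_plane[OF SL2Z_cusp[OF A]])
  have "order_at G k F (moebius_ext A None) = (THE \<alpha>. \<exists>B\<in>SL2Z. moebius_ext B None = moebius_ext A None \<and>
      (\<exists>g. cusp_expansion G k F B \<alpha> g \<and> g 0 \<noteq> 0))"
    by (simp only: order_at_def nx if_False)
  also have "\<dots> = \<alpha>"
    by (rule the_equality) (use A e g0 in blast, use uniq in blast)
  finally show ?thesis .
qed


section \<open>The Hauptmodul and the weight one form\<close>

text \<open>Of the group, only the determinant, the identity, its action on cusps and the existence
  of a translation at every cusp are recorded; this keeps the analytic part apart from Atkin--Lehner
  arithmetic.\<close>

locale hauptmodul_setup =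
  fixes \<Gamma> :: "(real^2^2) set" and t Z :: "complex \<Rightarrow> complex" and tq Zq :: "complex fps"
    and x0 :: "complex option" and \<mu> :: "real^2^2 \<Rightarrow> complex"
  assumes \<Gamma>_det: "A \<in> \<Gamma> \<Longrightarrow> det A > 0"
    and \<Gamma>_one: "mat 1 \<in> \<Gamma>"
    and \<Gamma>_cusp: "A \<in> \<Gamma> \<Longrightarrow> x \<in> cusps \<Longrightarrow> moebius_ext A x \<in> cusps"
    and \<Gamma>_width: "A \<in> SL2Z \<Longrightarrow> \<exists>h>0. \<exists>r. r \<noteq> 0 \<and> A ** (r *\<^sub>R mat2 1 h 0 1) ** matrix_inv A \<in> \<Gamma>"
    and t_unif: "uniformizer \<Gamma> t" and t_exp: "has_q_expansion t tq" and tq1: "fps_nth tq 1 = 1"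
    and x0: "x0 \<in> extended_half_plane"
    and t_pole: "\<forall>x\<in>extended_half_plane. order_at \<Gamma> 0 t x < 0 \<longleftrightarrow> x \<in> orbit_pt \<Gamma> x0"
    and Z_form: "modular_form \<Gamma> 1 \<mu> Z" and Z_exp: "has_q_expansion Z Zq" and Zq0: "fps_nth Zq 0 = 1"
    and Z_zero: "\<forall>x\<in>extended_half_plane. order_at \<Gamma> 1 Z x > 0 \<longleftrightarrow> x \<in> orbit_pt \<Gamma> x0"
    and Z_order: "order_at \<Gamma> 1 Z x0 \<le> 1"
begin

lemma t_mero: "t nicely_meromorphic_on upper_half_plane"
  and t_inv: "A \<in> \<Gamma> \<Longrightarrow> Im \<tau> > 0 \<Longrightarrow> t (moebius A \<tau>) = t \<tau>"
  and t_cusp: "A \<in> SL2Z \<Longrightarrow> \<exists>\<alpha> g. cusp_expansion \<Gamma> 0 t A \<alpha> g"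
  using t_unif by (auto simp: uniformizer_def modular_function_def upper_half_plane_def)

lemma Z_hol: "Z holomorphic_on upper_half_plane"
  and Z_slash: "A \<in> \<Gamma> \<Longrightarrow> Im \<tau> > 0 \<Longrightarrow> slash 1 Z A \<tau> = \<mu> A * Z \<tau>"
  and \<mu>_norm: "A \<in> \<Gamma> \<Longrightarrow> norm (\<mu> A) = 1"
  and Z_cusp: "A \<in> SL2Z \<Longrightarrow> \<exists>\<alpha>\<ge>0. \<exists>g. cusp_expansion \<Gamma> 1 Z A \<alpha> g"
  using Z_form unfolding modular_form_def upper_half_plane_def by blast+

lemma open_upper_half_plane: "open upper_half_plane"
  unfolding upper_half_plane_def by (rule open_halfspace_Im_gt)

lemma Z_analytic: "Im z > 0 \<Longrightarrow> Z analytic_on {z}"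
  using Z_hol open_upper_half_plane by (auto simp: analytic_at upper_half_plane_def)

lemma t_avoid: "Im z > 0 \<Longrightarrow> \<forall>\<^sub>F w in at z. t w \<noteq> c"
proof (rule avoid_const[OF t_mero t_exp])
  show "tq \<noteq> fps_const c" using tq1 by auto
qed

lemma Z_avoid: "Im z > 0 \<Longrightarrow> \<forall>\<^sub>F w in at z. Z w \<noteq> 0"
proof (rule avoid_const[OF _ Z_exp])
  show "Z nicely_meromorphic_on upper_half_plane"
    using Z_hol open_upper_half_plane by (intro analytic_on_imp_nicely_meromorphic_on) (simp add: analytic_on_open)
  show "Zq \<noteq> fps_const 0" using Zq0 by auto
qed

lemma Z_zero_inv:
  assumes "A \<in> \<Gamma>" "Im z > 0"
  shows "Z (moebius A z) = 0 \<longleftrightarrow> Z z = 0"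
proof -
  have "of_real (det A powr (1 / 2)) * (mden A z powi (- 1) * Z (moebius A z)) = \<mu> A * Z z"
    using Z_slash[OF assms] by (simp add: slash_def mden_def mult.assoc)
  moreover have "of_real (det A powr (1 / 2)) \<noteq> (0::complex)" using \<Gamma>_det[OF assms(1)] by simp
  moreover have "mden A z powi (- 1) \<noteq> 0" using mden_nonzero[OF \<Gamma>_det[OF assms(1)] assms(2)] by simp
  moreover have "\<mu> A \<noteq> 0" using \<mu>_norm[OF assms(1)] by auto
  ultimately show ?thesis by auto
qed

lemma frequently_at_if_eventually:
  assumes "\<forall>\<^sub>F w in at z. f w \<noteq> (c :: complex)"
  shows "\<exists>\<^sub>F w in at (z :: complex). f w \<noteq> c"
  using assms by (auto intro: eventually_frequently)

lemma uniformizer_order: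
  assumes "x \<in> extended_half_plane"
  shows "case sphere_value t x of None \<Rightarrow> order_at \<Gamma> 0 t x = -1 | Some c \<Rightarrow> order_at \<Gamma> 0 (\<lambda>\<tau>. t \<tau> - c) x = 1"
  using t_unif assms unfolding uniformizer_def by blast

lemma half_plane_extended: "Im z > 0 \<Longrightarrow> Some z \<in> extended_half_plane"
  by (auto simp: extended_half_plane_def upper_half_plane_def)

lemma order_at_uhp: "Im z > 0 \<Longrightarrow> order_at \<Gamma> k F (Some z) = of_int (zorder F z) / of_nat (elliptic_order \<Gamma> z)"
  by (auto simp: order_at_def upper_half_plane_def)

lemma sphere_value_uhp: "Im z > 0 \<Longrightarrow> sphere_value t (Some z) = (if is_pole t z then None else Some (t z))"
  by (auto simp: sphere_value_def upper_half_plane_def)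

text \<open>If the stabiliser were infinite, \<open>card\<close> would give 0 and division by 0
  would make every order at z equal to 0, whereas the uniformizer has a local order 1 or -1
  there.\<close>

lemma elliptic_order_pos:
  assumes "Im z > 0" shows "elliptic_order \<Gamma> z > 0"
proof (rule ccontr)
  assume "\<not> ?thesis"
  then have "order_at \<Gamma> 0 F (Some z) = 0" for F using assms by (simp add: order_at_uhp)
  then show False using uniformizer_order[OF half_plane_extended[OF assms]] by (auto split: option.splits)
qed

lemma t_isolated: "Im z > 0 \<Longrightarrow> isolated_singularity_at t z" "Im z > 0 \<Longrightarrow> not_essential t z"
  using t_mero by (auto simp: nicely_meromorphic_on_def upper_half_plane_def
      intro: meromorphic_on_isolated_singularity meromorphic_on_not_essential meromorphic_on_subset)

lemma t_analytic: "Im z > 0 \<Longrightarrow> \<not> is_pole t z \<Longrightarrow> t analytic_on {z}"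
  using nicely_meromorphic_on_imp_analytic_at[OF t_mero] by (auto simp: upper_half_plane_def)

text \<open>For the converse: at a point where t is finite, t - t(z) has order 1, so the order of t
  itself is 1 if t(z) = 0 and 0 otherwise, in neither case negative.\<close>

lemma pole_iff_orbit:
  assumes z: "Im z > 0"
  shows "is_pole t z \<longleftrightarrow> Some z \<in> orbit_pt \<Gamma> x0"
proof
  assume "is_pole t z"
  then have "zorder t z < 0" using t_isolated[OF z] by (intro isolated_pole_imp_neg_zorder)
  then have "order_at \<Gamma> 0 t (Some z) < 0"
    using elliptic_order_pos[OF z] by (simp add: order_at_uhp z divide_less_0_iff)
  then show "Some z \<in> orbit_pt \<Gamma> x0" using t_pole half_plane_extended[OF z] by blast
next
  assume "Some z \<in> orbit_pt \<Gamma> x0"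
  then have neg: "order_at \<Gamma> 0 t (Some z) < 0" using t_pole half_plane_extended[OF z] by blast
  show "is_pole t z"
  proof (rule ccontr)
    assume np: "\<not> is_pole t z"
    then have one: "order_at \<Gamma> 0 (\<lambda>\<tau>. t \<tau> - t z) (Some z) = 1"
      using uniformizer_order[OF half_plane_extended[OF z]] by (simp add: sphere_value_uhp[OF z])
    show False
    proof (cases "t z = 0")
      case True
      with one neg show False by simp
    next
      case False
      then have "zorder t z = 0" by (rule zorder_eq_0I[OF t_analytic[OF z np]])
      then show False using neg by (simp add: order_at_uhp[OF z])
    qed
  qed
qed

lemma Z_zero_iff_orbit:
  assumes z: "Im z > 0"
  shows "Z z = 0 \<longleftrightarrow> Some z \<in> orbit_pt \<Gamma> x0"
proof -
  have "zorder Z z > 0 \<longleftrightarrow> Z z = 0"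
    by (rule zorder_pos_iff'[OF Z_analytic[OF z] frequently_at_if_eventually[OF Z_avoid[OF z]]])
  moreover have "order_at \<Gamma> 1 Z (Some z) > 0 \<longleftrightarrow> zorder Z z > 0"
    using elliptic_order_pos[OF z] by (simp add: order_at_uhp z zero_less_divide_iff)
  ultimately show ?thesis using Z_zero half_plane_extended[OF z] by blast
qed

lemma pole_iff_zero: "Im z > 0 \<Longrightarrow> is_pole t z \<longleftrightarrow> Z z = 0"
  using pole_iff_orbit Z_zero_iff_orbit by blast

lemma width_nonneg:
  assumes "A \<in> SL2Z" shows "cusp_width \<Gamma> A \<ge> 0"
  unfolding cusp_width_def using \<Gamma>_width[OF assms] by (intro cInf_greatest) auto

lemma period:
  assumes A: "A \<in> SL2Z" and M: "A ** (r *\<^sub>R mat2 1 h 0 1) ** matrix_inv A \<in> \<Gamma>" "r \<noteq> 0" and \<tau>: "Im \<tau> > 0"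
  shows "t (moebius A (\<tau> + of_real h)) = t (moebius A \<tau>)"
proof -
  define T where "T = r *\<^sub>R mat2 1 h 0 1"
  have dA: "det A = 1" by (rule SL2Z_det[OF A])
  obtain K where K: "K \<in> \<Gamma>" "K ** A = A ** T"
    using M(1) unfolding slash_width_char[OF dA] T_def by blast
  have dA': "det A > 0" using dA by simp
  have T: "moebius T \<tau> = \<tau> + of_real h" "mden T \<tau> \<noteq> 0"
    unfolding T_def moebius_scale[OF M(2)] mden_scale using M(2) by (simp_all add: moebius_def mden_def)
  have "moebius K (moebius A \<tau>) = moebius A (\<tau> + of_real h)"
    using moebius_mult[OF mden_nonzero[OF dA' \<tau>], of K] moebius_mult[OF T(2), of A] by (simp add: K(2) T(1))
  then show ?thesis using t_inv[OF K(1) Im_moebius_pos[OF dA' \<tau>]] by simp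
qed

text \<open>\<open>cusp_expansion\<close> allows a real exponent, and here it is shown to be an
  integer. The invariant function t has period h, the width of the cusp, while translation by h
  multiplies its expansion by exp(2 pi i \<alpha>). Splitting off the full power of the parameter
  then makes the exponent equal to the order.\<close>

lemma t_cusp_factor:
  assumes A: "A \<in> SL2Z"
  obtains n :: int and g where "cusp_width \<Gamma> A > 0" "g analytic_on {0}" "g 0 \<noteq> 0"
    "\<forall>\<^sub>F \<tau> in at_ii_inf. t (moebius A \<tau>) = nome (cusp_width \<Gamma> A) \<tau> powi n * g (nome (cusp_width \<Gamma> A) \<tau>)"
    "order_at \<Gamma> 0 t (moebius_ext A None) = of_int n"
proof -
  define h where "h = cusp_width \<Gamma> A"
  have dA: "det A = 1" and dA': "det A > 0" using SL2Z_det[OF A] by simp_all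
  have mf: "\<not> (\<forall>\<^sub>F \<tau> in at_ii_inf. t (moebius A \<tau>) = c)" for c
    by (rule moebius_frequent[OF dA' t_avoid])
  obtain \<alpha> g where e: "cusp_expansion \<Gamma> 0 t A \<alpha> g" using t_cusp[OF A] by blast
  define \<Phi> where "\<Phi> = (\<lambda>\<tau>. exp (2 * pi * \<i> * of_real \<alpha> * \<tau> / of_real h) * g (nome h \<tau>))"
  have an: "g analytic_on {0}" using e by (simp add: cusp_expansion_def)
  have ev: "\<forall>\<^sub>F \<tau> in at_ii_inf. t (moebius A \<tau>) = \<Phi> \<tau>"
    using e by (simp add: cusp_expansion_def slash_det_1[OF dA] \<Phi>_def h_def nome_def)
  have h: "h > 0"
  proof (rule ccontr)
    assume "\<not> h > 0"
    then have "h = 0" using width_nonneg[OF A] by (simp add: h_def)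
    \<comment> \<open>Division by the width 0 yields 0, so both exponentials would be 1 and t would
      be constant near the cusp.\<close>
    then have "\<Phi> = (\<lambda>\<tau>. g 1)" by (simp add: \<Phi>_def nome_def)
    with ev mf show False by simp
  qed
  obtain B where B: "open B" "0 \<in> B" "g holomorphic_on B" using an by (auto simp: analytic_at)
  have "\<forall>\<^sub>F \<tau> in at_ii_inf. nome h \<tau> \<in> B"
    using filterlim_nome[OF h] eventually_at_in_open'[OF B(1,2)] by (auto simp: filterlim_iff)
  with ev have "\<forall>\<^sub>F \<tau> in at_ii_inf. t (moebius A \<tau>) = \<Phi> \<tau> \<and> nome h \<tau> \<in> B" by eventually_elim auto
  then obtain Y where Y: "Y > 0" "\<And>\<tau>. Im \<tau> > Y \<Longrightarrow> t (moebius A \<tau>) = \<Phi> \<tau> \<and> nome h \<tau> \<in> B"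
    by (auto simp: eventually_at_ii_inf)
  \<comment> \<open>The width is an infimum that is not known to be attained, so translation by h
    need not come from the group. There are however periods arbitrarily close to h from above, or h
    itself, and continuity yields the period h.\<close>
  have per: "\<Phi> (\<tau> + of_real h) = \<Phi> \<tau>" if \<tau>: "Im \<tau> > Y" for \<tau>
  proof (rule ccontr)
    assume ne: "\<Phi> (\<tau> + of_real h) \<noteq> \<Phi> \<tau>"
    have "isCont g (nome h (\<tau> + of_real h))"
      using Y(2)[of "\<tau> + of_real h"] \<tau> B by (metis Im_complex_of_real add.right_neutral continuous_on_eq_continuous_at holomorphic_on_imp_continuous_on plus_complex.sel(2))
    then have "isCont (g \<circ> (\<lambda>x::real. nome h (\<tau> + of_real x))) h"
      unfolding nome_def by (intro continuous_at_compose continuous_intros) (use h in auto)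
    then have "isCont (\<lambda>x::real. \<Phi> (\<tau> + of_real x)) h"
      unfolding \<Phi>_def o_def using h by (intro continuous_intros) auto
    then have "((\<lambda>x::real. \<Phi> (\<tau> + of_real x)) \<longlongrightarrow> \<Phi> (\<tau> + of_real h)) (at h)" by (simp add: isCont_def)
    then have "\<forall>\<^sub>F x in at h. \<Phi> (\<tau> + of_real x) \<noteq> \<Phi> \<tau>" using ne by (rule tendsto_imp_eventually_ne)
    then obtain d where d: "d > 0" "\<And>x. x \<noteq> h \<Longrightarrow> dist x h < d \<Longrightarrow> \<Phi> (\<tau> + of_real x) \<noteq> \<Phi> \<tau>"
      by (auto simp: eventually_at)
    define H where "H = {h. h > 0 \<and> (\<exists>r. r \<noteq> 0 \<and> A ** (r *\<^sub>R mat2 1 h 0 1) ** matrix_inv A \<in> \<Gamma>)}"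
    have H: "H \<noteq> {}" "bdd_below H" using \<Gamma>_width[OF A] by (auto simp: H_def intro!: bdd_belowI[of _ 0])
    have hH: "h = Inf H" by (simp add: h_def cusp_width_def H_def)
    then have "Inf H < h + d" using d by simp
    then obtain x where x: "x \<in> H" "x < h + d" using cInf_less_iff[OF H] by auto
    have "h \<le> x" using cInf_lower[OF x(1) H(2)] hH by simp
    then have "dist x h < d" using x(2) by (simp add: dist_real_def)
    then have "\<Phi> (\<tau> + of_real x) \<noteq> \<Phi> \<tau>" using d(2) ne by (cases "x = h") auto
    moreover have "Im \<tau> > 0" "Im (\<tau> + of_real x) > Y" using \<tau> Y(1) by auto
    moreover obtain r where "r \<noteq> 0" "A ** (r *\<^sub>R mat2 1 x 0 1) ** matrix_inv A \<in> \<Gamma>"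
      using x(1) by (auto simp: H_def)
    ultimately show False using period[OF A, of r x \<tau>] Y(2) \<tau> by metis
  qed
  have "exp (2 * pi * \<i> * of_real \<alpha>) = 1"
  proof (rule ccontr)
    assume ne: "exp (2 * pi * \<i> * of_real \<alpha>) \<noteq> 1"
    have "\<Phi> \<tau> = 0" if "Im \<tau> > Y" for \<tau>
    proof -
      have "nome h (\<tau> + of_real h) = nome h \<tau>"
        using h by (simp add: nome_def distrib_left add_divide_distrib exp_add)
      moreover have "exp (2 * pi * \<i> * of_real \<alpha> * (\<tau> + of_real h) / of_real h) =
          exp (2 * pi * \<i> * of_real \<alpha> * \<tau> / of_real h) * exp (2 * pi * \<i> * of_real \<alpha>)"
        using h by (simp add: distrib_left add_divide_distrib exp_add)
      ultimately have "\<Phi> (\<tau> + of_real h) = exp (2 * pi * \<i> * of_real \<alpha>) * \<Phi> \<tau>" by (simp add: \<Phi>_def)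
      then show ?thesis using per[OF that] ne by simp
    qed
    then have "\<forall>\<^sub>F \<tau> in at_ii_inf. t (moebius A \<tau>) = 0"
      unfolding eventually_at_ii_inf using Y by (intro exI[of _ Y]) auto
    with mf show False by blast
  qed
  then have "\<alpha> \<in> \<int>"
    by (auto simp: exp_eq_1)
  then obtain l where l: "\<alpha> = of_int l" by (auto elim: Ints_cases)
  have \<Phi>: "\<Phi> \<tau> = nome h \<tau> powi l * g (nome h \<tau>)" for \<tau>
    by (simp add: \<Phi>_def l nome_def exp_power_int mult_ac)
  have gnz: "\<not> (\<forall>\<^sub>F w in at 0. g w = 0)"
  proof
    assume "\<forall>\<^sub>F w in at 0. g w = 0"
    then have "\<forall>\<^sub>F \<tau> in at_ii_inf. g (nome h \<tau>) = 0" using eventually_nome[OF h, of "\<lambda>w. g w = 0"] by simp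
    with ev have "\<forall>\<^sub>F \<tau> in at_ii_inf. t (moebius A \<tau>) = 0" by eventually_elim (simp add: \<Phi>)
    with mf show False by blast
  qed
  obtain m g1 where g1: "g1 analytic_on {0}" "g1 0 \<noteq> 0" "\<forall>\<^sub>F w in at 0. g w = w ^ m * g1 w"
    using analytic_factor[OF an gnz] by blast
  have "\<forall>\<^sub>F \<tau> in at_ii_inf. g (nome h \<tau>) = nome h \<tau> ^ m * g1 (nome h \<tau>)"
    using g1(3) eventually_nome[OF h, of "\<lambda>w. g w = w ^ m * g1 w"] by simp
  with ev have ev1: "\<forall>\<^sub>F \<tau> in at_ii_inf. t (moebius A \<tau>) = nome h \<tau> powi (l + int m) * g1 (nome h \<tau>)"
    by eventually_elim (simp add: \<Phi> power_int_add)
  have "cusp_expansion \<Gamma> 0 t A (of_int (l + int m)) g1"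
    unfolding cusp_expansion_def h_def[symmetric]
  proof
    show "\<forall>\<^sub>F \<tau> in at_ii_inf. slash 0 t A \<tau> = exp (2 * pi * \<i> * of_real (of_int (l + int m)) * \<tau> / of_real h)
        * g1 (exp (2 * pi * \<i> * \<tau> / of_real h))"
      using ev1 by eventually_elim (simp add: slash_det_1[OF dA] nome_def exp_power_int mult_ac)
  qed (rule g1(1))
  from cusp_expansion_order[OF A _ this g1(2)]
  have "order_at \<Gamma> 0 t (moebius_ext A None) = of_int (l + int m)" using h by (simp add: h_def)
  then show ?thesis using that[of g1 "l + int m"] h g1 ev1 by (simp add: h_def)
qed

text \<open>The exponent may stay fractional on account of the multiplier. Moving all zeros of the
  analytic factor into it makes it the order of Z.\<close>

lemma Z_cusp_factor:
  assumes A: "A \<in> SL2Z"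
  obtains \<beta> :: real and g where "\<beta> \<ge> 0" "g analytic_on {0}" "g 0 \<noteq> 0"
    "\<forall>\<^sub>F \<tau> in at_ii_inf. slash 1 Z A \<tau> = exp (2 * pi * \<i> * of_real \<beta> * \<tau> / of_real (cusp_width \<Gamma> A))
       * g (nome (cusp_width \<Gamma> A) \<tau>)"
    "order_at \<Gamma> 1 Z (moebius_ext A None) = \<beta>"
proof -
  define h where "h = cusp_width \<Gamma> A"
  have h: "h > 0" unfolding h_def by (rule t_cusp_factor[OF A])
  have dA: "det A = 1" and dA': "det A > 0" using SL2Z_det[OF A] by simp_all
  obtain \<alpha> g where \<alpha>: "\<alpha> \<ge> 0" and e: "cusp_expansion \<Gamma> 1 Z A \<alpha> g" using Z_cusp[OF A] by blast
  have an: "g analytic_on {0}" using e by (simp add: cusp_expansion_def)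
  have ev: "\<forall>\<^sub>F \<tau> in at_ii_inf. slash 1 Z A \<tau> = exp (2 * pi * \<i> * of_real \<alpha> * \<tau> / of_real h) * g (nome h \<tau>)"
    using e by (simp add: cusp_expansion_def h_def nome_def)
  have ev0: "\<forall>\<^sub>F \<tau> in at_ii_inf. Im \<tau> > 0" unfolding eventually_at_ii_inf by (intro exI[of _ 1]) auto
  have gnz: "\<not> (\<forall>\<^sub>F w in at 0. g w = 0)"
  proof
    assume "\<forall>\<^sub>F w in at 0. g w = 0"
    then have "\<forall>\<^sub>F \<tau> in at_ii_inf. g (nome h \<tau>) = 0" using eventually_nome[OF h, of "\<lambda>w. g w = 0"] by simp
    with ev ev0 have "\<forall>\<^sub>F \<tau> in at_ii_inf. Z (moebius A \<tau>) = 0"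
    proof eventually_elim
      case (elim \<tau>)
      then show ?case using mden_nonzero[OF dA' elim(2)] by (simp add: slash_det_1[OF dA])
    qed
    with moebius_frequent[OF dA' Z_avoid] show False by blast
  qed
  obtain m g1 where g1: "g1 analytic_on {0}" "g1 0 \<noteq> 0" "\<forall>\<^sub>F w in at 0. g w = w ^ m * g1 w"
    using analytic_factor[OF an gnz] by blast
  have "\<forall>\<^sub>F \<tau> in at_ii_inf. g (nome h \<tau>) = nome h \<tau> ^ m * g1 (nome h \<tau>)"
    using g1(3) eventually_nome[OF h, of "\<lambda>w. g w = w ^ m * g1 w"] by simp
  with ev have ev1: "\<forall>\<^sub>F \<tau> in at_ii_inf. slash 1 Z A \<tau> =
      exp (2 * pi * \<i> * of_real (\<alpha> + m) * \<tau> / of_real h) * g1 (nome h \<tau>)"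
  proof eventually_elim
    case (elim \<tau>)
    have "nome h \<tau> ^ m = exp (2 * pi * \<i> * of_nat m * \<tau> / of_real h)"
      by (simp add: nome_def exp_of_nat_mult[symmetric] mult_ac)
    moreover have "exp (2 * pi * \<i> * of_real (\<alpha> + m) * \<tau> / of_real h) =
        exp (2 * pi * \<i> * of_real \<alpha> * \<tau> / of_real h) * exp (2 * pi * \<i> * of_nat m * \<tau> / of_real h)"
      by (simp add: exp_add[symmetric] add_divide_distrib[symmetric] algebra_simps)
    ultimately show ?case using elim by simp
  qed
  have "cusp_expansion \<Gamma> 1 Z A (\<alpha> + m) g1"
    using ev1 g1(1) by (simp add: cusp_expansion_def h_def nome_def)
  from cusp_expansion_order[OF A _ this g1(2)]
  have "order_at \<Gamma> 1 Z (moebius_ext A None) = \<alpha> + m" using h by (simp add: h_def)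
  then show ?thesis using that[of "\<alpha> + m" g1] \<alpha> g1 ev1 by (simp add: h_def)
qed

end


section \<open>Forms of weight \<open>k\<close> as polynomials in the Hauptmodul\<close>

context hauptmodul_setup
begin

text \<open>By invariance of t the limit may be taken along any matrix sending infinity into the
  orbit: two such matrices differ by an affine substitution of \<tau>, which preserves the approach
  to i infinity.\<close>

lemma sphere_value_cusp_orbit:
  assumes A: "A \<in> SL2Z" and y: "y \<in> orbit_pt \<Gamma> (moebius_ext A None)"
  shows "sphere_value t y = (if filterlim (\<lambda>\<tau>. t (moebius A \<tau>)) at_infinity at_ii_inf then None
     else Some (THE c. ((\<lambda>\<tau>. t (moebius A \<tau>)) \<longlongrightarrow> c) at_ii_inf))"
proof -
  obtain \<gamma> where \<gamma>: "\<gamma> \<in> \<Gamma>" "y = moebius_ext \<gamma> (moebius_ext A None)" using y by (auto simp: orbit_pt_def)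
  have yc: "y \<in> cusps" unfolding \<gamma>(2) by (rule \<Gamma>_cusp[OF \<gamma>(1) SL2Z_cusp[OF A]])
  have dA: "det A > 0" using SL2Z_det[OF A] by simp
  have lim: "filterlim (\<lambda>\<tau>. t (moebius A' \<tau>)) F at_ii_inf \<longleftrightarrow> filterlim (\<lambda>\<tau>. t (moebius A \<tau>)) F at_ii_inf"
    if A': "A' \<in> SL2Z" "moebius_ext A' None = y" for A' F
  proof -
    have "moebius_ext (\<gamma> ** A) None = moebius_ext A' None"
      using moebius_ext_mult_None[OF \<Gamma>_det[OF \<gamma>(1)] dA] \<gamma>(2) A'(2) by simp
    note prem = moebius_ext_None_eq[OF this]
    have d: "det (\<gamma> ** A) > 0" "det A' > 0" using \<Gamma>_det[OF \<gamma>(1)] dA SL2Z_det[OF A'(1)] by (simp_all add: det_mul)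
    show ?thesis
    proof (rule upper_affine[OF d prem])
      fix a b d
      assume a: "a > 0" and mo: "\<And>\<tau>. Im \<tau> > 0 \<Longrightarrow> moebius (\<gamma> ** A) \<tau> = moebius A' (of_real a * \<tau> + of_real b)"
      have "t (moebius A \<tau>) = t (moebius A' (of_real a * \<tau> + of_real b))" if "Im \<tau> > 0" for \<tau>
        using mo[OF that] moebius_mult[OF mden_nonzero[OF dA that], of \<gamma>]
          t_inv[OF \<gamma>(1) Im_moebius_pos[OF dA that]] by simp
      then show ?thesis by (rule filterlim_at_ii_inf_affine_iff[OF a, symmetric])
    qed
  qed
  obtain A' where A': "A' \<in> SL2Z" "moebius_ext A' None = y" using cusp_SL2Z[OF yc] by blast
  have 1: "(\<exists>A\<in>SL2Z. moebius_ext A None = y \<and> filterlim (\<lambda>\<tau>. t (moebius A \<tau>)) F at_ii_inf) \<longleftrightarrow>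
      filterlim (\<lambda>\<tau>. t (moebius A \<tau>)) F at_ii_inf" for F
    using lim A' by blast
  show ?thesis
    unfolding sphere_value_def 1 using cusp_not_half_plane[OF yc] by simp
qed

lemma orbit_pt_self: "x \<in> orbit_pt \<Gamma> x"
proof -
  have "moebius_ext (mat 1) x = x"
    by (cases x) (simp_all add: moebius_ext_def mat_def moebius_def)
  then show ?thesis using \<Gamma>_one unfolding orbit_pt_def by (metis image_eqI)
qed

lemma the_elem_const:
  assumes "\<And>y. y \<in> orbit_pt \<Gamma> x \<Longrightarrow> f y = v"
  shows "the_elem (f ` orbit_pt \<Gamma> x) = v"
proof -
  have "f ` orbit_pt \<Gamma> x = {v}" using assms orbit_pt_self[of x] by (auto simp: image_iff)
  then show ?thesis by simp
qed

lemma the_elem_uhp: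
  assumes z: "Im z > 0"
  shows "the_elem (sphere_value t ` orbit_pt \<Gamma> (Some z)) = (if is_pole t z then None else Some (t z))"
proof (rule the_elem_const)
  fix y assume "y \<in> orbit_pt \<Gamma> (Some z)"
  then obtain \<gamma> where \<gamma>: "\<gamma> \<in> \<Gamma>" "y = moebius_ext \<gamma> (Some z)" by (auto simp: orbit_pt_def)
  have y: "y = Some (moebius \<gamma> z)" unfolding \<gamma>(2) by (rule moebius_ext_Some[OF \<Gamma>_det[OF \<gamma>(1)] z])
  have im: "Im (moebius \<gamma> z) > 0" by (rule Im_moebius_pos[OF \<Gamma>_det[OF \<gamma>(1)] z])
  have "is_pole t (moebius \<gamma> z) \<longleftrightarrow> is_pole t z"
    by (simp add: pole_iff_zero[OF im] pole_iff_zero[OF z] Z_zero_inv[OF \<gamma>(1) z])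
  then show "sphere_value t y = (if is_pole t z then None else Some (t z))"
    by (simp add: y sphere_value_uhp[OF im] t_inv[OF \<gamma>(1) z])
qed

lemma same_value_same_orbit:
  assumes "Im z > 0" "Im z' > 0" "\<not> is_pole t z" "\<not> is_pole t z'" "t z = t z'"
  obtains \<gamma> where "\<gamma> \<in> \<Gamma>" "z' = moebius \<gamma> z"
proof -
  have inj: "inj_on (\<lambda>P. the_elem (sphere_value t ` P)) (modular_curve \<Gamma>)"
    using t_unif by (simp add: uniformizer_def bij_betw_def)
  have "orbit_pt \<Gamma> (Some z) = orbit_pt \<Gamma> (Some z')"
    by (rule inj_onD[OF inj]) (use assms in \<open>auto simp: the_elem_uhp modular_curve_def intro: half_plane_extended\<close>)
  then have "Some z' \<in> orbit_pt \<Gamma> (Some z)" using orbit_pt_self by simp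
  then obtain \<gamma> where \<gamma>: "\<gamma> \<in> \<Gamma>" "Some z' = moebius_ext \<gamma> (Some z)" by (auto simp: orbit_pt_def)
  then show ?thesis using that moebius_ext_Some[OF \<Gamma>_det[OF \<gamma>(1)] assms(1)] by simp
qed

text \<open>The induced map to the sphere is surjective, so a finite value not attained in the upper
  half-plane must be the value at a cusp.\<close>

lemma missed_value_cusp:
  assumes c: "\<And>z. Im z > 0 \<Longrightarrow> \<not> is_pole t z \<Longrightarrow> t z \<noteq> c"
  obtains A where "A \<in> SL2Z" "\<not> filterlim (\<lambda>\<tau>. t (moebius A \<tau>)) at_infinity at_ii_inf"
    "c = (THE c. ((\<lambda>\<tau>. t (moebius A \<tau>)) \<longlongrightarrow> c) at_ii_inf)"
proof -
  have "(\<lambda>P. the_elem (sphere_value t ` P)) ` modular_curve \<Gamma> = UNIV"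
    using t_unif by (simp add: uniformizer_def bij_betw_def)
  then obtain P where "P \<in> modular_curve \<Gamma>" and P: "the_elem (sphere_value t ` P) = Some c"
    by (metis (no_types, lifting) UNIV_I imageE)
  then obtain x where x: "x \<in> extended_half_plane" "P = orbit_pt \<Gamma> x" by (auto simp: modular_curve_def)
  have "x \<notin> Some ` upper_half_plane"
  proof
    assume "x \<in> Some ` upper_half_plane"
    then obtain z where z: "x = Some z" "Im z > 0" by (auto simp: upper_half_plane_def)
    then show False using P c[of z] by (simp add: x(2) the_elem_uhp split: if_splits)
  qed
  then have "x \<in> cusps" using x by (auto simp: extended_half_plane_eq)
  then obtain A where A: "A \<in> SL2Z" "moebius_ext A None = x" using cusp_SL2Z by blast
  have "the_elem (sphere_value t ` orbit_pt \<Gamma> (moebius_ext A None)) =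
     (if filterlim (\<lambda>\<tau>. t (moebius A \<tau>)) at_infinity at_ii_inf then None
     else Some (THE c. ((\<lambda>\<tau>. t (moebius A \<tau>)) \<longlongrightarrow> c) at_ii_inf))"
    by (rule the_elem_const) (rule sphere_value_cusp_orbit[OF A(1)])
  then show ?thesis using that[OF A(1)] P by (simp add: x(2) A(2) split: if_splits)
qed

section \<open>Size of E / Z^k in terms of t near the pole of t\<close>

lemma eventually_Im_pos: "\<forall>\<^sub>F \<tau> in at_ii_inf. Im \<tau> > 0"
  unfolding eventually_at_ii_inf by (intro exI[of _ 1]) auto

lemma eventually_norm_analytic_nome_gt:
  assumes "g analytic_on {0}" "g 0 \<noteq> 0" "h > 0"
  shows "\<forall>\<^sub>F \<tau> in at_ii_inf. norm (g (nome h \<tau>)) > norm (g 0) / 2"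
  by (rule order_tendstoD(1)[OF tendsto_norm[OF tendsto_analytic_nome[OF assms(1,3)]]]) (use assms in simp)

text \<open>E / Z^k has weight 0: the factors c \<tau> + d in the growth of E cancel against those
  in the slash action on Z.\<close>

lemma slash_bound:
  assumes "det A = 1" "Im \<tau> > 0" "Z (moebius A \<tau>) \<noteq> 0" "norm (E (moebius A \<tau>)) \<le> C * norm (mden A \<tau>) ^ k"
  shows "norm (E (moebius A \<tau>) / Z (moebius A \<tau>) ^ k) \<le> C / norm (slash 1 Z A \<tau>) ^ k"
proof -
  have j: "mden A \<tau> \<noteq> 0" using mden_nonzero[of A \<tau>] assms by simp
  have "norm (slash 1 Z A \<tau>) = norm (Z (moebius A \<tau>)) / norm (mden A \<tau>)"
    by (simp add: slash_det_1[OF assms(1)] norm_mult norm_inverse divide_inverse mult.commute)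
  then have "C / norm (slash 1 Z A \<tau>) ^ k = C * norm (mden A \<tau>) ^ k / norm (Z (moebius A \<tau>)) ^ k"
    by (simp add: power_divide)
  also have "\<dots> \<ge> norm (E (moebius A \<tau>)) / norm (Z (moebius A \<tau>)) ^ k"
    by (intro divide_right_mono assms) auto
  finally show ?thesis by (simp add: norm_divide norm_power)
qed

text \<open>Meant for e = |E|, x = |Z| and y = |t| near the pole of t, or their counterparts after
  the slash action. The lower bound q for x y expresses that the zero of Z is no deeper than the
  pole of t.\<close>

lemma ratio_bound:
  fixes x y q e B :: real
  assumes "0 < q" "q \<le> x * y" "0 < x" "0 \<le> e" "e \<le> B"
  shows "e / x ^ k \<le> B / q ^ k * y ^ k"
proof -
  have "q ^ k \<le> (x * y) ^ k" using assms by (intro power_mono) auto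
  then have "B * q ^ k \<le> B * (x ^ k * y ^ k)" using assms by (intro mult_left_mono) (auto simp: power_mult_distrib)
  moreover have "e * q ^ k \<le> B * q ^ k" using assms by (intro mult_right_mono) auto
  ultimately have "e * q ^ k \<le> (B * y ^ k) * x ^ k" by (simp add: mult_ac)
  then have "e / x ^ k \<le> (B * y ^ k) / q ^ k" using assms by (intro frac_le_eq[THEN iffD2] | simp add: divide_le_eq pos_le_divide_eq mult_ac)+
  then show ?thesis by simp
qed

text \<open>With e the elliptic order, t has a pole of order exactly e at z0 in the coordinate z and
  Z a zero of order m <= e. Hence |Z t| stays above a positive constant near z0. Every large value
  is taken by t near z0.\<close>

lemma growth_at_interior_pole:
  assumes E_hol: "E holomorphic_on upper_half_plane" and z0: "x0 = Some z0" "Im z0 > 0"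
  shows "\<exists>r C. \<forall>W. norm W > r \<longrightarrow> (\<exists>z. Im z > 0 \<and> Z z \<noteq> 0 \<and> t z = W \<and> norm (E z / Z z ^ k) \<le> C * norm W ^ k)"
proof -
  define e where "e = elliptic_order \<Gamma> z0"
  have e: "e > 0" unfolding e_def by (rule elliptic_order_pos[OF z0(2)])
  have pole: "is_pole t z0" using pole_iff_orbit[OF z0(2)] orbit_pt_self[of x0] z0(1) by simp
  have "order_at \<Gamma> 0 t (Some z0) = -1"
    using uniformizer_order[OF half_plane_extended[OF z0(2)]] pole by (simp add: sphere_value_uhp[OF z0(2)])
  then have "real_of_int (zorder t z0) = - real e" using e by (simp add: order_at_uhp[OF z0(2)] e_def[symmetric] field_simps)
  then have zt: "zorder t z0 = - int e" by linarith
  have "real_of_int (zorder Z z0) \<le> real e"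
    using Z_order e unfolding z0(1) by (simp add: order_at_uhp[OF z0(2)] e_def[symmetric] divide_le_eq)
  then have zZ: "zorder Z z0 \<le> int e" by linarith
  have fr: "\<exists>\<^sub>F w in at z0. t w \<noteq> 0" "\<exists>\<^sub>F w in at z0. Z w \<noteq> 0"
    by (intro frequently_at_if_eventually t_avoid Z_avoid z0(2))+
  have zZ0: "zorder Z z0 \<ge> 0" by (rule zorder_ge_0[OF Z_analytic[OF z0(2)] fr(2)])
  define m where "m = nat (zorder Z z0)"
  have m: "zorder Z z0 = int m" "m \<le> e" using zZ zZ0 by (auto simp: m_def)
  define gt gZ where "gt = zor_poly t z0" and "gZ = zor_poly Z z0"
  obtain r1 where gt0: "gt z0 \<noteq> 0" and r1: "r1 > 0" "gt holomorphic_on cball z0 r1"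
    "\<And>w. w \<in> cball z0 r1 - {z0} \<Longrightarrow> t w = gt w * (w - z0) powi (- int e) \<and> gt w \<noteq> 0"
    using zorder_exist[OF t_isolated[OF z0(2)] fr(1)] unfolding zt gt_def by blast
  obtain r2 where gZ0: "gZ z0 \<noteq> 0" and r2: "r2 > 0" "gZ holomorphic_on cball z0 r2"
    "\<And>w. w \<in> cball z0 r2 - {z0} \<Longrightarrow> Z w = gZ w * (w - z0) powi (int m) \<and> gZ w \<noteq> 0"
    using zorder_exist[OF isolated_singularity_at_analytic[OF Z_analytic[OF z0(2)]]
        not_essential_analytic[OF Z_analytic[OF z0(2)]] fr(2)] unfolding m(1) gZ_def by blast
  have an: "gt analytic_on {z0}" "gZ analytic_on {z0}" "E analytic_on {z0}"
  proof -
    have "gt holomorphic_on ball z0 r1" "gZ holomorphic_on ball z0 r2"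
      using r1(2) r2(2) by (auto intro: holomorphic_on_subset[OF _ ball_subset_cball])
    then show "gt analytic_on {z0}" "gZ analytic_on {z0}"
      using r1(1) r2(1) unfolding analytic_at by (meson centre_in_ball open_ball)+
    show "E analytic_on {z0}"
      using E_hol open_upper_half_plane z0(2) unfolding analytic_at by (auto simp: upper_half_plane_def)
  qed
  note cont = an[THEN analytic_at_imp_isCont, unfolded isCont_def]
  define a b B where "a = norm (gt z0) / 2" and "b = norm (gZ z0) / 2" and "B = norm (E z0) + 1"
  have ab: "a > 0" "b > 0" using gt0 gZ0 by (auto simp: a_def b_def)
  have "\<forall>\<^sub>F w in at z0. norm (gt w) > a" "\<forall>\<^sub>F w in at z0. norm (gZ w) > b" "\<forall>\<^sub>F w in at z0. norm (E w) < B"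
    using order_tendstoD(1)[OF tendsto_norm[OF cont(1)], of a] order_tendstoD(1)[OF tendsto_norm[OF cont(2)], of b]
      order_tendstoD(2)[OF tendsto_norm[OF cont(3)], of B] gt0 gZ0 by (auto simp: a_def b_def B_def)
  moreover have "\<forall>\<^sub>F w in at z0. w \<in> {w. Im w > 0}"
    by (rule eventually_at_in_open') (use z0(2) in \<open>auto intro: open_halfspace_Im_gt\<close>)
  moreover have "\<forall>\<^sub>F w in at z0. w \<in> ball z0 (min (min r1 r2) 1) - {z0}"
    by (rule eventually_at_in_open) (use r1(1) r2(1) in auto)
  ultimately have "\<forall>\<^sub>F w in at z0. norm (gt w) > a \<and> norm (gZ w) > b \<and> norm (E w) < B \<and> Im w > 0 \<and>
      w \<in> ball z0 (min (min r1 r2) 1) - {z0}"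
    by eventually_elim auto
  then obtain d where d: "d > 0" "\<And>w. w \<noteq> z0 \<Longrightarrow> dist w z0 < d \<Longrightarrow> norm (gt w) > a \<and> norm (gZ w) > b \<and>
      norm (E w) < B \<and> Im w > 0 \<and> w \<in> ball z0 (min (min r1 r2) 1) - {z0}"
    by (auto simp: eventually_at)
  \<comment> \<open>This is 1 / t continued analytically by the value 0 at z0; its open mapping
    property at 0 produces points where t is a given large W.\<close>
  define \<psi> where "\<psi> = (\<lambda>w. (w - z0) ^ e / gt w)"
  have \<psi>: "\<psi> analytic_on {z0}" unfolding \<psi>_def using gt0 by (intro analytic_intros an) auto
  have \<psi>0: "\<psi> z0 = 0" using e by (simp add: \<psi>_def)
  have nc: "\<not> (\<forall>\<^sub>F w in at z0. \<psi> w = \<psi> z0)"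
  proof
    assume "\<forall>\<^sub>F w in at z0. \<psi> w = \<psi> z0"
    moreover have "\<forall>\<^sub>F w in at z0. norm (gt w) > a" by fact
    moreover have "\<forall>\<^sub>F w in at z0. w \<noteq> z0" by (simp add: eventually_at_filter)
    ultimately have "\<forall>\<^sub>F w in at z0. False"
    proof eventually_elim
      case (elim w)
      then have "\<psi> w = 0" using \<psi>0 by simp
      then show ?case using elim ab by (auto simp: \<psi>_def)
    qed
    then show False by simp
  qed
  obtain r where r: "r > 0" "\<And>v. dist v (\<psi> z0) < r \<Longrightarrow> \<exists>w\<in>ball z0 d. \<psi> w = v"
    using analytic_cover[OF \<psi> nc d(1)] by blast
  have "\<exists>z. Im z > 0 \<and> Z z \<noteq> 0 \<and> t z = W \<and> norm (E z / Z z ^ k) \<le> B / (a * b) ^ k * norm W ^ k"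
    if W: "norm W > 1 / r" for W
  proof -
    have "norm W > 0" using W r(1) by (meson less_trans zero_less_divide_1_iff)
    then have W0: "W \<noteq> 0" by auto
    have "dist (1 / W) (\<psi> z0) < r" using W r(1) W0 by (simp add: \<psi>0 norm_divide field_simps)
    then obtain w where w: "w \<in> ball z0 d" "\<psi> w = 1 / W" using r(2) by blast
    have "w \<noteq> z0" using w W0 \<psi>0 by auto
    then have dw: "norm (gt w) > a" "norm (gZ w) > b" "norm (E w) < B" "Im w > 0"
      "w \<in> ball z0 (min (min r1 r2) 1) - {z0}"
      using d(2)[of w] w(1) by (auto simp: dist_commute)
    have tw: "t w = gt w * (w - z0) powi (- int e)" "gt w \<noteq> 0" using r1(3)[of w] dw(5) by auto
    have Zw: "Z w = gZ w * (w - z0) ^ m" "gZ w \<noteq> 0" using r2(3)[of w] dw(5) by auto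
    have "t w = 1 / \<psi> w" using tw by (simp add: \<psi>_def power_int_minus divide_inverse)
    then have tW: "t w = W" using w(2) by simp
    have Z0: "Z w \<noteq> 0" using Zw \<open>w \<noteq> z0\<close> by simp
    define s where "s = norm (w - z0)"
    have s: "0 < s" "s \<le> 1" using dw(5) \<open>w \<noteq> z0\<close> by (auto simp: s_def dist_norm norm_minus_commute)
    have "s ^ e \<le> s ^ m" using s m(2) by (intro power_decreasing) auto
    have "norm (Z w) = norm (gZ w) * s ^ m" by (simp add: Zw(1) norm_mult norm_power s_def)
    moreover have "norm W = norm (gt w) / s ^ e"
      unfolding tW[symmetric] tw(1) by (simp add: norm_mult power_int_minus norm_inverse norm_power s_def divide_inverse)
    ultimately have eq: "norm (Z w) * norm W = norm (gZ w) * norm (gt w) * (s ^ m / s ^ e)" by simp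
    have "1 \<le> s ^ m / s ^ e" using \<open>s ^ e \<le> s ^ m\<close> s by simp
    then have "b * a * 1 \<le> norm (gZ w) * norm (gt w) * (s ^ m / s ^ e)"
      using dw(1,2) ab by (intro mult_mono) auto
    then have "a * b \<le> norm (Z w) * norm W" unfolding eq by (simp only: mult.commute[of b a] mult_1_right)
    then have "norm (E w) / norm (Z w) ^ k \<le> B / (a * b) ^ k * norm W ^ k"
      by (intro ratio_bound) (use ab Z0 dw(3) in auto)
    then show ?thesis using dw(4) Z0 tW by (intro exI[of _ w]) (simp add: norm_divide norm_power)
  qed
  then show ?thesis by blast
qed

text \<open>The same comparison in the local parameter s of the cusp: |t| is at least a constant
  times 1 / |s|, and the slashed Z is at least a constant times |s| because its exponent is at most
  1.\<close>

lemma growth_at_cusp_pole: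
  assumes E_cusp: "\<And>A. A \<in> SL2Z \<Longrightarrow> \<exists>C. \<forall>\<^sub>F \<tau> in at_ii_inf. norm (E (moebius A \<tau>)) \<le> C * norm (mden A \<tau>) ^ k"
    and x0c: "x0 \<in> cusps"
  shows "\<exists>r C. \<forall>W. norm W > r \<longrightarrow> (\<exists>z. Im z > 0 \<and> Z z \<noteq> 0 \<and> t z = W \<and> norm (E z / Z z ^ k) \<le> C * norm W ^ k)"
proof -
  obtain A where A: "A \<in> SL2Z" "moebius_ext A None = x0" using cusp_SL2Z[OF x0c] by blast
  have dA: "det A = 1" "det A > 0" using SL2Z_det[OF A(1)] by simp_all
  define h where "h = cusp_width \<Gamma> A"
  obtain n :: int and g where h: "h > 0" and g: "g analytic_on {0}" "g 0 \<noteq> 0"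
    and tg: "\<forall>\<^sub>F \<tau> in at_ii_inf. t (moebius A \<tau>) = nome h \<tau> powi n * g (nome h \<tau>)"
    and on: "order_at \<Gamma> 0 t (moebius_ext A None) = of_int n"
    unfolding h_def by (rule t_cusp_factor[OF A(1)])
  obtain \<beta> g2 where \<beta>: "\<beta> \<ge> 0" and g2: "g2 analytic_on {0}" "g2 0 \<noteq> 0"
    and Zg: "\<forall>\<^sub>F \<tau> in at_ii_inf. slash 1 Z A \<tau> = exp (2 * pi * \<i> * of_real \<beta> * \<tau> / of_real h) * g2 (nome h \<tau>)"
    and oZ: "order_at \<Gamma> 1 Z (moebius_ext A None) = \<beta>"
    unfolding h_def by (rule Z_cusp_factor[OF A(1)])
  have "order_at \<Gamma> 0 t x0 < 0" using t_pole x0 orbit_pt_self[of x0] by blast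
  then have n: "n \<le> - 1" using on A(2) by simp
  have \<beta>1: "\<beta> \<le> 1" using Z_order oZ A(2) by simp
  obtain C where C: "\<forall>\<^sub>F \<tau> in at_ii_inf. norm (E (moebius A \<tau>)) \<le> C * norm (mden A \<tau>) ^ k"
    using E_cusp[OF A(1)] by blast
  define a b where "a = norm (g 0) / 2" and "b = norm (g2 0) / 2"
  have ab: "a > 0" "b > 0" using g g2 by (auto simp: a_def b_def)
  have "\<forall>\<^sub>F \<tau> in at_ii_inf. moebius A \<tau> \<in> {z. Im z > 0 \<and> Z z \<noteq> 0} \<and> g (nome h \<tau>) \<noteq> 0 \<and>
      t (moebius A \<tau>) = nome h \<tau> powi n * g (nome h \<tau>) \<and>
      norm (E (moebius A \<tau>) / Z (moebius A \<tau>) ^ k) \<le> \<bar>C\<bar> / (a * b) ^ k * norm (t (moebius A \<tau>)) ^ k"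
    using eventually_Im_pos tg Zg C eventually_norm_analytic_nome_gt[OF g h] eventually_norm_analytic_nome_gt[OF g2 h]
  proof eventually_elim
    case (elim \<tau>)
    define q where "q = norm (nome h \<tau>)"
    have q: "0 < q" "q < 1" using elim(1) h by (simp_all add: q_def norm_nome)
    have ns: "norm (slash 1 Z A \<tau>) = exp (- 2 * pi * \<beta> * Im \<tau> / h) * norm (g2 (nome h \<tau>))"
      unfolding elim(3) by (simp add: norm_mult norm_exp_eq_Re Re_divide_of_real)
    have "\<beta> * (2 * pi * Im \<tau> / h) \<le> 1 * (2 * pi * Im \<tau> / h)"
      using \<beta>1 elim(1) h by (intro mult_right_mono) auto
    then have "q \<le> exp (- 2 * pi * \<beta> * Im \<tau> / h)" by (simp add: q_def norm_nome mult_ac)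
    then have "q * b \<le> norm (slash 1 Z A \<tau>)"
      unfolding ns using elim(6) ab q by (intro mult_mono) (auto simp: b_def)
    moreover have "inverse q * a \<le> norm (t (moebius A \<tau>))"
    proof -
      have "norm (t (moebius A \<tau>)) = q powi n * norm (g (nome h \<tau>))"
        unfolding elim(2) by (simp add: norm_mult norm_power_int q_def)
      moreover have le: "inverse q \<le> q powi n"
      proof -
        have "inverse q ^ 1 \<le> inverse q ^ nat (- n)" using q n by (intro power_increasing) (auto simp: one_le_inverse)
        then show ?thesis using n by (simp add: power_int_def power_inverse)
      qed
      moreover have "inverse q * a \<le> q powi n * norm (g (nome h \<tau>))"
        by (rule mult_mono[OF le]) (use elim(5) ab q in \<open>auto simp: a_def\<close>)
      ultimately show ?thesis by simp
    qed
    ultimately have "(q * b) * (inverse q * a) \<le> norm (slash 1 Z A \<tau>) * norm (t (moebius A \<tau>))"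
      using q ab by (intro mult_mono) auto
    then have prod: "a * b \<le> norm (slash 1 Z A \<tau>) * norm (t (moebius A \<tau>))" using q by (simp add: field_simps)
    have spos: "norm (slash 1 Z A \<tau>) > 0"
      using \<open>q * b \<le> norm (slash 1 Z A \<tau>)\<close> q ab by (meson less_le_trans mult_pos_pos)
    then have Z0: "Z (moebius A \<tau>) \<noteq> 0" by (auto simp: slash_det_1[OF dA(1)])
    have "norm (E (moebius A \<tau>)) \<le> \<bar>C\<bar> * norm (mden A \<tau>) ^ k"
      using elim(4) by (rule order_trans) (intro mult_right_mono, auto)
    then have "norm (E (moebius A \<tau>) / Z (moebius A \<tau>) ^ k) \<le> \<bar>C\<bar> / norm (slash 1 Z A \<tau>) ^ k"
      by (rule slash_bound[OF dA(1) elim(1) Z0])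
    also have "\<dots> \<le> \<bar>C\<bar> / (a * b) ^ k * norm (t (moebius A \<tau>)) ^ k"
      by (rule ratio_bound[OF _ prod spos]) (use ab in auto)
    finally show ?case using elim(2,5) ab Z0 Im_moebius_pos[OF dA(2) elim(1)] by (auto simp: a_def)
  qed
  then obtain Y where Y: "Y > 0" "\<And>\<tau>. Im \<tau> > Y \<Longrightarrow> moebius A \<tau> \<in> {z. Im z > 0 \<and> Z z \<noteq> 0} \<and> g (nome h \<tau>) \<noteq> 0 \<and>
      t (moebius A \<tau>) = nome h \<tau> powi n * g (nome h \<tau>) \<and>
      norm (E (moebius A \<tau>) / Z (moebius A \<tau>) ^ k) \<le> \<bar>C\<bar> / (a * b) ^ k * norm (t (moebius A \<tau>)) ^ k"
    unfolding eventually_at_ii_inf by blast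
  define \<psi> where "\<psi> = (\<lambda>w. w ^ nat (- n) / g w)"
  have \<psi>: "\<psi> analytic_on {0}" unfolding \<psi>_def using g by (intro analytic_intros) auto
  have \<psi>0: "\<psi> 0 = 0" using n by (simp add: \<psi>_def power_0_left)
  have "\<forall>\<^sub>F \<tau> in at_ii_inf. g (nome h \<tau>) \<noteq> 0"
    unfolding eventually_at_ii_inf using Y by blast
  then have g_ev: "\<forall>\<^sub>F w in at 0. g w \<noteq> 0" using eventually_nome[OF h, of "\<lambda>w. g w \<noteq> 0"] by simp
  have nc: "\<not> (\<forall>\<^sub>F w in at 0. \<psi> w = \<psi> 0)"
  proof
    assume "\<forall>\<^sub>F w in at 0. \<psi> w = \<psi> 0"
    moreover have "\<forall>\<^sub>F w in at (0::complex). w \<noteq> 0" by (simp add: eventually_at_filter)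
    ultimately have "\<forall>\<^sub>F w in at (0::complex). False"
      using g_ev
    proof eventually_elim
      case (elim w)
      then have "\<psi> w = 0" using \<psi>0 by simp
      then show ?case using elim by (simp add: \<psi>_def)
    qed
    then show False by simp
  qed
  obtain r where r: "r > 0" "\<And>v. dist v (\<psi> 0) < r \<Longrightarrow> \<exists>w\<in>ball 0 (exp (- 2 * pi * Y / h)). \<psi> w = v"
    using analytic_cover[OF \<psi> nc, of "exp (- 2 * pi * Y / h)"] by auto
  have "\<exists>z. Im z > 0 \<and> Z z \<noteq> 0 \<and> t z = W \<and> norm (E z / Z z ^ k) \<le> \<bar>C\<bar> / (a * b) ^ k * norm W ^ k"
    if W: "norm W > 1 / r" for W
  proof -
    have "norm W > 0" using W r(1) by (meson less_trans zero_less_divide_1_iff)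
    then have W0: "W \<noteq> 0" by auto
    have "dist (1 / W) (\<psi> 0) < r" using W r(1) W0 by (simp add: \<psi>0 norm_divide field_simps)
    then obtain w where w: "w \<in> ball 0 (exp (- 2 * pi * Y / h))" "\<psi> w = 1 / W" using r(2) by blast
    have "w \<noteq> 0" using w W0 \<psi>0 by auto
    then obtain \<tau> where \<tau>: "Im \<tau> > Y" "nome h \<tau> = w" using nome_surj[OF h, of w Y] w by auto
    have "t (moebius A \<tau>) = w powi n * g w" using Y(2)[OF \<tau>(1)] \<tau>(2) by simp
    also have "\<dots> = 1 / \<psi> w" using n by (simp add: \<psi>_def power_int_def divide_inverse power_inverse mult.commute)
    finally have "t (moebius A \<tau>) = W" using w(2) by simp
    then show ?thesis using Y(2)[OF \<tau>(1)] by (intro exI[of _ "moebius A \<tau>"]) auto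
  qed
  then show ?thesis by blast
qed

text \<open>\<open>E / Z\<^sup>k\<close> is an entire function of \<open>t\<close> (values that \<open>t\<close> takes only at cusps are removable) and
  grows at most like \<open>t\<^sup>k\<close>, because \<open>Z\<close> vanishes at most to the order of the pole of \<open>t\<close>.\<close>

theorem form_is_polynomial:
  assumes E_hol: "E holomorphic_on upper_half_plane"
    and E_inv: "\<And>\<gamma> \<tau>. \<gamma> \<in> \<Gamma> \<Longrightarrow> Im \<tau> > 0 \<Longrightarrow> E (moebius \<gamma> \<tau>) * Z \<tau> ^ k = E \<tau> * Z (moebius \<gamma> \<tau>) ^ k"
    and E_cusp: "\<And>A. A \<in> SL2Z \<Longrightarrow> \<exists>C. \<forall>\<^sub>F \<tau> in at_ii_inf. norm (E (moebius A \<tau>)) \<le> C * norm (mden A \<tau>) ^ k"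
  shows "\<exists>a. \<forall>z. Im z > 0 \<and> Z z \<noteq> 0 \<longrightarrow> E z = Z z ^ k * (\<Sum>i\<le>k. a i * t z ^ i)"
proof -
  define D where "D = {z. Im z > 0 \<and> Z z \<noteq> 0}"
  define f where "f = (\<lambda>z. E z / Z z ^ k)"
  have D_uhp: "D = upper_half_plane \<inter> Z -` (- {0})" by (auto simp: D_def upper_half_plane_def)
  have "open D" unfolding D_uhp
    by (rule continuous_open_preimage[OF holomorphic_on_imp_continuous_on[OF Z_hol] open_upper_half_plane]) auto
  have D_sub: "D \<subseteq> upper_half_plane" by (auto simp: D_uhp)
  have np: "\<not> is_pole t z" if "z \<in> D" for z using that pole_iff_zero[of z] by (auto simp: D_def)
  have t_hol: "t holomorphic_on D"
  proof (rule analytic_imp_holomorphic)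
    show "t analytic_on D"
      unfolding analytic_on_analytic_at[of t D] using np by (auto simp: D_def intro: t_analytic)
  qed
  have f_hol: "f holomorphic_on D"
    unfolding f_def by (intro holomorphic_intros holomorphic_on_subset[OF E_hol D_sub] holomorphic_on_subset[OF Z_hol D_sub])
      (auto simp: D_def)
  have "\<exists>a. \<forall>z\<in>D. f z = (\<Sum>i\<le>k. a i * t z ^ i)"
  proof (rule polynomial_in_open_map[OF t_hol f_hol \<open>open D\<close>])
    show "\<forall>\<^sub>F w in at z. t w \<noteq> t z" if "z \<in> D" for z using that by (intro t_avoid) (simp add: D_def)
  next
    fix z z' assume zz: "z \<in> D" "z' \<in> D" "t z = t z'"
    then have im: "Im z > 0" "Im z' > 0" "Z z \<noteq> 0" "Z z' \<noteq> 0" by (auto simp: D_def)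
    obtain \<gamma> where "\<gamma> \<in> \<Gamma>" "z' = moebius \<gamma> z"
      using same_value_same_orbit[OF im(1,2) np[OF zz(1)] np[OF zz(2)] zz(3)] by blast
    then show "f z = f z'" using E_inv[of \<gamma> z] im by (simp add: f_def frac_eq_eq)
  next
    fix c assume "c \<notin> t ` D"
    then have "t z \<noteq> c" if "Im z > 0" "\<not> is_pole t z" for z
      using that pole_iff_zero[OF that(1)] by (auto simp: D_def)
    then obtain A where A: "A \<in> SL2Z" "\<not> filterlim (\<lambda>\<tau>. t (moebius A \<tau>)) at_infinity at_ii_inf"
      and c: "c = (THE c. ((\<lambda>\<tau>. t (moebius A \<tau>)) \<longlongrightarrow> c) at_ii_inf)"
      using missed_value_cusp by blast
    have dA: "det A = 1" "det A > 0" using SL2Z_det[OF A(1)] by simp_all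
    obtain n :: int and g where h: "cusp_width \<Gamma> A > 0" and g: "g analytic_on {0}" "g 0 \<noteq> 0"
      and tg: "\<forall>\<^sub>F \<tau> in at_ii_inf. t (moebius A \<tau>) = nome (cusp_width \<Gamma> A) \<tau> powi n * g (nome (cusp_width \<Gamma> A) \<tau>)"
      and on: "order_at \<Gamma> 0 t (moebius_ext A None) = of_int n"
      by (rule t_cusp_factor[OF A(1)])
    define h where "h = cusp_width \<Gamma> A"
    have h: "h > 0" using h by (simp add: h_def)
    have n: "n \<ge> 0"
    proof (rule ccontr)
      assume "\<not> n \<ge> 0"
      define m where "m = nat (- n - 1)"
      have m: "n = - int (Suc m)" using \<open>\<not> n \<ge> 0\<close> by (simp add: m_def)
      have "filterlim (\<lambda>\<tau>. g (nome h \<tau>) / nome h \<tau> ^ Suc m) at_infinity at_ii_inf"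
      proof (rule filterlim_divide_at_infinity[OF tendsto_analytic_nome[OF g(1) h] _ g(2)])
        have "((\<lambda>\<tau>. nome h \<tau> ^ Suc m) \<longlongrightarrow> 0 ^ Suc m) at_ii_inf"
          using filterlim_nome[OF h] by (intro tendsto_power) (simp add: filterlim_at)
        then show "filterlim (\<lambda>\<tau>. nome h \<tau> ^ Suc m) (at 0) at_ii_inf"
          by (intro filterlim_atI) auto
      qed
      moreover have "\<forall>\<^sub>F \<tau> in at_ii_inf. g (nome h \<tau>) / nome h \<tau> ^ Suc m = t (moebius A \<tau>)"
        using tg unfolding h_def[symmetric] m
        by eventually_elim (simp add: power_int_minus divide_inverse mult.commute del: power_Suc of_nat_Suc)
      ultimately have "filterlim (\<lambda>\<tau>. t (moebius A \<tau>)) at_infinity at_ii_inf"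
        by (subst (asm) filterlim_cong[OF refl refl])
      with A(2) show False by simp
    qed
    define \<phi> where "\<phi> = (\<lambda>w. w ^ nat n * g w)"
    have \<phi>: "\<phi> analytic_on {0}" unfolding \<phi>_def by (intro analytic_intros g)
    have t\<phi>: "\<forall>\<^sub>F \<tau> in at_ii_inf. t (moebius A \<tau>) = \<phi> (nome h \<tau>)"
      using tg unfolding h_def[symmetric] by eventually_elim (use n in \<open>simp add: \<phi>_def power_int_def\<close>)
    have lim: "((\<lambda>\<tau>. t (moebius A \<tau>)) \<longlongrightarrow> \<phi> 0) at_ii_inf"
      by (subst filterlim_cong[OF refl refl t\<phi>]) (rule tendsto_analytic_nome[OF \<phi> h])
    then have c0: "c = \<phi> 0" unfolding c
      by (intro the_equality) (auto intro: tendsto_unique[OF at_ii_inf_neq_bot])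
    have nc: "\<not> (\<forall>\<^sub>F w in at 0. \<phi> w = \<phi> 0)"
    proof
      assume "\<forall>\<^sub>F w in at 0. \<phi> w = \<phi> 0"
      then have "\<forall>\<^sub>F \<tau> in at_ii_inf. \<phi> (nome h \<tau>) = \<phi> 0"
        using eventually_nome[OF h, of "\<lambda>w. \<phi> w = \<phi> 0"] by simp
      with t\<phi> have "\<forall>\<^sub>F \<tau> in at_ii_inf. t (moebius A \<tau>) = \<phi> 0" by eventually_elim simp
      with moebius_frequent[OF dA(2) t_avoid] show False by blast
    qed
    have xe: "moebius_ext A None \<in> extended_half_plane"
      using SL2Z_cusp[OF A(1)] by (simp add: extended_half_plane_eq)
    obtain \<beta> g2 where \<beta>: "\<beta> \<ge> 0" and g2: "g2 analytic_on {0}" "g2 0 \<noteq> 0"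
      and Zg: "\<forall>\<^sub>F \<tau> in at_ii_inf. slash 1 Z A \<tau> = exp (2 * pi * \<i> * of_real \<beta> * \<tau> / of_real h) * g2 (nome h \<tau>)"
      and oZ: "order_at \<Gamma> 1 Z (moebius_ext A None) = \<beta>"
      unfolding h_def by (rule Z_cusp_factor[OF A(1)])
    \<comment> \<open>At this cusp t is finite, so it is not the place where Z vanishes. The
      exponent of Z is thus 0, the slashed Z stays away from 0, and E / Z^k is bounded near the
      cusp.\<close>
    have "moebius_ext A None \<notin> orbit_pt \<Gamma> x0" using t_pole xe on n by auto
    then have "\<beta> = 0" using Z_zero xe oZ \<beta> by force
    then have Zg: "\<forall>\<^sub>F \<tau> in at_ii_inf. slash 1 Z A \<tau> = g2 (nome h \<tau>)" using Zg by simp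
    obtain C where C: "\<forall>\<^sub>F \<tau> in at_ii_inf. norm (E (moebius A \<tau>)) \<le> C * norm (mden A \<tau>) ^ k"
      using E_cusp[OF A(1)] by blast
    define C' where "C' = \<bar>C\<bar> / (norm (g2 0) / 2) ^ k"
    have "\<forall>\<^sub>F \<tau> in at_ii_inf. moebius A \<tau> \<in> D \<and> t (moebius A \<tau>) = \<phi> (nome h \<tau>) \<and> norm (f (moebius A \<tau>)) \<le> C'"
      using eventually_Im_pos t\<phi> Zg C eventually_norm_analytic_nome_gt[OF g2 h]
    proof eventually_elim
      case (elim \<tau>)
      have s: "norm (slash 1 Z A \<tau>) > norm (g2 0) / 2" using elim by simp
      then have "slash 1 Z A \<tau> \<noteq> 0" by (metis less_asym norm_ge_zero norm_zero not_less zero_le_divide_iff zero_le_numeral)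
      then have Z0: "Z (moebius A \<tau>) \<noteq> 0" by (auto simp: slash_det_1[OF dA(1)])
      have "norm (E (moebius A \<tau>)) \<le> \<bar>C\<bar> * norm (mden A \<tau>) ^ k"
        using elim(4) by (rule order_trans) (intro mult_right_mono, auto)
      then have "norm (f (moebius A \<tau>)) \<le> \<bar>C\<bar> / norm (slash 1 Z A \<tau>) ^ k"
        unfolding f_def by (rule slash_bound[OF dA(1) elim(1) Z0])
      also have "\<dots> \<le> C'" unfolding C'_def using s g2
        by (intro divide_left_mono power_mono mult_pos_pos zero_less_power) auto
      finally show ?case using elim Z0 Im_moebius_pos[OF dA(2) elim(1)] by (simp add: D_def)
    qed
    then obtain Y where Y: "Y > 0" "\<And>\<tau>. Im \<tau> > Y \<Longrightarrow>
        moebius A \<tau> \<in> D \<and> t (moebius A \<tau>) = \<phi> (nome h \<tau>) \<and> norm (f (moebius A \<tau>)) \<le> C'"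
      by (auto simp: eventually_at_ii_inf)
    obtain r where r: "r > 0" "\<And>v. dist v (\<phi> 0) < r \<Longrightarrow> \<exists>w\<in>ball 0 (exp (- 2 * pi * Y / h)). \<phi> w = v"
      using analytic_cover[OF \<phi> nc, of "exp (- 2 * pi * Y / h)"] by auto
    have "\<exists>z\<in>D. t z = v \<and> norm (f z) \<le> C'" if v: "0 < dist v c" "dist v c < r" for v
    proof -
      obtain w where w: "w \<in> ball 0 (exp (- 2 * pi * Y / h))" "\<phi> w = v" using r(2) v c0 by blast
      have "w \<noteq> 0" using w v c0 by auto
      then obtain \<tau> where "Im \<tau> > Y" "nome h \<tau> = w" using nome_surj[OF h, of w Y] w by auto
      then show ?thesis using Y(2)[of \<tau>] w by (intro bexI[of _ "moebius A \<tau>"]) auto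
    qed
    then show "\<exists>r>0. \<exists>C. \<forall>w. 0 < dist w c \<and> dist w c < r \<longrightarrow> (\<exists>z\<in>D. t z = w \<and> norm (f z) \<le> C)"
      using r(1) by blast
  next
    show "\<exists>r C. \<forall>w. norm w > r \<longrightarrow> (\<exists>z\<in>D. t z = w \<and> norm (f z) \<le> C * norm w ^ k)"
    proof (cases "x0 \<in> cusps")
      case True
      show ?thesis using growth_at_cusp_pole[OF E_cusp True] unfolding D_def f_def by blast
    next
      case False
      then obtain z0 where "x0 = Some z0" "Im z0 > 0"
        using x0 by (auto simp: extended_half_plane_eq upper_half_plane_def)
      from growth_at_interior_pole[OF E_hol this] show ?thesis unfolding D_def f_def by blast
    qed
  qed
  then obtain a where a: "\<And>z. z \<in> D \<Longrightarrow> f z = (\<Sum>i\<le>k. a i * t z ^ i)" by blast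
  show ?thesis
  proof (intro exI[of _ a] allI impI)
    fix z assume z: "Im z > 0 \<and> Z z \<noteq> 0"
    then have "f z = (\<Sum>i\<le>k. a i * t z ^ i)" by (intro a) (simp add: D_def)
    then show "E z = Z z ^ k * (\<Sum>i\<le>k. a i * t z ^ i)" using z by (simp add: f_def field_simps)
  qed
qed

end


section \<open>Hall divisors and the Atkin--Lehner action on Eisenstein series\<close>

text \<open>Hall divisors of N are encoded by their sets of prime factors. The composition law of
  Atkin--Lehner involutions, e f / gcd(e, f)^2, then becomes symmetric difference.\<close>

definition hall_part :: "nat \<Rightarrow> nat set \<Rightarrow> nat" where
  "hall_part N Q = (\<Prod>q\<in>Q. q ^ multiplicity q N)"

lemma hall_part_Un: "finite A \<Longrightarrow> finite B \<Longrightarrow> A \<inter> B = {} \<Longrightarrow> hall_part N (A \<union> B) = hall_part N A * hall_part N B"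
  by (simp add: hall_part_def prod.union_disjoint)

lemma hall_part_prime_factors: "N > 0 \<Longrightarrow> hall_part N (prime_factors N) = N"
  by (simp add: hall_part_def prime_factorization_nat[symmetric])

lemma hall_part_pos: "Q \<subseteq> prime_factors N \<Longrightarrow> hall_part N Q > 0"
  unfolding hall_part_def by (intro prod_pos) (auto intro!: zero_less_power prime_gt_0_nat dest: in_prime_factors_imp_prime)

lemma hall_part_coprime:
  assumes "A \<subseteq> prime_factors N" "B \<subseteq> prime_factors N" "A \<inter> B = {}"
  shows "coprime (hall_part N A) (hall_part N B)"
  unfolding hall_part_def
proof (intro prod_coprime_left prod_coprime_right)
  fix p q assume "p \<in> A" "q \<in> B"
  then have "Factorial_Ring.prime p" "Factorial_Ring.prime q" "p \<noteq> q" using assms by (auto dest: in_prime_factors_imp_prime)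
  then show "coprime (p ^ multiplicity p N) (q ^ multiplicity q N)" by (simp add: primes_coprime)
qed

text \<open>g is the common part of the two Hall divisors, x and y are what remains of each, and l
  is the rest of N. All matrix computations below use these coordinates.\<close>

lemma hall_part_split:
  assumes N: "N > 0" and Q: "Q \<subseteq> prime_factors N" "Q' \<subseteq> prime_factors N"
  obtains g x y l where "hall_part N Q = g * x" "hall_part N Q' = g * y" "hall_part N (sym_diff Q Q') = x * y"
    "N = g * x * y * l" "g > 0" "x > 0" "y > 0"
proof -
  have fin: "finite Q" "finite Q'" using Q by (auto intro: finite_subset)
  have "hall_part N Q = hall_part N (Q \<inter> Q') * hall_part N (Q - Q')"
    using hall_part_Un[of "Q \<inter> Q'" "Q - Q'" N] fin by (metis Diff_disjoint Int_Diff_Un Int_Diff_disjoint finite_Diff finite_Int)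
  moreover have "hall_part N Q' = hall_part N (Q \<inter> Q') * hall_part N (Q' - Q)"
    using hall_part_Un[of "Q \<inter> Q'" "Q' - Q" N] fin by (metis Int_Diff_Un Int_Diff_disjoint Int_commute finite_Diff finite_Int)
  moreover have "hall_part N (sym_diff Q Q') = hall_part N (Q - Q') * hall_part N (Q' - Q)"
    using fin by (intro hall_part_Un) auto
  moreover have "N = hall_part N (Q \<inter> Q') * hall_part N (Q - Q') * hall_part N (Q' - Q) * hall_part N (prime_factors N - (Q \<union> Q'))"
  proof -
    have "prime_factors N = (((Q \<inter> Q') \<union> (Q - Q')) \<union> (Q' - Q)) \<union> (prime_factors N - (Q \<union> Q'))" using Q by auto
    then have "N = hall_part N ((((Q \<inter> Q') \<union> (Q - Q')) \<union> (Q' - Q)) \<union> (prime_factors N - (Q \<union> Q')))"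
      using hall_part_prime_factors[OF N] by simp
    also have "\<dots> = hall_part N (Q \<inter> Q') * hall_part N (Q - Q') * hall_part N (Q' - Q) * hall_part N (prime_factors N - (Q \<union> Q'))"
      using fin by (subst hall_part_Un; (subst hall_part_Un)?; (subst hall_part_Un)?; auto)
    finally show ?thesis .
  qed
  moreover have "hall_part N (Q \<inter> Q') > 0" "hall_part N (Q - Q') > 0" "hall_part N (Q' - Q) > 0"
    using Q by (auto intro!: hall_part_pos)
  ultimately show ?thesis using that by blast
qed

lemma hall_part_hall:
  assumes "N > 0" "Q \<subseteq> prime_factors N"
  shows "hall_divisor (hall_part N Q) N"
proof -
  have "N = hall_part N (Q \<union> (prime_factors N - Q))" using hall_part_prime_factors[OF assms(1)] assms(2) by (simp add: Un_absorb1)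
  also have "\<dots> = hall_part N Q * hall_part N (prime_factors N - Q)"
    using assms by (intro hall_part_Un) (auto intro: finite_subset)
  finally have eq: "N = hall_part N Q * hall_part N (prime_factors N - Q)" .
  then have "N div hall_part N Q = hall_part N (prime_factors N - Q)"
    using hall_part_pos[OF assms(2)] by (metis nonzero_mult_div_cancel_left less_not_refl)
  moreover have "coprime (hall_part N Q) (hall_part N (prime_factors N - Q))"
    using assms by (intro hall_part_coprime) auto
  ultimately show ?thesis unfolding hall_divisor_def using eq by (metis dvd_triv_left)
qed

lemma hall_divisor_eq_hall_part:
  assumes N: "N > 0" and e: "hall_divisor e N"
  shows "prime_factors e \<subseteq> prime_factors N" "hall_part N (prime_factors e) = e"
proof -
  have dvd: "e dvd N" and cop: "coprime e (N div e)" using e by (auto simp: hall_divisor_def)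
  have e0: "e > 0" using dvd N by (auto intro: dvd_pos_nat)
  show "prime_factors e \<subseteq> prime_factors N" using dvd N by (intro dvd_prime_factors) auto
  have "multiplicity q N = multiplicity q e" if q: "q \<in> prime_factors e" for q
  proof -
    have pq: "Factorial_Ring.prime q" "q dvd e" using q by auto
    have "\<not> q dvd N div e" using cop pq by (meson coprime_common_divisor not_prime_unit)
    then have "multiplicity q (N div e) = 0" by (rule not_dvd_imp_multiplicity_0)
    moreover have "N div e \<noteq> 0" using dvd N e0 by (auto elim!: dvdE)
    ultimately have "multiplicity q (e * (N div e)) = multiplicity q e"
      using pq e0 by (subst prime_elem_multiplicity_mult_distrib) auto
    then show ?thesis using dvd by simp
  qed
  then have "hall_part N (prime_factors e) = hall_part e (prime_factors e)"
    unfolding hall_part_def by (intro prod.cong) auto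
  then show "hall_part N (prime_factors e) = e" using hall_part_prime_factors[OF e0] by simp
qed

lemma AL_matrices_cases:
  assumes w: "w \<in> AL_matrices (g * x * y * l) (g * y)" and pos: "g > 0" "y > 0"
  obtains a b c d :: int where
    "w = mat2 (of_int (int (g * y) * a)) (of_int b) (of_int (c * int (g * x * y * l))) (of_int (int (g * y) * d))"
    "int (g * y) * a * d - b * c * int (x * l) = 1"
proof -
  obtain a b c d :: int where w: "w = mat2 (of_int a) (of_int b) (of_int (c * int (g * x * y * l))) (of_int d)"
    and det: "a * d - b * (c * int (g * x * y * l)) = int (g * y)" and dv: "int (g * y) dvd a" "int (g * y) dvd d"
    using w unfolding AL_matrices_def by auto
  obtain a' d' where ad: "a = int (g * y) * a'" "d = int (g * y) * d'" using dv by (auto elim!: dvdE)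
  have "int (g * y) * (int (g * y) * a' * d' - b * c * int (x * l)) = int (g * y) * 1"
    using det unfolding ad by (simp add: algebra_simps)
  moreover have "int (g * y) \<noteq> 0" using pos by simp
  ultimately have "int (g * y) * a' * d' - b * c * int (x * l) = 1" by (metis mult_cancel_left)
  then show ?thesis using that w ad by blast
qed

text \<open>The reason is the factorisation diag(g x, 1) w = g \<gamma> diag(x y, 1), where \<gamma>
  has rows (a g, x b) and (c l, y d) and determinant 1.\<close>

lemma eis_AL:
  assumes w: "w \<in> AL_matrices (g * x * y * l) (g * y)" and pos: "g > 0" "x > 0" "y > 0"
    and k: "even k" "k \<ge> 4" and \<tau>: "Im \<tau> > 0"
  shows "eis k (of_nat (g * x) * moebius w \<tau>) = (mden w \<tau> / of_nat g) ^ k * eis k (of_nat (x * y) * \<tau>)"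
proof -
  obtain a b c d :: int where we: "w = mat2 (of_int (int (g * y) * a)) (of_int b) (of_int (c * int (g * x * y * l))) (of_int (int (g * y) * d))"
    and det: "int (g * y) * a * d - b * c * int (x * l) = 1"
    by (rule AL_matrices_cases[OF w pos(1,3)])
  define \<tau>' where "\<tau>' = of_nat (x * y) * \<tau>"
  have im: "Im \<tau>' > 0" using pos \<tau> by (simp add: \<tau>'_def)
  have "(a * int g) * (int y * d) - (int x * b) * (c * int l) = 1" using det by (simp add: algebra_simps)
  note em = eis_modular[OF im k this]
  have j: "mden w \<tau> = of_nat g * (of_int (c * int l) * \<tau>' + of_int (int y * d))"
    by (simp add: mden_def we \<tau>'_def algebra_simps)
  have n: "of_nat (g * x) * (of_real (m11 w) * \<tau> + of_real (m12 w)) =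
      of_nat g * (of_int (a * int g) * \<tau>' + of_int (int x * b))"
    by (simp add: we \<tau>'_def algebra_simps)
  have "of_nat (g * x) * moebius w \<tau> = (of_nat (g * x) * (of_real (m11 w) * \<tau> + of_real (m12 w))) / mden w \<tau>"
    by (simp add: moebius_def mden_def)
  also have "\<dots> = (of_int (a * int g) * \<tau>' + of_int (int x * b)) / (of_int (c * int l) * \<tau>' + of_int (int y * d))"
    unfolding n j using pos by simp
  finally have "eis k (of_nat (g * x) * moebius w \<tau>) = (of_int (c * int l) * \<tau>' + of_int (int y * d)) ^ k * eis k \<tau>'"
    using em by simp
  also have "of_int (c * int l) * \<tau>' + of_int (int y * d) = mden w \<tau> / of_nat g" unfolding j using pos by simp
  finally show ?thesis by (simp add: \<tau>'_def)
qed

text \<open>All entries of the product share the factor g, which is removed as a scalar; A, B, C, D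
  are what is left, with the divisibility by x y made visible in A and D.\<close>

lemma AL_matrices_mult:
  assumes w: "w \<in> AL_matrices (g * x * y * l) (g * x)" "w' \<in> AL_matrices (g * x * y * l) (g * y)"
    and pos: "g > 0" "x > 0" "y > 0"
  obtains w'' where "w'' \<in> AL_matrices (g * x * y * l) (x * y)" "w ** w' = real g *\<^sub>R w''"
proof -
  have "w \<in> AL_matrices (g * y * x * l) (g * x)" using w(1) by (simp add: mult_ac)
  then obtain a b c d :: int where we: "w = mat2 (of_int (int (g * x) * a)) (of_int b) (of_int (c * int (g * y * x * l))) (of_int (int (g * x) * d))"
    and det: "int (g * x) * a * d - b * c * int (y * l) = 1"
    by (rule AL_matrices_cases) (use pos in auto)
  obtain a' b' c' d' :: int where we': "w' = mat2 (of_int (int (g * y) * a')) (of_int b') (of_int (c' * int (g * x * y * l))) (of_int (int (g * y) * d'))"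
    and det': "int (g * y) * a' * d' - b' * c' * int (x * l) = 1"
    by (rule AL_matrices_cases[OF w(2) pos(1,3)])
  define A B C D where "A = int (x * y) * (int g * a * a' + b * c' * int l)"
    and "B = int x * a * b' + b * int y * d'" and "C = c * int y * a' + int x * d * c'"
    and "D = int (x * y) * (c * b' * int l + int g * d * d')"
  define w'' where "w'' = mat2 (of_int A) (of_int B) (of_int (C * int (g * x * y * l))) (of_int D)"
  have "A * D - B * (C * int (g * x * y * l)) = int (x * y) *
     ((int (g * x) * a * d - b * c * int (y * l)) * (int (g * y) * a' * d' - b' * c' * int (x * l)))"
    by (simp add: A_def B_def C_def D_def algebra_simps)
  also have "\<dots> = int (x * y)" unfolding det det' by simp
  finally have "A * D - B * (C * int (g * x * y * l)) = int (x * y)" .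
  moreover have "int (x * y) dvd A" "int (x * y) dvd D" unfolding A_def D_def by (rule dvd_triv_left)+
  ultimately have "w'' \<in> AL_matrices (g * x * y * l) (x * y)"
    unfolding AL_matrices_def w''_def by blast
  moreover have "w ** w' = real g *\<^sub>R w''"
    by (rule mat2_eqI) (simp_all add: mult_nth2 we we' w''_def A_def B_def C_def D_def algebra_simps)
  ultimately show ?thesis using that by blast
qed

lemma AL_matrices_det: "w \<in> AL_matrices N e \<Longrightarrow> det w = of_nat e"
proof -
  assume "w \<in> AL_matrices N e"
  then obtain a b c d :: int where w: "w = mat2 (of_int a) (of_int b) (of_int (c * int N)) (of_int d)"
    and det: "a * d - b * (c * int N) = int e" unfolding AL_matrices_def by auto
  have "det w = of_int (a * d - b * (c * int N))" unfolding w by (simp add: det_entries)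
  then show ?thesis unfolding det by simp
qed

lemma AL_matrices_1: "AL_matrices N 1 = Gamma0 N"
  unfolding AL_matrices_def Gamma0_def by auto

lemma tendsto_eis: "(eis k \<longlongrightarrow> of_rat (eis_const k)) at_ii_inf"
proof -
  have "fps_conv_radius (eis_fps k) > 0"
    by (rule less_le_trans[OF _ conv_radius_eis_fps]) (simp add: one_ereal_def zero_ereal_def)
  then have "eval_fps (eis_fps k) analytic_on {0}"
    by (intro analytic_on_eval_fps) (auto simp: zero_ereal_def)
  from tendsto_analytic_nome[OF this, of 1] show ?thesis
    by (simp add: eis_def[abs_def] nome_def eval_fps_at_0 eis_fps_def)
qed

lemma eis_SL2Z:
  assumes "B \<in> SL2Z" "Im \<tau> > 0" "even k" "k \<ge> 4"
  shows "eis k (moebius B \<tau>) = mden B \<tau> ^ k * eis k \<tau>"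
proof -
  obtain a b c d :: int where B: "B = mat2 (of_int a) (of_int b) (of_int c) (of_int d)" "a * d - b * c = 1"
    using assms(1) unfolding SL2Z_iff by auto
  show ?thesis using eis_modular[OF assms(2-4) B(2)] by (simp add: B(1) moebius_def mden_def)
qed

text \<open>The matrix diag(d, 1) A takes infinity to a cusp, so it is B times an upper triangular
  matrix with B in the modular group. The factor from B is the automorphy factor of A up to a
  constant, and the Eisenstein series tends to its constant term.\<close>

lemma eis_level_cusp_bound:
  assumes A: "A \<in> SL2Z" and d: "d > 0" and k: "even k" "k \<ge> 4"
  shows "\<exists>C. \<forall>\<^sub>F \<tau> in at_ii_inf. norm (eis k (of_nat d * moebius A \<tau>)) \<le> C * norm (mden A \<tau>) ^ k"
proof -
  define M where "M = mat2 (of_nat d) 0 0 1 ** A"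
  have Mm: "moebius M \<tau> = of_nat d * moebius A \<tau>" "mden M \<tau> = mden A \<tau>" for \<tau>
    by (simp_all add: M_def moebius_def mden_def mult_nth2 mult.assoc distrib_left add_divide_distrib)
  have dM: "det M > 0"
  proof -
    have "det (mat2 (of_nat d) 0 0 1) = of_nat d" by (simp add: det_entries)
    then show ?thesis using SL2Z_det[OF A] d by (simp add: M_def det_mul)
  qed
  obtain a b c e :: int where Ae: "A = mat2 (of_int a) (of_int b) (of_int c) (of_int e)"
    using A unfolding SL2Z_iff by auto
  have "M = 1 *\<^sub>R mat2 (of_int (int d * a)) (of_int (int d * b)) (of_int c) (of_int e)"
    by (rule mat2_eqI) (simp_all add: M_def mult_nth2 Ae)
  then have "moebius_ext M None \<in> cusps" using moebius_ext_int_cusp[of 1 "int d * a" "int d * b" c e] by simp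
  then obtain B where B: "B \<in> SL2Z" "moebius_ext B None = moebius_ext M None" using cusp_SL2Z by blast
  have dB: "det B > 0" using SL2Z_det[OF B(1)] by simp
  show ?thesis
  proof (rule upper_affine[OF dM dB moebius_ext_None_eq[OF B(2)[symmetric]]])
    fix \<alpha> b \<delta>
    assume \<alpha>: "\<alpha> > 0" "\<alpha> * \<delta> ^ 2 = det M / det B"
      and mo: "\<And>\<tau>. Im \<tau> > 0 \<Longrightarrow> moebius M \<tau> = moebius B (of_real \<alpha> * \<tau> + of_real b)"
      and md: "\<And>\<tau>. mden M \<tau> = of_real \<delta> * mden B (of_real \<alpha> * \<tau> + of_real b)"
    have \<delta>: "\<delta> \<noteq> 0" using \<alpha> dM dB by auto
    have "((\<lambda>\<tau>. norm (eis k (of_real \<alpha> * \<tau> + of_real b))) \<longlongrightarrow> norm (of_rat (eis_const k) :: complex)) at_ii_inf"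
      by (intro tendsto_norm filterlim_compose[OF tendsto_eis filterlim_affine_at_ii_inf[OF \<alpha>(1)]])
    then have "\<forall>\<^sub>F \<tau> in at_ii_inf. norm (eis k (of_real \<alpha> * \<tau> + of_real b)) < norm (of_rat (eis_const k) :: complex) + 1"
      by (rule order_tendstoD) simp
    moreover have "\<forall>\<^sub>F \<tau> in at_ii_inf. Im \<tau> > 0" unfolding eventually_at_ii_inf by (intro exI[of _ 1]) auto
    ultimately have "\<forall>\<^sub>F \<tau> in at_ii_inf. norm (eis k (of_nat d * moebius A \<tau>)) \<le>
        ((norm (of_rat (eis_const k) :: complex) + 1) / \<bar>\<delta>\<bar> ^ k) * norm (mden A \<tau>) ^ k"
    proof eventually_elim
      case (elim \<tau>)
      define \<tau>' where "\<tau>' = of_real \<alpha> * \<tau> + of_real b"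
      have "eis k (of_nat d * moebius A \<tau>) = mden B \<tau>' ^ k * eis k \<tau>'"
        using eis_SL2Z[OF B(1) _ k, of \<tau>'] mo[OF elim(2)] elim(2) \<alpha>(1) by (simp add: \<tau>'_def Mm)
      moreover have "norm (mden B \<tau>') = norm (mden A \<tau>) / \<bar>\<delta>\<bar>"
        using md[of \<tau>] \<delta> by (simp add: Mm \<tau>'_def norm_mult)
      ultimately have "norm (eis k (of_nat d * moebius A \<tau>)) = norm (eis k \<tau>') * (norm (mden A \<tau>) ^ k / \<bar>\<delta>\<bar> ^ k)"
        by (simp add: norm_mult norm_power power_divide)
      also have "\<dots> \<le> (norm (of_rat (eis_const k) :: complex) + 1) * (norm (mden A \<tau>) ^ k / \<bar>\<delta>\<bar> ^ k)"
        using elim(1) by (intro mult_right_mono) (auto simp: \<tau>'_def)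
      finally show ?case by simp
    qed
    then show ?thesis by blast
  qed
qed

lemma eis_holomorphic: "d > 0 \<Longrightarrow> (\<lambda>\<tau>. eis k (of_nat d * \<tau>)) holomorphic_on upper_half_plane"
proof -
  assume d: "d > 0"
  have "exp (2 * pi * \<i> * (of_nat d * \<tau>)) \<in> eball 0 (fps_conv_radius (eis_fps k))" if "\<tau> \<in> upper_half_plane" for \<tau>
  proof -
    have "Im (of_nat d * \<tau>) > 0" using that d by (simp add: upper_half_plane_def)
    from norm_exp_lt_1[OF this] show ?thesis
      using conv_radius_eis_fps[of k] by (simp add: less_le_trans[OF _ conv_radius_eis_fps] one_ereal_def)
  qed
  then show ?thesis unfolding eis_def
    by (intro holomorphic_on_eval_fps[THEN holomorphic_on_compose_gen[unfolded o_def, rotated]] holomorphic_intros) auto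
qed


section \<open>Denominators of the constant terms\<close>

text \<open>The localisation of the integers at p, inside the rationals.\<close>

definition p_integral :: "nat \<Rightarrow> rat set" where
  "p_integral p = {x. \<exists>a b::int. \<not> int p dvd b \<and> x = of_int a / of_int b}"

context
  fixes p :: nat
  assumes prime_p: "Factorial_Ring.prime p"
begin

lemma prime_int: "Factorial_Ring.prime (int p)" using prime_p by simp

lemma p_integral_add:
  assumes "x \<in> p_integral p" "y \<in> p_integral p" shows "x + y \<in> p_integral p"
proof -
  obtain a b c d :: int where *: "\<not> int p dvd b" "x = of_int a / of_int b" "\<not> int p dvd d" "y = of_int c / of_int d"
    using assms unfolding p_integral_def by auto
  have "b \<noteq> 0" "d \<noteq> 0" using * by auto
  then have "x + y = of_int (a * d + c * b) / of_int (b * d)" using * by (simp add: add_frac_eq)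
  moreover have "\<not> int p dvd b * d" using * prime_int by (simp add: prime_dvd_mult_iff)
  ultimately show ?thesis unfolding p_integral_def by blast
qed

lemma p_integral_mult:
  assumes "x \<in> p_integral p" "y \<in> p_integral p" shows "x * y \<in> p_integral p"
proof -
  obtain a b c d :: int where *: "\<not> int p dvd b" "x = of_int a / of_int b" "\<not> int p dvd d" "y = of_int c / of_int d"
    using assms unfolding p_integral_def by auto
  have "x * y = of_int (a * c) / of_int (b * d)" using * by simp
  moreover have "\<not> int p dvd b * d" using * prime_int by (simp add: prime_dvd_mult_iff)
  ultimately show ?thesis unfolding p_integral_def by blast
qed

lemma p_integral_of_int: "of_int a \<in> p_integral p"
  unfolding p_integral_def by (intro CollectI exI[of _ a] exI[of _ 1]) (use prime_int in auto)

lemma p_integral_uminus: "x \<in> p_integral p \<Longrightarrow> - x \<in> p_integral p"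
  using p_integral_mult[OF p_integral_of_int[of "- 1"]] by simp

lemma p_integral_sum: "(\<And>i. i \<in> A \<Longrightarrow> f i \<in> p_integral p) \<Longrightarrow> sum f A \<in> p_integral p"
  using p_integral_of_int[of 0] by (induction A rule: infinite_finite_induct) (auto intro: p_integral_add)

lemma p_integral_inverse_fact: "n < p \<Longrightarrow> 1 / fact n \<in> p_integral p"
proof -
  assume "n < p"
  then have "\<not> p dvd fact n" using prime_p by (simp add: prime_dvd_fact_iff)
  then have "\<not> int p dvd fact n" by (metis int_dvd_int_iff of_nat_fact)
  moreover have "1 / fact n = (of_int 1 / of_int (fact n) :: rat)" by simp
  ultimately show ?thesis unfolding p_integral_def by blast
qed

text \<open>The recursion divides only by factorials of numbers up to n + 1 < p, which are prime to
  p.\<close>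

lemma bern_coeff_p_integral: "n < p - 1 \<Longrightarrow> bern_coeff n \<in> p_integral p"
proof (induction n rule: less_induct)
  case (less n)
  show ?case
  proof (cases "n = 0")
    case True
    then show ?thesis using p_integral_of_int[of 1] by (simp add: bern_coeff_0)
  next
    case False
    have "bern_coeff i * (1 / fact (n + 1 - i)) \<in> p_integral p" if "i \<in> {..<n}" for i
      using that less by (intro p_integral_mult p_integral_inverse_fact less.IH) auto
    then have "(\<Sum>i<n. bern_coeff i / fact (n + 1 - i)) \<in> p_integral p"
      by (intro p_integral_sum) simp
    then show ?thesis using bern_coeff_rec[of n] False p_integral_uminus by simp
  qed
qed

text \<open>The case \<open>k = p - 1\<close> of the von Staudt--Clausen theorem.\<close>

lemma eis_const_p:
  assumes "p \<ge> 5"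
  obtains u v :: int where "v \<noteq> 0" "int p dvd v" "\<not> int p dvd u" "eis_const (p - 1) = of_int u / of_int v"
proof -
  define s where "s = (\<Sum>i\<in>{1..<p - 1}. bern_coeff i / fact (p - i))"
  have "{..<p - 1} = insert 0 {1..<p - 1}" using assms by auto
  \<comment> \<open>In the recursion for p - 1 only the term with index 0 has p in its denominator,
    through p!; the rest, \<open>s\<close>, is p-integral.\<close>
  then have b: "bern_coeff (p - 1) = - (1 / fact p + s)"
    using bern_coeff_rec[of "p - 1"] assms by (simp add: s_def bern_coeff_0)
  have "bern_coeff i * (1 / fact (p - i)) \<in> p_integral p" if "i \<in> {1..<p - 1}" for i
    using that by (intro p_integral_mult p_integral_inverse_fact bern_coeff_p_integral) auto
  then have s: "s \<in> p_integral p" unfolding s_def by (intro p_integral_sum) simp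
  have half: "1 / 2 \<in> p_integral p" using p_integral_inverse_fact[of 2] assms by simp
  have "of_int (fact (p - 2)) * (s * (1 / 2)) \<in> p_integral p"
    by (intro p_integral_mult p_integral_of_int s half)
  then obtain a c :: int where ac: "\<not> int p dvd c" "fact (p - 2) * (s * (1 / 2)) = of_int a / of_int c"
    unfolding p_integral_def by auto
  have c0: "c \<noteq> 0" using ac by auto
  have f: "(fact p :: rat) = of_nat p * (of_nat (p - 1) * fact (p - 2))"
  proof -
    define m where "m = p - 2"
    have "p = Suc (Suc m)" using assms by (simp add: m_def)
    then show ?thesis by simp
  qed
  have "eis_const (p - 1) = fact (p - 2) / (2 * fact p) + fact (p - 2) * (s * (1 / 2))"
    unfolding eis_const_def b by (simp add: numeral_2_eq_2 algebra_simps add_divide_distrib)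
  also have "fact (p - 2) / (2 * fact p) = (1 :: rat) / of_int (2 * int p * (int p - 1))"
    unfolding f using assms by (simp add: of_nat_diff)
  also have "1 / of_int (2 * int p * (int p - 1)) + fact (p - 2) * (s * (1 / 2)) =
      of_int (c + 2 * int p * (int p - 1) * a) / (of_int (2 * int p * (int p - 1) * c) :: rat)"
    unfolding ac(2) using c0 assms by (subst add_frac_eq) (auto simp: mult_ac)
  finally have "eis_const (p - 1) = of_int (c + 2 * int p * (int p - 1) * a) / of_int (2 * int p * (int p - 1) * c)" .
  moreover have "2 * int p * (int p - 1) * c \<noteq> 0" using c0 assms by simp
  moreover have "int p dvd 2 * int p * (int p - 1) * c" by simp
  moreover have "\<not> int p dvd c + 2 * int p * (int p - 1) * a"
    using ac(1) by (metis dvd_add_left_iff dvd_mult2 dvd_triv_right)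
  ultimately show ?thesis using that by blast
qed

end

lemma eis_const_4: "eis_const 4 = 1 / 240" and eis_const_6: "eis_const 6 = - 1 / 504"
  by (simp_all add: eis_const_def bern_coeff_4 bern_coeff_6 fact_numeral)

section \<open>Power series congruent to a constant\<close>

text \<open>A congruence modulo p between series with rational integer coefficients, stated inside
  the complex power series where the expansions live. It can later be read in any ring that contains
  the integers.\<close>

definition cong_const :: "nat \<Rightarrow> int \<Rightarrow> complex fps \<Rightarrow> bool" where
  "cong_const p M F \<longleftrightarrow> (\<exists>b. F = of_int M + of_nat p * Abs_fps (\<lambda>n. of_int (b n)))"

definition int_fps :: "complex fps set" where "int_fps = range (\<lambda>b. Abs_fps (\<lambda>n. of_int (b n)))"

lemma int_fpsI: "(\<And>n. fps_nth F n \<in> \<int>) \<Longrightarrow> F \<in> int_fps"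
proof -
  assume "\<And>n. fps_nth F n \<in> \<int>"
  then obtain b where "\<And>n. fps_nth F n = of_int (b n)" unfolding Ints_def by (auto simp: image_iff) metis
  then have "F = Abs_fps (\<lambda>n. of_int (b n))" by (intro fps_ext) simp
  then show ?thesis by (auto simp: int_fps_def)
qed

lemma int_fpsD: "F \<in> int_fps \<Longrightarrow> fps_nth F n \<in> \<int>" by (auto simp: int_fps_def)

lemma int_fps_closed: "F \<in> int_fps \<Longrightarrow> G \<in> int_fps \<Longrightarrow> F + G \<in> int_fps"
  "F \<in> int_fps \<Longrightarrow> G \<in> int_fps \<Longrightarrow> F * G \<in> int_fps" "of_int a \<in> int_fps"
  by (auto intro!: int_fpsI Ints_sum Ints_mult Ints_add simp: int_fpsD fps_mult_nth simp flip: fps_of_int)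

lemma cong_const_iff: "cong_const p M F \<longleftrightarrow> (\<exists>G\<in>int_fps. F = of_int M + of_nat p * G)"
  by (auto simp: cong_const_def int_fps_def)

lemma cong_const_add: "cong_const p M F \<Longrightarrow> cong_const p M' F' \<Longrightarrow> cong_const p (M + M') (F + F')"
proof -
  assume "cong_const p M F" "cong_const p M' F'"
  then obtain G G' where "G \<in> int_fps" "G' \<in> int_fps" "F = of_int M + of_nat p * G" "F' = of_int M' + of_nat p * G'"
    unfolding cong_const_iff by blast
  then show ?thesis unfolding cong_const_iff by (intro bexI[of _ "G + G'"]) (auto simp: algebra_simps int_fps_closed)
qed

lemma cong_const_mult: "cong_const p M F \<Longrightarrow> cong_const p M' F' \<Longrightarrow> cong_const p (M * M') (F * F')"
proof -
  assume "cong_const p M F" "cong_const p M' F'"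
  then obtain G G' where G: "G \<in> int_fps" "G' \<in> int_fps" and "F = of_int M + of_nat p * G" "F' = of_int M' + of_nat p * G'"
    unfolding cong_const_iff by blast
  then have "F * F' = of_int (M * M') + of_nat p * (of_int M * G' + G * of_int M' + of_int (int p) * (G * G'))"
    by (simp add: algebra_simps)
  moreover have "of_int M * G' + G * of_int M' + of_int (int p) * (G * G') \<in> int_fps"
    by (intro int_fps_closed G)
  ultimately show ?thesis unfolding cong_const_iff by blast
qed

lemma cong_const_of_int: "cong_const p M (of_int M)"
  unfolding cong_const_iff using int_fps_closed(3)[of 0] by (intro bexI[of _ 0]) auto

lemma cong_const_sum: "(\<And>i. i \<in> A \<Longrightarrow> cong_const p (M i) (F i)) \<Longrightarrow> cong_const p (\<Sum>i\<in>A. M i) (\<Sum>i\<in>A. F i)"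
  using cong_const_of_int[of p 0] by (induction A rule: infinite_finite_induct) (auto intro: cong_const_add)

lemma cong_const_prod: "(\<And>i. i \<in> A \<Longrightarrow> cong_const p (M i) (F i)) \<Longrightarrow> cong_const p (\<Prod>i\<in>A. M i) (\<Prod>i\<in>A. F i)"
  using cong_const_of_int[of p 1] by (induction A rule: infinite_finite_induct) (auto intro: cong_const_mult)

text \<open>The denominator v of the constant term is divisible by p. Multiplying by v makes the
  constant term u and all other coefficients, which are integers to begin with, multiples of
  p.\<close>

lemma cong_const_eis:
  assumes "eis_const k = of_int u / of_int v" "v \<noteq> 0" "int p dvd v" "d > 0"
  shows "cong_const p u (fps_const (of_int v) * (eis_fps k oo fps_X ^ d))"
proof -
  obtain v' where v': "v = int p * v'" using assms(3) by auto
  define G :: "complex fps" where "G = Abs_fps (\<lambda>n. if n = 0 then 0 else if d dvd n then of_int (v' * int (\<Sum>r | r dvd n div d. r ^ (k - 1))) else 0)"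
  have "fps_const (of_int v) * (eis_fps k oo fps_X ^ d) = of_int u + of_nat p * G"
  proof (rule fps_ext)
    fix n
    have c: "of_int v * of_rat (eis_const k) = (of_int u :: complex)"
      unfolding assms(1) using assms(2) by (simp add: of_rat_divide)
    have nz: "n div d \<noteq> 0" if "n \<noteq> 0" "d dvd n" using that assms(4) by (auto elim!: dvdE)
    show "fps_nth (fps_const (of_int v) * (eis_fps k oo fps_X ^ d)) n = fps_nth (of_int u + of_nat p * G) n"
      using c nz by (auto simp: fps_nth_compose_X_power eis_fps_def G_def v' simp flip: fps_of_int fps_of_nat)
  qed
  moreover have "G \<in> int_fps" by (rule int_fpsI) (auto simp: G_def simp del: of_nat_sum of_int_mult)
  ultimately show ?thesis unfolding cong_const_iff by blast
qed

lemma eis_has_expansion: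
  assumes "d > 0"
  shows "(\<lambda>w. eval_fps (eis_fps k) (w ^ d)) has_fps_expansion (eis_fps k oo fps_X ^ d)"
proof -
  have "fps_conv_radius (eis_fps k) > 0"
    by (rule less_le_trans[OF _ conv_radius_eis_fps]) (simp add: one_ereal_def zero_ereal_def)
  then have "eval_fps (eis_fps k) has_fps_expansion eis_fps k" by (rule eval_fps_has_fps_expansion)
  moreover have "(\<lambda>w::complex. w ^ d) has_fps_expansion fps_X ^ d" by (intro fps_expansion_intros)
  ultimately have "(eval_fps (eis_fps k) \<circ> (\<lambda>w. w ^ d)) has_fps_expansion (eis_fps k oo fps_X ^ d)"
    using assms by (intro has_fps_expansion_compose) (auto simp: fps_X_power_nth)
  then show ?thesis by (simp add: o_def)
qed

lemma eis_nome: "eis k (of_nat d * \<tau>) = eval_fps (eis_fps k) (nome 1 \<tau> ^ d)"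
  by (simp add: eis_def nome_def exp_of_nat_mult[symmetric] mult_ac)

lemma fps_unique_at_ii_inf:
  assumes f: "f has_fps_expansion F" and g: "g has_fps_expansion G"
    and ev: "\<forall>\<^sub>F \<tau> in at_ii_inf. f (nome 1 \<tau>) = g (nome 1 \<tau>)"
  shows "F = (G :: complex fps)"
proof -
  have R: "fps_conv_radius F > 0" "fps_conv_radius G > 0" using f g by (auto simp: has_fps_expansion_def)
  have "\<forall>\<^sub>F w in nhds 0. eval_fps F w = f w" "\<forall>\<^sub>F w in nhds 0. eval_fps G w = g w"
    using f g by (simp_all add: has_fps_expansion_def)
  then have e: "\<forall>\<^sub>F w in at 0. eval_fps F w = f w" "\<forall>\<^sub>F w in at 0. eval_fps G w = g w"
    unfolding eventually_at_filter by (auto elim: eventually_mono)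
  have "\<forall>\<^sub>F \<tau> in at_ii_inf. eval_fps F (nome 1 \<tau>) = f (nome 1 \<tau>)" "\<forall>\<^sub>F \<tau> in at_ii_inf. eval_fps G (nome 1 \<tau>) = g (nome 1 \<tau>)"
    using e eventually_nome[of 1 "\<lambda>w. eval_fps F w = f w"] eventually_nome[of 1 "\<lambda>w. eval_fps G w = g w"] by simp_all
  with ev have "\<forall>\<^sub>F \<tau> in at_ii_inf. eval_fps F (nome 1 \<tau>) = eval_fps G (nome 1 \<tau>)" by eventually_elim simp
  then show ?thesis by (rule fps_eqI_at_ii_inf[OF R])
qed

section \<open>Families of sets closed under symmetric difference\<close>

text \<open>Such a family is a vector space over the field with two elements. In the induction, the
  members avoiding x form a subspace of index 1 or 2, and adding a fixed member containing x
  exchanges the two cosets.\<close>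

lemma card_sym_diff_closed:
  assumes "finite U" "F \<subseteq> Pow U" "{} \<in> F" "\<And>A B. A \<in> F \<Longrightarrow> B \<in> F \<Longrightarrow> sym_diff A B \<in> F"
  shows "\<exists>j. card F = 2 ^ j"
  using assms
proof (induction U arbitrary: F rule: finite_induct)
  case empty
  then have "F = {{}}" by auto
  then show ?case by (intro exI[of _ 0]) simp
next
  case (insert x U)
  define F0 where "F0 = {A \<in> F. x \<notin> A}"
  have F0: "F0 \<subseteq> Pow U" "{} \<in> F0" "\<And>A B. A \<in> F0 \<Longrightarrow> B \<in> F0 \<Longrightarrow> sym_diff A B \<in> F0"
    using insert.prems by (auto simp: F0_def)
  obtain j where j: "card F0 = 2 ^ j" using insert.IH[OF F0] by blast
  show ?case
  proof (cases "F0 = F")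
    case True
    then show ?thesis using j by blast
  next
    case False
    then obtain B where B: "B \<in> F" "x \<in> B" by (auto simp: F0_def)
    have inj: "inj_on (\<lambda>A. sym_diff A B) F0" by (rule inj_onI) blast
    have inv: "sym_diff (sym_diff A B) B = A" for A by blast
    have F: "F = F0 \<union> (\<lambda>A. sym_diff A B) ` F0"
    proof (intro equalityI subsetI)
      fix A assume A: "A \<in> F"
      show "A \<in> F0 \<union> (\<lambda>A. sym_diff A B) ` F0"
      proof (cases "x \<in> A")
        case True
        then have "sym_diff A B \<in> F0" using A B insert.prems(3) by (auto simp: F0_def)
        then have "sym_diff (sym_diff A B) B \<in> (\<lambda>A. sym_diff A B) ` F0" by (rule imageI)
        then show ?thesis unfolding inv by blast
      qed (use A in \<open>auto simp: F0_def\<close>)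
    qed (use B insert.prems(3) in \<open>auto simp: F0_def\<close>)
    have "finite F0" using F0(1) insert.hyps(1) by (meson finite_Pow_iff finite_subset)
    moreover have "F0 \<inter> (\<lambda>A. sym_diff A B) ` F0 = {}" using B by (auto simp: F0_def)
    ultimately have "card F = card F0 + card F0"
      by (subst F) (simp add: card_Un_disjoint card_image[OF inj])
    then show ?thesis using j by (intro exI[of _ "Suc j"]) simp
  qed
qed


section \<open>Atkin--Lehner extensions\<close>

lemma Gamma0_subset_carrier: "Gamma0 N \<subseteq> carrier GL2_plus"
proof
  fix w assume "w \<in> Gamma0 N"
  then have "det w = of_nat 1" by (intro AL_matrices_det[of w N 1]) (simp only: AL_matrices_1)
  then show "w \<in> carrier GL2_plus" by (simp add: GL2_plus_def)
qed

lemma AL_subset_carrier: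
  assumes "N > 0" "hall_divisor e N"
  shows "AL_matrices N e \<subseteq> carrier GL2_plus"
proof -
  have "e > 0" using assms by (auto simp: hall_divisor_def intro: dvd_pos_nat)
  then show ?thesis using AL_matrices_det[of _ N e] by (auto simp: GL2_plus_def)
qed

definition int_scaled :: "(real^2^2) set" where
  "int_scaled = {M. det M > 0 \<and> (\<exists>r. r \<noteq> 0 \<and> (\<exists>(a::int) (b::int) (c::int) (d::int).
     M = r *\<^sub>R mat2 (of_int a) (of_int b) (of_int c) (of_int d)))}"

lemma int_scaledI':
  "M = r *\<^sub>R mat2 (of_int a) (of_int b) (of_int c) (of_int d) \<Longrightarrow> r \<noteq> 0 \<Longrightarrow> det M > 0 \<Longrightarrow> M \<in> int_scaled"
  unfolding int_scaled_def by (intro CollectI conjI exI[of _ r] exI[of _ a] exI[of _ b] exI[of _ c] exI[of _ d])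

lemma int_scaledI:
  "M = mat2 (of_int a) (of_int b) (of_int c) (of_int d) \<Longrightarrow> det M > 0 \<Longrightarrow> M \<in> int_scaled"
  by (rule int_scaledI'[of _ 1]) simp_all

lemma GL2_plus_inv:
  assumes "M \<in> carrier GL2_plus"
  shows "inv\<^bsub>GL2_plus\<^esub> M = (1 / det M) *\<^sub>R mat2 (m22 M) (- m12 M) (- m21 M) (m11 M)"
proof -
  interpret G: group GL2_plus by (rule group_GL2_plus)
  define B where "B = (1 / det M) *\<^sub>R mat2 (m22 M) (- m12 M) (- m21 M) (m11 M)"
  have d: "det M > 0" using assms by (simp add: GL2_plus_def)
  have "B ** M = mat 1"
  proof -
    have e: "m11 (B ** M) = det M / det M" "m22 (B ** M) = det M / det M" "m12 (B ** M) = 0" "m21 (B ** M) = 0"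
      by (simp_all add: B_def mult_nth2 det_entries[of M] mult.commute flip: diff_divide_distrib)
    show ?thesis by (rule mat2_eqI) (use e d in \<open>simp_all add: mat_def\<close>)
  qed
  moreover have "det B > 0"
  proof -
    have "det B * det M = 1" using \<open>B ** M = mat 1\<close> by (metis det_I det_mul)
    then show ?thesis using d by (metis zero_less_mult_pos2 zero_less_one)
  qed
  ultimately show ?thesis
    unfolding B_def[symmetric] using assms by (intro G.inv_equality) (auto simp: GL2_plus_def)
qed

lemma subgroup_int_scaled: "subgroup int_scaled GL2_plus"
proof (rule subgroup.intro)
  show "int_scaled \<subseteq> carrier GL2_plus" by (auto simp: int_scaled_def GL2_plus_def)
  have "mat 1 = mat2 (of_int 1) (of_int 0) (of_int 0) (of_int 1)"
    by (rule mat2_eqI) (simp_all add: mat_def)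
  then have "mat 1 \<in> int_scaled" by (rule int_scaledI) simp
  then show "\<one>\<^bsub>GL2_plus\<^esub> \<in> int_scaled" by (simp add: GL2_plus_def)
next
  fix A B assume A: "A \<in> int_scaled" and B: "B \<in> int_scaled"
  obtain r and a b c d :: int where r: "r \<noteq> 0" and Ae: "A = r *\<^sub>R mat2 (of_int a) (of_int b) (of_int c) (of_int d)"
    using A unfolding int_scaled_def by blast
  obtain r' and a' b' c' d' :: int where r': "r' \<noteq> 0" and Be: "B = r' *\<^sub>R mat2 (of_int a') (of_int b') (of_int c') (of_int d')"
    using B unfolding int_scaled_def by blast
  have "A ** B = (r * r') *\<^sub>R mat2 (of_int (a * a' + b * c')) (of_int (a * b' + b * d')) (of_int (c * a' + d * c')) (of_int (c * b' + d * d'))"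
    by (rule mat2_eqI) (simp_all add: Ae Be mult_nth2 algebra_simps)
  moreover have "r * r' \<noteq> 0" using r r' by simp
  moreover have "det (A ** B) > 0" using A B by (simp add: det_mul int_scaled_def)
  ultimately have "A ** B \<in> int_scaled" by (rule int_scaledI')
  then show "A \<otimes>\<^bsub>GL2_plus\<^esub> B \<in> int_scaled" by (simp add: GL2_plus_def)
next
  interpret G: group GL2_plus by (rule group_GL2_plus)
  fix A assume A: "A \<in> int_scaled"
  then have Ac: "A \<in> carrier GL2_plus" by (auto simp: int_scaled_def GL2_plus_def)
  obtain r and a b c d :: int where r: "r \<noteq> 0" and Ae: "A = r *\<^sub>R mat2 (of_int a) (of_int b) (of_int c) (of_int d)"
    using A unfolding int_scaled_def by blast
  have d0: "det A > 0" using A by (simp add: int_scaled_def)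
  have "inv\<^bsub>GL2_plus\<^esub> A = (r / det A) *\<^sub>R mat2 (of_int d) (of_int (- b)) (of_int (- c)) (of_int a)"
    unfolding GL2_plus_inv[OF Ac] by (rule mat2_eqI) (simp_all add: Ae)
  moreover have "r / det A \<noteq> 0" using r d0 by simp
  moreover have "det (inv\<^bsub>GL2_plus\<^esub> A) > 0" using G.inv_closed[OF Ac] by (simp add: GL2_plus_def)
  ultimately show "inv\<^bsub>GL2_plus\<^esub> A \<in> int_scaled" by (rule int_scaledI')
qed

lemma int_scaled_cusp:
  assumes M: "M \<in> int_scaled" and x: "x \<in> cusps"
  shows "moebius_ext M x \<in> cusps"
proof -
  obtain A where A: "A \<in> SL2Z" "moebius_ext A None = x" using cusp_SL2Z[OF x] by blast
  obtain a b c d :: int where "A = mat2 (of_int a) (of_int b) (of_int c) (of_int d)"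
    using A(1) unfolding SL2Z_iff by auto
  then have "A \<in> int_scaled" by (rule int_scaledI) (simp add: SL2Z_det[OF A(1)])
  then have "M ** A \<in> int_scaled"
    using subgroup.m_closed[OF subgroup_int_scaled M] by (simp add: GL2_plus_def)
  then obtain r and a b c d :: int where "r \<noteq> 0" "M ** A = r *\<^sub>R mat2 (of_int a) (of_int b) (of_int c) (of_int d)"
    unfolding int_scaled_def by blast
  then have "moebius_ext (M ** A) None \<in> cusps" using moebius_ext_int_cusp by simp
  moreover have "det M > 0" using M by (simp add: int_scaled_def)
  ultimately show ?thesis using moebius_ext_mult_None[of M A] SL2Z_det[OF A(1)] A(2) by simp
qed

lemma AL_subset_int_scaled:
  assumes "N > 0" "hall_divisor e N"
  shows "AL_matrices N e \<subseteq> int_scaled"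
proof
  fix w assume w: "w \<in> AL_matrices N e"
  then have "det w > 0" using AL_subset_carrier[OF assms] by (auto simp: GL2_plus_def)
  moreover obtain a b c d :: int where "w = mat2 (of_int a) (of_int b) (of_int (c * int N)) (of_int d)"
    using w unfolding AL_matrices_def by auto
  ultimately show "w \<in> int_scaled" by (intro int_scaledI)
qed

lemma hall_divisor_1: "hall_divisor 1 N" by (simp add: hall_divisor_def)

lemma AL_extension_props:
  assumes N: "N > 0" and S: "\<forall>e\<in>S. hall_divisor e N" and \<Gamma>: "\<Gamma> = AL_extension N S"
  shows "subgroup \<Gamma> GL2_plus" "\<Gamma> \<subseteq> int_scaled"
    "A \<in> SL2Z \<Longrightarrow> \<exists>h>0. \<exists>r. r \<noteq> 0 \<and> A ** (r *\<^sub>R mat2 1 h 0 1) ** matrix_inv A \<in> \<Gamma>"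
    "Gamma0 N \<subseteq> \<Gamma>" "e \<in> S \<Longrightarrow> AL_matrices N e \<subseteq> \<Gamma>"
proof -
  interpret G: group GL2_plus by (rule group_GL2_plus)
  have sub: "Gamma0 N \<union> (\<Union>e\<in>S. AL_matrices N e) \<subseteq> carrier GL2_plus"
    using Gamma0_subset_carrier AL_subset_carrier[OF N] S by blast
  then show "subgroup \<Gamma> GL2_plus" unfolding \<Gamma> AL_extension_def by (rule G.generate_is_subgroup)
  have "Gamma0 N \<union> (\<Union>e\<in>S. AL_matrices N e) \<subseteq> int_scaled"
    using AL_subset_int_scaled[OF N] AL_subset_int_scaled[OF N hall_divisor_1, unfolded AL_matrices_1] S by blast
  then show "\<Gamma> \<subseteq> int_scaled"
    unfolding \<Gamma> AL_extension_def by (rule G.generate_subgroup_incl[OF _ subgroup_int_scaled])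
  show G0: "Gamma0 N \<subseteq> \<Gamma>" and "e \<in> S \<Longrightarrow> AL_matrices N e \<subseteq> \<Gamma>"
    unfolding \<Gamma> AL_extension_def by (auto intro: generate.incl)
  show "\<exists>h>0. \<exists>r. r \<noteq> 0 \<and> A ** (r *\<^sub>R mat2 1 h 0 1) ** matrix_inv A \<in> \<Gamma>" if A: "A \<in> SL2Z"
  proof -
    obtain a b c d :: int where Ae: "A = mat2 (of_int a) (of_int b) (of_int c) (of_int d)" and det: "a * d - b * c = 1"
      using A unfolding SL2Z_iff by auto
    \<comment> \<open>\<open>K\<close> is the conjugate by A of the translation by N; its lower left
      entry is divisible by N.\<close>
    define K where "K = mat2 (of_int (1 - a * c * int N)) (of_int (a * a * int N)) (of_int (- (c * c) * int N)) (of_int (1 + a * c * int N))"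
    have "(1 - a * c * int N) * (1 + a * c * int N) - (a * a * int N) * (- (c * c) * int N) = 1"
      by (simp add: algebra_simps)
    then have "K \<in> Gamma0 N" unfolding Gamma0_def K_def by blast
    moreover have "K ** A = A ** (1 *\<^sub>R mat2 1 (real N) 0 1)"
    proof (rule mat2_eqI)
      have e: "real_of_int a * of_int d = 1 + of_int b * of_int c" using det by (metis of_int_1 of_int_add of_int_mult diff_eq_eq)
      have e1: "x * (real_of_int a * of_int d) = x + x * (of_int b * of_int c)" for x unfolding e by (simp add: distrib_left)
      show "m11 (K ** A) = m11 (A ** (1 *\<^sub>R mat2 1 (real N) 0 1))" "m21 (K ** A) = m21 (A ** (1 *\<^sub>R mat2 1 (real N) 0 1))"
        by (simp_all add: K_def Ae mult_nth2 algebra_simps)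
      show "m12 (K ** A) = m12 (A ** (1 *\<^sub>R mat2 1 (real N) 0 1))"
        using e1[of "of_int a * real N"] by (simp add: K_def Ae mult_nth2 algebra_simps)
      show "m22 (K ** A) = m22 (A ** (1 *\<^sub>R mat2 1 (real N) 0 1))"
        using e1[of "of_int c * real N"] by (simp add: K_def Ae mult_nth2 algebra_simps)
    qed
    ultimately have "\<exists>K\<in>\<Gamma>. K ** A = A ** (1 *\<^sub>R mat2 1 (real N) 0 1)" using G0 by blast
    then show ?thesis using N unfolding slash_width_char[OF SL2Z_det[OF A], symmetric]
      by (intro exI[of _ "real N"] conjI exI[of _ "1::real"]) auto
  qed
qed

locale atkin_lehner_setup = hauptmodul_setup +
  fixes N :: nat and S :: "nat set" and chi :: "real^2^2 \<Rightarrow> complex"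
  assumes N: "N > 0" and S: "\<forall>e\<in>S. hall_divisor e N" and \<Gamma>_eq: "\<Gamma> = AL_extension N S"
    and chi_quadratic: "quadratic_character \<Gamma> chi"
    and chi_trivial: "\<forall>A\<in>Gamma0 N. chi A = 1"
    and Z2_form: "modular_form \<Gamma> 2 chi (\<lambda>\<tau>. Z \<tau> ^ 2)"
begin

lemmas \<Gamma>_props = AL_extension_props[OF N S \<Gamma>_eq]

lemma \<Gamma>_mult: "A \<in> \<Gamma> \<Longrightarrow> B \<in> \<Gamma> \<Longrightarrow> A ** B \<in> \<Gamma>"
  using subgroup.m_closed[OF \<Gamma>_props(1)] by (simp add: GL2_plus_def)

lemma chi_mult: "A \<in> \<Gamma> \<Longrightarrow> B \<in> \<Gamma> \<Longrightarrow> chi (A ** B) = chi A * chi B"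
  and chi_cases: "A \<in> \<Gamma> \<Longrightarrow> chi A = 1 \<or> chi A = -1"
  using chi_quadratic by (auto simp: quadratic_character_def)

lemma Z2_transform:
  assumes A: "A \<in> \<Gamma>" and \<tau>: "Im \<tau> > 0"
  shows "Z (moebius A \<tau>) ^ 2 = chi A * (mden A \<tau> ^ 2 / of_real (det A)) * Z \<tau> ^ 2"
proof -
  have d: "det A > 0" by (rule \<Gamma>_det[OF A])
  have "slash 2 (\<lambda>\<tau>. Z \<tau> ^ 2) A \<tau> = chi A * Z \<tau> ^ 2"
    using Z2_form A \<tau> by (auto simp: modular_form_def upper_half_plane_def)
  then have "of_real (det A) * inverse (mden A \<tau> ^ 2) * Z (moebius A \<tau>) ^ 2 = chi A * Z \<tau> ^ 2"
    using d by (simp add: slash_def mden_def power_int_minus)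
  moreover have "mden A \<tau> \<noteq> 0" by (rule mden_nonzero[OF d \<tau>])
  ultimately show ?thesis using d by (simp add: field_simps)
qed

lemma Z_nonzero_point: obtains \<tau> where "Im \<tau> > 0" "Z \<tau> \<noteq> 0"
proof -
  have "\<forall>\<^sub>F w in at \<i>. Z w \<noteq> 0" by (rule Z_avoid) simp
  moreover have "\<forall>\<^sub>F w in at \<i>. w \<in> {w. Im w > 0}"
    by (rule eventually_at_in_open') (auto intro: open_halfspace_Im_gt)
  ultimately have "\<forall>\<^sub>F w in at \<i>. Im w > 0 \<and> Z w \<noteq> 0" by eventually_elim auto
  then show ?thesis using that eventually_happens[of _ "at \<i>"] by auto
qed

text \<open>The character can be read off from the weight 2 slash action on Z^2 at a point where Z
  does not vanish, and this action ignores scalars since (c \<tau> + d)^2 / det does.\<close>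

lemma chi_scale:
  assumes A: "A \<in> \<Gamma>" and cA: "c *\<^sub>R A \<in> \<Gamma>" and c: "c \<noteq> 0"
  shows "chi (c *\<^sub>R A) = chi A"
proof -
  obtain \<tau> where \<tau>: "Im \<tau> > 0" "Z \<tau> \<noteq> 0" by (rule Z_nonzero_point)
  have d: "det (c *\<^sub>R A) = c ^ 2 * det A" by (simp add: det_entries power2_eq_square algebra_simps)
  have "(of_real c * mden A \<tau>) ^ 2 / of_real (c ^ 2 * det A) = mden A \<tau> ^ 2 / of_real (det A)"
    using c by (simp add: power_mult_distrib)
  then have "chi (c *\<^sub>R A) * (mden A \<tau> ^ 2 / of_real (det A)) * Z \<tau> ^ 2 = chi A * (mden A \<tau> ^ 2 / of_real (det A)) * Z \<tau> ^ 2"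
    using Z2_transform[OF cA \<tau>(1)] unfolding Z2_transform[OF A \<tau>(1)] moebius_scale[OF c] mden_scale d by auto
  moreover have "mden A \<tau> ^ 2 / of_real (det A) \<noteq> 0"
    using mden_nonzero[OF \<Gamma>_det[OF A] \<tau>(1)] \<Gamma>_det[OF A] by simp
  ultimately show ?thesis using \<tau>(2) by (simp only: mult_cancel_right power_eq_0_iff) auto
qed

section \<open>The group of Hall divisors of the extension and the sign character on it\<close>

abbreviation hp :: "nat set \<Rightarrow> nat" where "hp \<equiv> hall_part N"

definition QQ :: "nat set set" where
  "QQ = {Q. Q \<subseteq> prime_factors N \<and> hall_divisor_of_group N \<Gamma> (hp Q)}"

text \<open>An involution belongs to the group only up to a scalar, so the scalar r is carried
  along; \<open>chi\<close> is evaluated at the multiple that lies in the group.\<close>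

definition AL_pair :: "nat set \<Rightarrow> real^2^2 \<Rightarrow> real \<Rightarrow> bool" where
  "AL_pair Q w r \<longleftrightarrow> w \<in> AL_matrices N (hp Q) \<and> r \<noteq> 0 \<and> r *\<^sub>R w \<in> \<Gamma>"

lemma AL_pair_chi: "AL_pair Q w r \<Longrightarrow> chi (r *\<^sub>R w) = 1 \<or> chi (r *\<^sub>R w) = -1"
  by (rule chi_cases) (simp add: AL_pair_def)

lemma QQ_iff: "Q \<in> QQ \<longleftrightarrow> Q \<subseteq> prime_factors N \<and> (\<exists>w r. AL_pair Q w r)"
  using hall_part_hall[OF N] by (auto simp: QQ_def hall_divisor_of_group_def AL_pair_def)

lemma finite_QQ: "finite QQ"
  by (rule finite_subset[of _ "Pow (prime_factors N)"]) (auto simp: QQ_def)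

lemma AL_pair_mult:
  assumes Q: "Q \<subseteq> prime_factors N" "Q' \<subseteq> prime_factors N" and w: "AL_pair Q w r" and w': "AL_pair Q' w' r'"
  obtains w'' r'' where "AL_pair (sym_diff Q Q') w'' r''" "chi (r'' *\<^sub>R w'') = chi (r *\<^sub>R w) * chi (r' *\<^sub>R w')"
proof -
  obtain g x y l where s: "hp Q = g * x" "hp Q' = g * y" "hp (sym_diff Q Q') = x * y" "N = g * x * y * l"
    "g > 0" "x > 0" "y > 0"
    by (rule hall_part_split[OF N Q])
  obtain w'' where w'': "w'' \<in> AL_matrices (g * x * y * l) (x * y)" "w ** w' = real g *\<^sub>R w''"
  proof (rule AL_matrices_mult[of w g x y l w'])
    show "w \<in> AL_matrices (g * x * y * l) (g * x)" "w' \<in> AL_matrices (g * x * y * l) (g * y)"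
      using w w' unfolding AL_pair_def s(1,2) s(4)[symmetric] by auto
  qed (use s in auto)
  have eq: "(r *\<^sub>R w) ** (r' *\<^sub>R w') = (r * r' * real g) *\<^sub>R w''"
  proof -
    have "(r *\<^sub>R w) ** (r' *\<^sub>R w') = (r * r') *\<^sub>R (w ** w')"
      by (rule mat2_eqI) (simp_all add: mult_nth2 algebra_simps)
    then show ?thesis by (simp add: w''(2))
  qed
  have "(r * r' * real g) *\<^sub>R w'' \<in> \<Gamma>"
    unfolding eq[symmetric] using w w' by (intro \<Gamma>_mult) (auto simp: AL_pair_def)
  then have "AL_pair (sym_diff Q Q') w'' (r * r' * real g)"
    using w w' w''(1) s(5) unfolding AL_pair_def s(3) s(4)[symmetric] by simp
  moreover have "chi ((r * r' * real g) *\<^sub>R w'') = chi (r *\<^sub>R w) * chi (r' *\<^sub>R w')"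
    unfolding eq[symmetric] using w w' by (intro chi_mult) (auto simp: AL_pair_def)
  ultimately show ?thesis using that by blast
qed

lemma QQ_closed: "Q \<in> QQ \<Longrightarrow> Q' \<in> QQ \<Longrightarrow> sym_diff Q Q' \<in> QQ"
  unfolding QQ_iff using AL_pair_mult by (metis Diff_subset Un_least subset_trans)

text \<open>The symmetric difference of Q with itself is empty, so the product of two choices is a
  scalar multiple of an element of \<open>Gamma0 N\<close>. The character is 1 there, and two signs
  with product 1 are equal.\<close>

lemma AL_pair_chi_unique:
  assumes Q: "Q \<subseteq> prime_factors N" and w: "AL_pair Q w r" and w': "AL_pair Q w' r'"
  shows "chi (r *\<^sub>R w) = chi (r' *\<^sub>R w')"
proof -
  obtain w'' r'' where w'': "AL_pair (sym_diff Q Q) w'' r''" "chi (r'' *\<^sub>R w'') = chi (r *\<^sub>R w) * chi (r' *\<^sub>R w')"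
    by (rule AL_pair_mult[OF Q Q w w'])
  then have g0: "w'' \<in> Gamma0 N" "r'' \<noteq> 0" "r'' *\<^sub>R w'' \<in> \<Gamma>" by (auto simp: AL_pair_def hall_part_def AL_matrices_1[simplified])
  have "chi (r'' *\<^sub>R w'') = chi w''" using g0 \<Gamma>_props(4) by (intro chi_scale) auto
  then have "chi (r *\<^sub>R w) * chi (r' *\<^sub>R w') = 1" using w''(2) chi_trivial g0(1) by simp
  moreover have "chi (r *\<^sub>R w) = 1 \<or> chi (r *\<^sub>R w) = -1" "chi (r' *\<^sub>R w') = 1 \<or> chi (r' *\<^sub>R w') = -1"
    using AL_pair_chi w w' by blast+
  ultimately show ?thesis by auto
qed

text \<open>The value of the character at the involution of Q, as an integer so that it can enter
  congruences. It is -1 by default when no such involution is in the group.\<close>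

definition eps :: "nat set \<Rightarrow> int" where
  "eps Q = (if \<exists>w r. AL_pair Q w r \<and> chi (r *\<^sub>R w) = 1 then 1 else -1)"

lemma eps_eq: "Q \<subseteq> prime_factors N \<Longrightarrow> AL_pair Q w r \<Longrightarrow> of_int (eps Q) = chi (r *\<^sub>R w)"
proof -
  assume Q: "Q \<subseteq> prime_factors N" and w: "AL_pair Q w r"
  have "chi (r *\<^sub>R w) = 1 \<or> chi (r *\<^sub>R w) = -1" by (rule AL_pair_chi[OF w])
  then show ?thesis
  proof
    assume 1: "chi (r *\<^sub>R w) = 1"
    then have "eps Q = 1" using w unfolding eps_def by auto
    then show ?thesis using 1 by simp
  next
    assume m: "chi (r *\<^sub>R w) = -1"
    have "\<not> (\<exists>w r. AL_pair Q w r \<and> chi (r *\<^sub>R w) = 1)"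
    proof
      assume "\<exists>w r. AL_pair Q w r \<and> chi (r *\<^sub>R w) = 1"
      then obtain w' r' where "AL_pair Q w' r'" "chi (r' *\<^sub>R w') = 1" by blast
      then show False using AL_pair_chi_unique[OF Q w, of w' r'] m by simp
    qed
    then have "eps Q = -1" unfolding eps_def by (simp only: if_False)
    then show ?thesis using m by simp
  qed
qed

lemma eps_mult:
  assumes "Q \<in> QQ" "Q' \<in> QQ"
  shows "eps (sym_diff Q Q') = eps Q * eps Q'"
proof -
  obtain w r w' r' where w: "Q \<subseteq> prime_factors N" "Q' \<subseteq> prime_factors N" "AL_pair Q w r" "AL_pair Q' w' r'"
    using assms unfolding QQ_iff by blast
  obtain w'' r'' where w'': "AL_pair (sym_diff Q Q') w'' r''" "chi (r'' *\<^sub>R w'') = chi (r *\<^sub>R w) * chi (r' *\<^sub>R w')"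
    by (rule AL_pair_mult[OF w])
  have "of_int (eps (sym_diff Q Q')) = (of_int (eps Q * eps Q') :: complex)"
    using eps_eq[OF w(1,3)] eps_eq[OF w(2,4)] eps_eq[OF _ w''(1)] w(1,2) w''(2) by auto
  then show ?thesis by (simp only: of_int_eq_iff)
qed

text \<open>The factor in front makes Atkin--Lehner matrices permute these forms: the matrix of \<open>Q'\<close> takes the
  form of \<open>Q\<close> to that of the symmetric difference.\<close>

definition level_form :: "nat \<Rightarrow> nat set \<Rightarrow> complex \<Rightarrow> complex" where
  "level_form \<kappa> Q \<tau> = of_nat (hp Q) ^ \<kappa> * eis (2 * \<kappa>) (of_nat (hp Q) * \<tau>)"

text \<open>With j the automorphy factor of w, both sides carry the same constant: g x (j / g)^2 =
  (j^2 / (g y)) x y, and g y is the determinant of w.\<close>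

lemma level_form_transform:
  assumes Q: "Q \<subseteq> prime_factors N" "Q' \<subseteq> prime_factors N" and w: "w \<in> AL_matrices N (hp Q')"
    and \<kappa>: "\<kappa> \<ge> 2" and \<tau>: "Im \<tau> > 0"
  shows "level_form \<kappa> Q (moebius w \<tau>) = (mden w \<tau> ^ 2 / of_real (det w)) ^ \<kappa> * level_form \<kappa> (sym_diff Q Q') \<tau>"
proof -
  obtain g x y l where s: "hp Q = g * x" "hp Q' = g * y" "hp (sym_diff Q Q') = x * y" "N = g * x * y * l"
    "g > 0" "x > 0" "y > 0"
    by (rule hall_part_split[OF N Q])
  have "w \<in> AL_matrices (g * x * y * l) (g * y)" using w s by simp
  then have e: "eis (2 * \<kappa>) (of_nat (g * x) * moebius w \<tau>) = (mden w \<tau> / of_nat g) ^ (2 * \<kappa>) * eis (2 * \<kappa>) (of_nat (x * y) * \<tau>)"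
    by (rule eis_AL) (use s \<kappa> \<tau> in auto)
  have dw: "det w = of_nat (g * y)" using AL_matrices_det[OF w] s(2) by simp
  have "of_nat (g * x) * (mden w \<tau> / of_nat g) ^ 2 = (mden w \<tau> ^ 2 / of_real (det w)) * of_nat (x * y)"
    using s(5-7) by (simp add: dw power2_eq_square field_simps)
  then have "(of_nat (g * x) * (mden w \<tau> / of_nat g) ^ 2) ^ \<kappa> = ((mden w \<tau> ^ 2 / of_real (det w)) * of_nat (x * y)) ^ \<kappa>"
    by simp
  then have "of_nat (g * x) ^ \<kappa> * (mden w \<tau> / of_nat g) ^ (2 * \<kappa>) = (mden w \<tau> ^ 2 / of_real (det w)) ^ \<kappa> * of_nat (x * y) ^ \<kappa>"
    by (simp only: power_mult_distrib power_mult)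
  then show ?thesis unfolding level_form_def s(1,3) e by (simp only: mult.assoc[symmetric])
qed

lemma generator_cases:
  assumes "w \<in> Gamma0 N \<union> (\<Union>e\<in>S. AL_matrices N e)"
  obtains Q where "Q \<in> QQ" "w \<in> AL_matrices N (hp Q)" "w \<in> \<Gamma>" "of_int (eps Q) = chi w"
proof -
  obtain e where e: "hall_divisor e N" "w \<in> AL_matrices N e" "w \<in> \<Gamma>"
    using assms S \<Gamma>_props(4,5) hall_divisor_1[of N] unfolding AL_matrices_1[symmetric] by blast
  define Q where "Q = prime_factors e"
  have Q: "Q \<subseteq> prime_factors N" "hp Q = e" using hall_divisor_eq_hall_part[OF N e(1)] by (simp_all add: Q_def)
  have p: "AL_pair Q w 1" using e Q by (simp add: AL_pair_def)
  have "Q \<in> QQ" using p Q unfolding QQ_iff by blast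
  then show ?thesis using that e Q eps_eq[OF Q(1) p] by simp
qed

text \<open>On generators E and Z^(2 \<kappa>) are multiplied by the same factor. The
  cross-multiplied relation is also meaningful at zeros of Z and passes to inverses directly. For
  products one cancels the value of Z at the intermediate point; if that value is 0, so are the
  values at both ends.\<close>

lemma invariance_from_generators:
  assumes gen: "\<And>w \<tau>. w \<in> Gamma0 N \<union> (\<Union>e\<in>S. AL_matrices N e) \<Longrightarrow> Im \<tau> > 0 \<Longrightarrow>
      E (moebius w \<tau>) = chi w ^ \<kappa> * (mden w \<tau> ^ 2 / of_real (det w)) ^ \<kappa> * E \<tau>"
    and \<kappa>: "\<kappa> > 0" and \<gamma>: "\<gamma> \<in> \<Gamma>" and \<tau>: "Im \<tau> > 0"
  shows "E (moebius \<gamma> \<tau>) * Z \<tau> ^ (2 * \<kappa>) = E \<tau> * Z (moebius \<gamma> \<tau>) ^ (2 * \<kappa>)"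
proof -
  interpret G: group GL2_plus by (rule group_GL2_plus)
  let ?H = "Gamma0 N \<union> (\<Union>e\<in>S. AL_matrices N e)"
  have H\<Gamma>: "?H \<subseteq> \<Gamma>" using \<Gamma>_props(4,5) by blast
  have base: "E (moebius w \<tau>) * Z \<tau> ^ (2 * \<kappa>) = E \<tau> * Z (moebius w \<tau>) ^ (2 * \<kappa>)" if w: "w \<in> ?H" "Im \<tau> > 0" for w \<tau>
  proof -
    have "w \<in> \<Gamma>" using w H\<Gamma> by blast
    from Z2_transform[OF this w(2)]
    have "Z (moebius w \<tau>) ^ (2 * \<kappa>) = chi w ^ \<kappa> * (mden w \<tau> ^ 2 / of_real (det w)) ^ \<kappa> * Z \<tau> ^ (2 * \<kappa>)"
      by (simp only: power_mult power_mult_distrib)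
    then show ?thesis unfolding gen[OF w] by simp
  qed
  have "\<gamma> \<in> generate GL2_plus ?H" using \<gamma> by (simp add: \<Gamma>_eq AL_extension_def)
  then show ?thesis using \<tau>
  proof (induction \<gamma> arbitrary: \<tau> rule: generate.induct)
    case one
    then show ?case by (simp add: GL2_plus_def moebius_one)
  next
    case (incl h)
    then show ?case by (intro base)
  next
    case (inv h)
    have hc: "h \<in> carrier GL2_plus" using inv(1) H\<Gamma> \<Gamma>_det by (auto simp: GL2_plus_def)
    define h' where "h' = inv\<^bsub>GL2_plus\<^esub> h"
    have h': "h' \<in> carrier GL2_plus" "h ** h' = mat 1"
      using G.inv_closed[OF hc] G.r_inv[OF hc] by (simp_all add: h'_def GL2_plus_def)
    have dh': "det h' > 0" using h'(1) by (simp add: GL2_plus_def)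
    have "moebius h (moebius h' \<tau>) = \<tau>"
      using moebius_mult[OF mden_nonzero[OF dh' inv(2)], of h] by (simp add: h'(2) moebius_one)
    then show ?case
      using base[OF inv(1) Im_moebius_pos[OF dh' inv(2)]] by (simp add: h'_def mult.commute)
  next
    case (eng h1 h2)
    have \<Gamma>12: "h1 \<in> \<Gamma>" "h2 \<in> \<Gamma>" using eng(1,2) by (simp_all add: \<Gamma>_eq AL_extension_def)
    define \<sigma> where "\<sigma> = moebius h2 \<tau>"
    have \<sigma>: "Im \<sigma> > 0" unfolding \<sigma>_def by (rule Im_moebius_pos[OF \<Gamma>_det[OF \<Gamma>12(2)] eng.prems])
    have comp: "moebius (h1 \<otimes>\<^bsub>GL2_plus\<^esub> h2) \<tau> = moebius h1 \<sigma>"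
      using moebius_mult[OF mden_nonzero[OF \<Gamma>_det[OF \<Gamma>12(2)] eng.prems], of h1] by (simp add: GL2_plus_def \<sigma>_def)
    have 1: "E (moebius h1 \<sigma>) * Z \<sigma> ^ (2 * \<kappa>) = E \<sigma> * Z (moebius h1 \<sigma>) ^ (2 * \<kappa>)" by (rule eng.IH(1)[OF \<sigma>])
    have 2: "E \<sigma> * Z \<tau> ^ (2 * \<kappa>) = E \<tau> * Z \<sigma> ^ (2 * \<kappa>)" unfolding \<sigma>_def by (rule eng.IH(2)[OF eng.prems])
    show ?case unfolding comp
    proof (cases "Z \<sigma> = 0")
      case True
      then have "Z \<tau> = 0" "Z (moebius h1 \<sigma>) = 0"
        using Z_zero_inv[OF \<Gamma>12(2) eng.prems] Z_zero_inv[OF \<Gamma>12(1) \<sigma>] by (simp_all add: \<sigma>_def)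
      then show "E (moebius h1 \<sigma>) * Z \<tau> ^ (2 * \<kappa>) = E \<tau> * Z (moebius h1 \<sigma>) ^ (2 * \<kappa>)" using \<kappa> by simp
    next
      case False
      have "Z \<sigma> ^ (2 * \<kappa>) * (E (moebius h1 \<sigma>) * Z \<tau> ^ (2 * \<kappa>)) = (E \<sigma> * Z \<tau> ^ (2 * \<kappa>)) * Z (moebius h1 \<sigma>) ^ (2 * \<kappa>)"
        using arg_cong[OF 1, of "\<lambda>x. x * Z \<tau> ^ (2 * \<kappa>)"] by (simp add: mult_ac)
      also have "\<dots> = Z \<sigma> ^ (2 * \<kappa>) * (E \<tau> * Z (moebius h1 \<sigma>) ^ (2 * \<kappa>))" unfolding 2 by simp
      finally show "E (moebius h1 \<sigma>) * Z \<tau> ^ (2 * \<kappa>) = E \<tau> * Z (moebius h1 \<sigma>) ^ (2 * \<kappa>)" using False by simp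
    qed
  qed
qed

end


section \<open>The Eisenstein combination\<close>

text \<open>Boundedness of the weight k slash near i infinity for every A, written without negative
  powers. No group is involved, so the condition is stable under sums and products of forms of
  different level.\<close>

definition cusp_growth :: "nat \<Rightarrow> (complex \<Rightarrow> complex) \<Rightarrow> bool" where
  "cusp_growth k f \<longleftrightarrow>
     (\<forall>A\<in>SL2Z. \<exists>C. \<forall>\<^sub>F \<tau> in at_ii_inf. norm (f (moebius A \<tau>)) \<le> C * norm (mden A \<tau>) ^ k)"

lemma cusp_growth_const: "cusp_growth 0 (\<lambda>_. c)"
  unfolding cusp_growth_def by (intro ballI exI[of _ "norm c"]) simp

lemma cusp_growth_zero: "cusp_growth k (\<lambda>_. 0)"
  unfolding cusp_growth_def by (intro ballI exI[of _ 0]) simp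

lemma cusp_growth_add:
  assumes "cusp_growth k f" "cusp_growth k g"
  shows "cusp_growth k (\<lambda>\<tau>. f \<tau> + g \<tau>)"
  unfolding cusp_growth_def
proof
  fix A assume A: "A \<in> SL2Z"
  obtain C where C: "\<forall>\<^sub>F \<tau> in at_ii_inf. norm (f (moebius A \<tau>)) \<le> C * norm (mden A \<tau>) ^ k"
    using assms(1) A unfolding cusp_growth_def by blast
  obtain D where D: "\<forall>\<^sub>F \<tau> in at_ii_inf. norm (g (moebius A \<tau>)) \<le> D * norm (mden A \<tau>) ^ k"
    using assms(2) A unfolding cusp_growth_def by blast
  have "\<forall>\<^sub>F \<tau> in at_ii_inf. norm (f (moebius A \<tau>) + g (moebius A \<tau>)) \<le> (C + D) * norm (mden A \<tau>) ^ k"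
    using C D
  proof eventually_elim
    case (elim \<tau>)
    then show ?case unfolding distrib_right by (rule norm_add_rule_thm)
  qed
  then show "\<exists>C. \<forall>\<^sub>F \<tau> in at_ii_inf. norm (f (moebius A \<tau>) + g (moebius A \<tau>)) \<le> C * norm (mden A \<tau>) ^ k" by blast
qed

lemma cusp_growth_mult:
  assumes "cusp_growth k f" "cusp_growth l g"
  shows "cusp_growth (k + l) (\<lambda>\<tau>. f \<tau> * g \<tau>)"
  unfolding cusp_growth_def
proof
  fix A assume A: "A \<in> SL2Z"
  obtain C where C: "\<forall>\<^sub>F \<tau> in at_ii_inf. norm (f (moebius A \<tau>)) \<le> C * norm (mden A \<tau>) ^ k"
    using assms(1) A unfolding cusp_growth_def by blast
  obtain D where D: "\<forall>\<^sub>F \<tau> in at_ii_inf. norm (g (moebius A \<tau>)) \<le> D * norm (mden A \<tau>) ^ l"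
    using assms(2) A unfolding cusp_growth_def by blast
  have "\<forall>\<^sub>F \<tau> in at_ii_inf. norm (f (moebius A \<tau>) * g (moebius A \<tau>)) \<le> (C * D) * norm (mden A \<tau>) ^ (k + l)"
    using C D
  proof eventually_elim
    case (elim \<tau>)
    have "norm (f (moebius A \<tau>)) * norm (g (moebius A \<tau>)) \<le> (C * norm (mden A \<tau>) ^ k) * (D * norm (mden A \<tau>) ^ l)"
      by (rule mult_mono'[OF elim]) simp_all
    then show ?case by (simp add: norm_mult power_add mult_ac)
  qed
  then show "\<exists>C. \<forall>\<^sub>F \<tau> in at_ii_inf. norm (f (moebius A \<tau>) * g (moebius A \<tau>)) \<le> C * norm (mden A \<tau>) ^ (k + l)" by blast
qed

lemma cusp_growth_cmult: "cusp_growth k f \<Longrightarrow> cusp_growth k (\<lambda>\<tau>. c * f \<tau>)"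
  using cusp_growth_mult[OF cusp_growth_const[of c]] by simp

lemma cusp_growth_sum: "(\<And>i. i \<in> I \<Longrightarrow> cusp_growth k (f i)) \<Longrightarrow> cusp_growth k (\<lambda>\<tau>. \<Sum>i\<in>I. f i \<tau>)"
  by (induction I rule: infinite_finite_induct) (simp_all add: cusp_growth_zero cusp_growth_add)

lemma cusp_growth_prod:
  assumes "finite I" "\<And>i. i \<in> I \<Longrightarrow> cusp_growth k (f i)"
  shows "cusp_growth (card I * k) (\<lambda>\<tau>. \<Prod>i\<in>I. f i \<tau>)"
  using assms by (induction I rule: finite_induct) (simp_all add: cusp_growth_const cusp_growth_mult)

lemma cusp_growth_eis: "d > 0 \<Longrightarrow> even k \<Longrightarrow> k \<ge> 4 \<Longrightarrow> cusp_growth k (\<lambda>\<tau>. eis k (of_nat d * \<tau>))"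
  unfolding cusp_growth_def using eis_level_cusp_bound by blast

lemma sum_cong_count:
  assumes "finite I" "\<And>i. i \<in> I \<Longrightarrow> P i \<Longrightarrow> [f i = 0] (mod m)" "\<And>i. i \<in> I \<Longrightarrow> \<not> P i \<Longrightarrow> [f i = c] (mod (m::int))"
  shows "[(\<Sum>i\<in>I. f i) = int (card {i\<in>I. \<not> P i}) * c] (mod m)"
proof -
  have "[(\<Sum>i\<in>I. f i) = (\<Sum>i\<in>I. if P i then 0 else c)] (mod m)"
    by (rule cong_sum) (use assms in auto)
  also have "(\<Sum>i\<in>I. if P i then 0 else c) = int (card {i\<in>I. \<not> P i}) * c"
    using assms(1) by (simp add: sum.If_cases Int_def)
  finally show ?thesis .
qed

context atkin_lehner_setup
begin

lemma hp_pos: "Q \<in> QQ \<Longrightarrow> hp Q > 0"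
  by (rule hall_part_pos) (simp add: QQ_def)

lemma empty_QQ: "{} \<in> QQ"
proof -
  have "mat 1 = mat2 (of_int 1) (of_int 0) (of_int (0 * int N)) (of_int 1)"
    by (rule mat2_eqI) (simp_all add: mat_def)
  then have "mat 1 \<in> Gamma0 N" unfolding Gamma0_def by (intro CollectI exI conjI) (assumption, simp)
  then have "AL_pair {} (mat 1) 1"
    using \<Gamma>_one unfolding AL_pair_def hall_part_def prod.empty AL_matrices_1 by simp
  then show ?thesis unfolding QQ_iff by blast
qed

text \<open>Adding Q' is an involution of \<open>QQ\<close>. An Atkin--Lehner matrix therefore only
  permutes the summands or factors of a form built over all of \<open>QQ\<close>.\<close>

lemma reindex_QQ:
  assumes "Q' \<in> QQ"
  shows "(\<Sum>Q\<in>QQ. g (sym_diff Q Q')) = sum g QQ" "(\<Prod>Q\<in>QQ. h (sym_diff Q Q')) = prod h QQ"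
proof -
  have i: "sym_diff (sym_diff Q Q') Q' = Q" for Q by auto
  show "(\<Sum>Q\<in>QQ. g (sym_diff Q Q')) = sum g QQ"
    by (rule sum.reindex_bij_witness[of _ "\<lambda>Q. sym_diff Q Q'" "\<lambda>Q. sym_diff Q Q'"]) (use QQ_closed assms i in auto)
  show "(\<Prod>Q\<in>QQ. h (sym_diff Q Q')) = prod h QQ"
    by (rule prod.reindex_bij_witness[of _ "\<lambda>Q. sym_diff Q Q'" "\<lambda>Q. sym_diff Q Q'"]) (use QQ_closed assms i in auto)
qed

lemma prime_dvd_hp:
  assumes "Q \<in> QQ" "Factorial_Ring.prime p"
  shows "p dvd hp Q \<longleftrightarrow> p \<in> Q"
proof -
  have Q: "Q \<subseteq> prime_factors N" using assms(1) by (simp add: QQ_def)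
  have "p dvd hp Q \<longleftrightarrow> (\<exists>q\<in>Q. p dvd q ^ multiplicity q N)"
    unfolding hall_part_def using Q assms(2) by (intro prime_dvd_prod_iff) (auto intro: finite_subset)
  also have "\<dots> \<longleftrightarrow> p \<in> Q"
  proof
    assume "\<exists>q\<in>Q. p dvd q ^ multiplicity q N"
    then obtain q where q: "q \<in> Q" "p dvd q" using prime_dvd_power[OF assms(2)] by blast
    have "Factorial_Ring.prime q" using q(1) Q by (auto dest: in_prime_factors_imp_prime)
    then show "p \<in> Q" using q assms(2) primes_dvd_imp_eq by blast
  next
    assume p: "p \<in> Q"
    then have "multiplicity p N > 0" using Q by (auto simp: prime_factors_multiplicity)
    then show "\<exists>q\<in>Q. p dvd q ^ multiplicity q N" using p by (intro bexI[of _ p]) (auto intro: dvd_power)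
  qed
  finally show ?thesis .
qed

lemma card_QQ: "\<exists>j. card QQ = 2 ^ j" "\<exists>j. card {Q\<in>QQ. p \<notin> Q} = 2 ^ j"
proof -
  show "\<exists>j. card QQ = 2 ^ j"
    by (rule card_sym_diff_closed[of "prime_factors N"]) (use empty_QQ QQ_closed in \<open>auto simp: QQ_def\<close>)
  show "\<exists>j. card {Q\<in>QQ. p \<notin> Q} = 2 ^ j"
    by (rule card_sym_diff_closed[of "prime_factors N"]) (use empty_QQ QQ_closed in \<open>auto simp: QQ_def\<close>)
qed

context
  fixes R :: "complex set" and p :: nat and \<phi> :: "complex \<Rightarrow> nat \<Rightarrow> int" and T :: "nat \<Rightarrow> complex"
  assumes R: "subring R (ring_of_type_algebra :: complex ring)"
    and p: "Factorial_Ring.prime p" and emb: "padic_embedding R p \<phi>"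
    and tR: "\<And>n. fps_nth tq n \<in> R" and tq0: "fps_nth tq 0 = 0" and ZR: "\<And>n. fps_nth Zq n \<in> R"
    and T: "Abs_fps T oo tq = Zq"
begin

text \<open>Odd primes and p = 2 differ only in the choice of E; this is the argument they share.
  The weight is 2 \<kappa>, and the law for E is demanded on the generators alone.\<close>

lemma lucas_from_form:
  assumes \<kappa>: "2 * \<kappa> = (p - 1) * p ^ j" "\<kappa> > 0"
    and E_hol: "E holomorphic_on upper_half_plane"
    and E_gen: "\<And>w \<tau>. w \<in> Gamma0 N \<union> (\<Union>e\<in>S. AL_matrices N e) \<Longrightarrow> Im \<tau> > 0 \<Longrightarrow>
      E (moebius w \<tau>) = chi w ^ \<kappa> * (mden w \<tau> ^ 2 / of_real (det w)) ^ \<kappa> * E \<tau>"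
    and E_cusp: "cusp_growth (2 * \<kappa>) E"
    and E_exp: "f has_fps_expansion F" "\<And>\<tau>. E \<tau> = f (nome 1 \<tau>)"
    and M: "cong_const p M F" "\<not> int p dvd M"
  shows "lucas_congruences p (\<lambda>n. \<phi> (T n))"
proof -
  have "\<exists>C. \<forall>\<^sub>F \<tau> in at_ii_inf. norm (E (moebius A \<tau>)) \<le> C * norm (mden A \<tau>) ^ (2 * \<kappa>)" if "A \<in> SL2Z" for A
    using E_cusp that unfolding cusp_growth_def by blast
  from form_is_polynomial[OF E_hol invariance_from_generators[OF E_gen \<kappa>(2)] this]
  obtain a where a: "\<And>z. Im z > 0 \<Longrightarrow> Z z \<noteq> 0 \<Longrightarrow> E z = Z z ^ (2 * \<kappa>) * (\<Sum>i\<le>2 * \<kappa>. a i * t z ^ i)"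
    by blast
  have rt: "fps_conv_radius tq > 0" and rZ: "fps_conv_radius Zq > 0"
    by (rule q_expansion_eval(1)[OF t_exp], rule q_expansion_eval(1)[OF Z_exp])
  define g where "g w = eval_fps Zq w ^ (2 * \<kappa>) * (\<Sum>i\<le>2 * \<kappa>. a i * eval_fps tq w ^ i)" for w
  define G where "G = Zq ^ (2 * \<kappa>) * (\<Sum>i\<le>2 * \<kappa>. fps_const (a i) * tq ^ i)"
  have gG: "g has_fps_expansion G"
    unfolding g_def G_def
    by (intro fps_expansion_intros eval_fps_has_fps_expansion rt rZ)
  \<comment> \<open>The polynomial expression is available only where Z does not vanish; near i
    infinity this is ensured by the constant term 1 of \<open>Zq\<close>.\<close>
  have "continuous (at 0) (eval_fps Zq)" using rZ by (intro continuous_eval_fps) (simp add: zero_ereal_def)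
  then have "(eval_fps Zq \<longlongrightarrow> 1) (at 0)" using Zq0 by (simp add: continuous_within eval_fps_at_0)
  then have "\<forall>\<^sub>F w in at 0. eval_fps Zq w \<noteq> 0" by (rule tendsto_imp_eventually_ne) simp
  then have Znz: "\<forall>\<^sub>F \<tau> in at_ii_inf. eval_fps Zq (nome 1 \<tau>) \<noteq> 0"
    using eventually_nome[of 1 "\<lambda>w. eval_fps Zq w \<noteq> 0"] by simp
  have "\<forall>\<^sub>F \<tau> in at_ii_inf. f (nome 1 \<tau>) = g (nome 1 \<tau>)"
    using Znz eventually_Im_pos q_expansion_eval(2)[OF t_exp] q_expansion_eval(2)[OF Z_exp]
  proof eventually_elim
    case (elim \<tau>)
    then show ?case using a[of \<tau>] E_exp(2)[of \<tau>] by (simp add: g_def)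
  qed
  then have "F = G" by (rule fps_unique_at_ii_inf[OF E_exp(1) gG])
  moreover obtain b where "F = of_int M + of_nat p * Abs_fps (\<lambda>n. of_int (b n))"
    using M(1) unfolding cong_const_def by blast
  ultimately have "of_int M + of_nat p * Abs_fps (\<lambda>n. of_int (b n)) = G" by simp
  then show ?thesis
    unfolding G_def by (rule lucas_from_expansion[OF R p emb tR tq0 tq1 ZR Zq0 T \<kappa>(1) M(2)])
qed

lemma lucas_odd:
  assumes \<kappa>: "2 * \<kappa> = (p - 1) * p ^ j" "\<kappa> \<ge> 2" and podd: "odd p"
    and uv: "eis_const (2 * \<kappa>) = of_int u / of_int v" "v \<noteq> 0" "int p dvd v" "\<not> int p dvd u"
    and eps: "\<And>Q. Q \<in> QQ \<Longrightarrow> p \<notin> Q \<Longrightarrow> [(eps Q * int (hp Q)) ^ \<kappa> = 1] (mod int p)"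
  shows "lucas_congruences p (\<lambda>n. \<phi> (T n))"
proof -
  define c where "c Q = (eps Q * int (hp Q)) ^ \<kappa>" for Q
  \<comment> \<open>The twist by \<open>eps\<close> makes a generator w multiply the sum by
    chi(w)^\<kappa>, as it does for the \<kappa>-th power of Z^2. The factor v clears the
    denominator of the constant terms, which become c(Q) u.\<close>
  define E where "E \<tau> = of_int v * (\<Sum>Q\<in>QQ. of_int (eps Q) ^ \<kappa> * level_form \<kappa> Q \<tau>)" for \<tau>
  define f where "f w = (\<Sum>Q\<in>QQ. of_int (c Q) * (of_int v * eval_fps (eis_fps (2 * \<kappa>)) (w ^ hp Q)))" for w :: complex
  define F where "F = (\<Sum>Q\<in>QQ. fps_const (of_int (c Q)) * (fps_const (of_int v) * (eis_fps (2 * \<kappa>) oo fps_X ^ hp Q)))"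
  show ?thesis
  proof (rule lucas_from_form[OF \<kappa>(1)])
    show "\<kappa> > 0" using \<kappa> by simp
    show "E holomorphic_on upper_half_plane"
      unfolding E_def level_form_def by (intro holomorphic_intros eis_holomorphic hp_pos)
    show "E (moebius w \<tau>) = chi w ^ \<kappa> * (mden w \<tau> ^ 2 / of_real (det w)) ^ \<kappa> * E \<tau>"
      if w: "w \<in> Gamma0 N \<union> (\<Union>e\<in>S. AL_matrices N e)" and \<tau>: "Im \<tau> > 0" for w \<tau>
    proof -
      obtain Q' where Q': "Q' \<in> QQ" "w \<in> AL_matrices N (hp Q')" "of_int (eps Q') = chi w"
        by (rule generator_cases[OF w]) auto
      define J where "J = (mden w \<tau> ^ 2 / of_real (det w)) ^ \<kappa>"
      have "of_int (eps Q) ^ \<kappa> * level_form \<kappa> Q (moebius w \<tau>) =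
          chi w ^ \<kappa> * J * (of_int (eps (sym_diff Q Q')) ^ \<kappa> * level_form \<kappa> (sym_diff Q Q') \<tau>)" if Q: "Q \<in> QQ" for Q
      proof -
        have "chi w ^ \<kappa> * chi w ^ \<kappa> = 1"
          unfolding Q'(3)[symmetric] eps_def by (simp flip: power_mult_distrib)
        then have e: "chi w ^ \<kappa> * of_int (eps (sym_diff Q Q')) ^ \<kappa> = of_int (eps Q) ^ \<kappa>"
          by (simp add: eps_mult[OF Q Q'(1)] Q'(3) power_mult_distrib)
        have l: "level_form \<kappa> Q (moebius w \<tau>) = J * level_form \<kappa> (sym_diff Q Q') \<tau>"
          unfolding J_def by (rule level_form_transform) (use Q Q' \<kappa> \<tau> in \<open>auto simp: QQ_def\<close>)
        show ?thesis unfolding l e[symmetric] by (simp only: mult_ac)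
      qed
      then have "(\<Sum>Q\<in>QQ. of_int (eps Q) ^ \<kappa> * level_form \<kappa> Q (moebius w \<tau>)) =
          (\<Sum>Q\<in>QQ. chi w ^ \<kappa> * J * (of_int (eps (sym_diff Q Q')) ^ \<kappa> * level_form \<kappa> (sym_diff Q Q') \<tau>))"
        by (intro sum.cong refl)
      also have "\<dots> = (\<Sum>Q\<in>QQ. chi w ^ \<kappa> * J * (of_int (eps Q) ^ \<kappa> * level_form \<kappa> Q \<tau>))"
        by (rule reindex_QQ(1)[OF Q'(1)])
      finally show ?thesis unfolding E_def J_def by (simp only: sum_distrib_left mult_ac)
    qed
    have k4: "2 * \<kappa> \<ge> 4" using \<kappa>(2) by simp
    show "cusp_growth (2 * \<kappa>) E"
      unfolding E_def level_form_def
      by (intro cusp_growth_cmult cusp_growth_sum cusp_growth_eis hp_pos k4) auto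
    show "f has_fps_expansion F"
      unfolding f_def F_def
      by (intro has_fps_expansion_sum has_fps_expansion_cmult_left eis_has_expansion hp_pos)
    show "E \<tau> = f (nome 1 \<tau>)" for \<tau>
      by (simp add: E_def f_def c_def level_form_def eis_nome[symmetric] power_mult_distrib sum_distrib_left mult_ac)
    have "cong_const p (c Q * u) (fps_const (of_int (c Q)) * (fps_const (of_int v) * (eis_fps (2 * \<kappa>) oo fps_X ^ hp Q)))"
      if "Q \<in> QQ" for Q
      unfolding fps_of_int by (intro cong_const_mult cong_const_of_int cong_const_eis[OF uv(1-3), unfolded fps_of_int] hp_pos that)
    then show "cong_const p (\<Sum>Q\<in>QQ. c Q * u) F"
      unfolding F_def by (rule cong_const_sum)
    have "[(\<Sum>Q\<in>QQ. c Q) = int (card {Q\<in>QQ. \<not> p \<in> Q}) * 1] (mod int p)"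
    proof (rule sum_cong_count[OF finite_QQ])
      fix Q assume Q: "Q \<in> QQ"
      show "[c Q = 1] (mod int p)" if "p \<notin> Q" using eps[OF Q that] by (simp add: c_def)
      assume "p \<in> Q"
      then have "int p dvd eps Q * int (hp Q)" using prime_dvd_hp[OF Q p] by (simp add: dvd_mult)
      then show "[c Q = 0] (mod int p)" using \<kappa>(2) by (simp add: c_def cong_0_iff dvd_power_iff dvd_trans[OF _ dvd_power])
    qed
    then have c: "int p dvd (\<Sum>Q\<in>QQ. c Q) \<longleftrightarrow> int p dvd int (card {Q\<in>QQ. \<not> p \<in> Q})"
      by (simp add: cong_dvd_iff)
    obtain i where i: "card {Q\<in>QQ. p \<notin> Q} = 2 ^ i" using card_QQ(2) by blast
    have "\<not> p dvd 2 ^ i"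
    proof
      assume "p dvd 2 ^ i"
      then have "p dvd 2" using p prime_dvd_power by blast
      then have "p = 2" using p primes_dvd_imp_eq two_is_prime_nat by blast
      then show False using podd by simp
    qed
    then have "\<not> int p dvd int (card {Q\<in>QQ. \<not> p \<in> Q})" unfolding i int_dvd_int_iff .
    then show "\<not> int p dvd (\<Sum>Q\<in>QQ. c Q * u)"
      using uv(4) c p by (simp add: prime_dvd_mult_iff flip: sum_distrib_right)
  qed
qed

text \<open>A sum over 2^i divisors could have an even constant term, whence the product. The factor
  240 cancels the constant term 1/240 of the weight 4 series and makes all other coefficients even.
  The weight is 4 * 2^i, a power of 2, and the character disappears because it is raised to an even
  power.\<close>

lemma lucas_2:
  assumes p2: "p = 2"
  shows "lucas_congruences p (\<lambda>n. \<phi> (T n))"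
proof -
  define n where "n = card QQ"
  obtain i where i: "n = 2 ^ i" using card_QQ(1) by (auto simp: n_def)
  define E where "E \<tau> = (\<Prod>Q\<in>QQ. of_int 240 * eis 4 (of_nat (hp Q) * \<tau>))" for \<tau>
  define f where "f w = (\<Prod>Q\<in>QQ. of_int 240 * eval_fps (eis_fps 4) (w ^ hp Q))" for w :: complex
  define F where "F = (\<Prod>Q\<in>QQ. fps_const (of_int 240) * (eis_fps 4 oo fps_X ^ hp Q))"
  show ?thesis
  proof (rule lucas_from_form[of "2 * n" "i + 2"])
    show "2 * (2 * n) = (p - 1) * p ^ (i + 2)" by (simp add: p2 i)
    show "2 * n > 0" by (simp add: i)
    show "E holomorphic_on upper_half_plane"
      unfolding E_def by (intro holomorphic_intros eis_holomorphic hp_pos)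
    show "E (moebius w \<tau>) = chi w ^ (2 * n) * (mden w \<tau> ^ 2 / of_real (det w)) ^ (2 * n) * E \<tau>"
      if w: "w \<in> Gamma0 N \<union> (\<Union>e\<in>S. AL_matrices N e)" and \<tau>: "Im \<tau> > 0" for w \<tau>
    proof -
      obtain Q' where Q': "Q' \<in> QQ" "w \<in> AL_matrices N (hp Q')" "w \<in> \<Gamma>"
        by (rule generator_cases[OF w]) auto
      define J where "J = (mden w \<tau> ^ 2 / of_real (det w)) ^ 2"
      \<comment> \<open>The normalising factors d^2 enter the product as one nonzero constant. It is
        divided out, since it may be even and would spoil the constant term.\<close>
      have P: "(\<Prod>Q\<in>QQ. level_form 2 Q z) = (\<Prod>Q\<in>QQ. of_nat (hp Q) ^ 2) * (\<Prod>Q\<in>QQ. eis 4 (of_nat (hp Q) * z))" for z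
        by (simp add: level_form_def prod.distrib)
      have nz: "(\<Prod>Q\<in>QQ. of_nat (hp Q) ^ 2) \<noteq> (0::complex)"
        using hp_pos finite_QQ by (auto simp: prod_zero_iff)
      have l: "level_form 2 Q (moebius w \<tau>) = J * level_form 2 (sym_diff Q Q') \<tau>" if "Q \<in> QQ" for Q
        unfolding J_def by (rule level_form_transform) (use that Q' \<tau> in \<open>auto simp: QQ_def\<close>)
      have "(\<Prod>Q\<in>QQ. level_form 2 Q (moebius w \<tau>)) = (\<Prod>Q\<in>QQ. J * level_form 2 (sym_diff Q Q') \<tau>)"
        by (intro prod.cong refl l)
      also have "\<dots> = (\<Prod>Q\<in>QQ. J * level_form 2 Q \<tau>)" by (rule reindex_QQ(2)[OF Q'(1)])
      also have "\<dots> = J ^ n * (\<Prod>Q\<in>QQ. level_form 2 Q \<tau>)" by (simp add: prod.distrib n_def)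
      finally have "(\<Prod>Q\<in>QQ. eis 4 (of_nat (hp Q) * moebius w \<tau>)) = J ^ n * (\<Prod>Q\<in>QQ. eis 4 (of_nat (hp Q) * \<tau>))"
        unfolding P using nz by simp
      moreover have "chi w ^ (2 * n) = 1" using chi_cases[OF Q'(3)] by (auto simp: power_mult)
      ultimately show ?thesis by (simp add: E_def J_def prod.distrib power_mult)
    qed
    have "cusp_growth (card QQ * 4) E"
      unfolding E_def by (intro cusp_growth_prod finite_QQ cusp_growth_cmult cusp_growth_eis hp_pos) auto
    then show "cusp_growth (2 * (2 * n)) E" by (simp add: n_def mult.commute)
    show "f has_fps_expansion F"
      unfolding f_def F_def
      by (intro has_fps_expansion_prod has_fps_expansion_cmult_left eis_has_expansion hp_pos)
    show "E \<tau> = f (nome 1 \<tau>)" for \<tau> by (simp add: E_def f_def eis_nome)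
    have "cong_const p 1 (fps_const (of_int 240) * (eis_fps 4 oo fps_X ^ hp Q))" if "Q \<in> QQ" for Q
      by (rule cong_const_eis) (use hp_pos[OF that] in \<open>simp_all add: eis_const_4 p2\<close>)
    then show "cong_const p (\<Prod>Q\<in>QQ. 1) F" unfolding F_def by (rule cong_const_prod)
    show "\<not> int p dvd (\<Prod>Q\<in>QQ. 1)" by (simp add: p2)
  qed
qed

text \<open>Euler's criterion turns the power of d into its Legendre symbol, nonzero because p does
  not divide d. The exponent (p - 1) / 2 is even for p = 1 modulo 4, where the sign drops out, and
  odd for p = -1 modulo 4, where it remains; the two conditions on p say that the product is
  1.\<close>

lemma eps_hp_cong:
  assumes cond: "([p = 1] (mod 4) \<and>
         (\<forall>d. hall_divisor_of_group N \<Gamma> d \<longrightarrow> Legendre (int d) (int p) \<in> {0, 1}))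
      \<or> ([int p = -1] (mod 4) \<and>
         (\<forall>d. hall_divisor_of_group N \<Gamma> d \<longrightarrow>
            (\<forall>w\<in>AL_matrices N d. \<forall>r. r \<noteq> 0 \<and> r *\<^sub>R w \<in> \<Gamma> \<longrightarrow>
               chi (r *\<^sub>R w) * of_int (Legendre (int d) (int p)) \<in> {0, 1})))"
    and p2: "p > 2" and Q: "Q \<in> QQ" "p \<notin> Q"
  shows "[(eps Q * int (hp Q)) ^ ((p - 1) div 2) = 1] (mod int p)"
proof -
  define h where "h = (p - 1) div 2"
  have d: "hall_divisor_of_group N \<Gamma> (hp Q)" and Qs: "Q \<subseteq> prime_factors N" using Q(1) by (auto simp: QQ_def)
  have "\<not> [int (hp Q) = 0] (mod int p)" using prime_dvd_hp[OF Q(1) p] Q(2) by (simp add: cong_0_iff)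
  then have L0: "Legendre (int (hp Q)) (int p) \<noteq> 0" by (simp add: Legendre_def)
  have eu: "[Legendre (int (hp Q)) (int p) = int (hp Q) ^ h] (mod int p)"
    unfolding h_def using euler_criterion[of p "int (hp Q)"] p p2 by simp
  have "[eps Q ^ h * int (hp Q) ^ h = 1] (mod int p)"
    using cond
  proof (elim disjE conjE)
    assume p4: "[p = 1] (mod 4)" and *: "\<forall>d. hall_divisor_of_group N \<Gamma> d \<longrightarrow> Legendre (int d) (int p) \<in> {0, 1}"
    have "even h" using p4 unfolding h_def cong_def by presburger
    then have "eps Q ^ h = 1" by (simp add: eps_def)
    moreover have "Legendre (int (hp Q)) (int p) = 1" using * d L0 by blast
    ultimately show ?thesis using eu by (simp add: cong_sym_eq)
  next
    assume p4: "[int p = -1] (mod 4)" and *: "\<forall>d. hall_divisor_of_group N \<Gamma> d \<longrightarrow>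
            (\<forall>w\<in>AL_matrices N d. \<forall>r. r \<noteq> 0 \<and> r *\<^sub>R w \<in> \<Gamma> \<longrightarrow>
               chi (r *\<^sub>R w) * of_int (Legendre (int d) (int p)) \<in> {0, 1})"
    have "odd h" using p4 unfolding h_def cong_def by presburger
    then have e: "eps Q ^ h = eps Q" by (simp add: eps_def)
    obtain w r where w: "AL_pair Q w r" using Q(1) unfolding QQ_iff by blast
    have "of_int (eps Q) * of_int (Legendre (int (hp Q)) (int p)) \<in> {0, 1::complex}"
      unfolding eps_eq[OF Qs w] using * d w unfolding AL_pair_def by blast
    then have "of_int (eps Q * Legendre (int (hp Q)) (int p)) = (1 :: complex)"
      using L0 by (auto simp: eps_def split: if_splits)
    then have "eps Q * Legendre (int (hp Q)) (int p) = 1" by (simp only: of_int_eq_1_iff)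
    then show ?thesis using cong_mult[OF cong_refl[of "eps Q"] eu] by (simp add: e cong_sym_eq)
  qed
  then show ?thesis by (simp add: h_def power_mult_distrib)
qed

lemma lucas_all_cases:
  assumes cond: "p = 2 \<or> ([p = 1] (mod 4) \<and>
         (\<forall>d. hall_divisor_of_group N \<Gamma> d \<longrightarrow> Legendre (int d) (int p) \<in> {0, 1}))
      \<or> ([int p = -1] (mod 4) \<and>
         (\<forall>d. hall_divisor_of_group N \<Gamma> d \<longrightarrow>
            (\<forall>w\<in>AL_matrices N d. \<forall>r. r \<noteq> 0 \<and> r *\<^sub>R w \<in> \<Gamma> \<longrightarrow>
               chi (r *\<^sub>R w) * of_int (Legendre (int d) (int p)) \<in> {0, 1})))"
  shows "lucas_congruences p (\<lambda>n. \<phi> (T n))"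
proof (cases "p = 2")
  case True
  then show ?thesis by (rule lucas_2)
next
  case False
  then have p2: "p > 2" using prime_ge_2_nat[OF p] by simp
  have podd: "odd p" using p p2 prime_odd_nat by blast
  have eps: "[(eps Q * int (hp Q)) ^ ((p - 1) div 2) = 1] (mod int p)" if "Q \<in> QQ" "p \<notin> Q" for Q
    by (rule eps_hp_cong[OF _ p2 that]) (use cond False in blast)
  show ?thesis
  proof (cases "p = 3")
    case True
    show ?thesis
    \<comment> \<open>Weight 6 = (3 - 1) * 3, with constant term -1/504 and 504 divisible by 3. The
      congruence for exponent 1 is cubed.\<close>
    proof (rule lucas_odd[of 3 1 "-1" 504])
      show "eis_const (2 * 3) = of_int (-1) / of_int 504" by (simp add: eis_const_6)
      fix Q assume Q: "Q \<in> QQ" "p \<notin> Q"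
      have "[(eps Q * int (hp Q)) ^ 1 = 1] (mod int p)" using eps[OF Q] True by simp
      from cong_pow[OF this, of 3] show "[(eps Q * int (hp Q)) ^ 3 = 1] (mod int p)" by simp
    qed (use True podd in auto)
  next
    case F: False
    have "p \<noteq> 4" using podd by auto
    then have p5: "p \<ge> 5" using F p2 by simp
    obtain u v :: int where uv: "v \<noteq> 0" "int p dvd v" "\<not> int p dvd u" "eis_const (p - 1) = of_int u / of_int v"
      by (rule eis_const_p[OF p p5])
    have h: "2 * ((p - 1) div 2) = p - 1" using podd by simp
    show ?thesis
    \<comment> \<open>From p = 5 on the weight p - 1 is at least 4 and can be used directly, with j
      = 0.\<close>
    proof (rule lucas_odd[of "(p - 1) div 2" 0 u v])
      fix Q assume Q: "Q \<in> QQ" "p \<notin> Q"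
      show "[(eps Q * int (hp Q)) ^ ((p - 1) div 2) = 1] (mod int p)" by (rule eps[OF Q])
    qed (use h uv podd p5 in auto)
  qed
qed

end

end


theorem theorem1p3:
  fixes N p :: nat and S :: "nat set" and \<Gamma> :: "(real^2^2) set"
    and R :: "complex set"
    and t Z :: "complex \<Rightarrow> complex" and tq Zq :: "complex fps"
    and x0 :: "complex option"
    and \<mu> chi :: "real^2^2 \<Rightarrow> complex"
    and T :: "nat \<Rightarrow> complex"
    and \<phi> :: "complex \<Rightarrow> (nat \<Rightarrow> int)"
  assumes N: "N \<ge> 1"
    and S: "\<forall>e\<in>S. hall_divisor e N"
    and Gamma: "\<Gamma> = AL_extension N S"
    and genus: "genus_zero (modular_curve_topology \<Gamma>)"
    and R: "subring R (ring_of_type_algebra :: complex ring)"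
    and t_uniformizer: "uniformizer \<Gamma> t"
    and t_expansion: "has_q_expansion t tq"
    and t_coeffs: "fps_nth tq 0 = 0" "fps_nth tq 1 = 1" "\<forall>n\<ge>2. fps_nth tq n \<in> R"
    and x0: "x0 \<in> extended_half_plane"
    and t_zero: "\<forall>x\<in>extended_half_plane. order_at \<Gamma> 0 t x > 0 \<longleftrightarrow> x \<in> orbit_pt \<Gamma> None"
    and t_pole: "\<forall>x\<in>extended_half_plane. order_at \<Gamma> 0 t x < 0 \<longleftrightarrow> x \<in> orbit_pt \<Gamma> x0"
    and Z_form: "modular_form \<Gamma> 1 \<mu> Z"
    and Z_expansion: "has_q_expansion Z Zq"
    and Z_coeffs: "fps_nth Zq 0 = 1" "\<forall>n\<ge>1. fps_nth Zq n \<in> R"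
    and Z_zero: "\<forall>x\<in>extended_half_plane. order_at \<Gamma> 1 Z x > 0 \<longleftrightarrow> x \<in> orbit_pt \<Gamma> x0"
    and Z_order: "order_at \<Gamma> 1 Z x0 \<le> 1"
    and chi_quadratic: "quadratic_character \<Gamma> chi"
    and chi_trivial: "\<forall>A\<in>Gamma0 N. chi A = 1"
    and Z2_form: "modular_form \<Gamma> 2 chi (\<lambda>\<tau>. Z \<tau> ^ 2)"
    and T: "fps_compose (Abs_fps T) tq = Zq"
    and p: "Factorial_Ring.prime p"
    and embedding: "padic_embedding R p \<phi>"
    and p_cond: "p = 2
      \<or> ([p = 1] (mod 4) \<and>
         (\<forall>d. hall_divisor_of_group N \<Gamma> d \<longrightarrow> Legendre (int d) (int p) \<in> {0, 1}))
      \<or> ([int p = -1] (mod 4) \<and>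
         (\<forall>d. hall_divisor_of_group N \<Gamma> d \<longrightarrow>
            (\<forall>w\<in>AL_matrices N d. \<forall>r. r \<noteq> 0 \<and> r *\<^sub>R w \<in> \<Gamma> \<longrightarrow>
               chi (r *\<^sub>R w) * of_int (Legendre (int d) (int p)) \<in> {0, 1})))"
  shows "lucas_congruences p (\<lambda>n. \<phi> (T n))"
proof -
  have N0: "N > 0" using N by simp
  note props = AL_extension_props[OF N0 S Gamma]
  have tR: "fps_nth tq n \<in> R" for n
  proof -
    have "0 \<in> R" "1 \<in> R" using subringE(2,3)[OF R] by (simp_all add: ring_of_type_algebra_def)
    then show ?thesis using t_coeffs by (cases "n = 0 \<or> n = 1") auto
  qed
  have ZR: "fps_nth Zq n \<in> R" for n
    using Z_coeffs subringE(3)[OF R] by (cases "n = 0") (auto simp: ring_of_type_algebra_def)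
  interpret hauptmodul_setup \<Gamma> t Z tq Zq x0 \<mu>
  proof
    show "mat 1 \<in> \<Gamma>" using subgroup.one_closed[OF props(1)] by (simp add: GL2_plus_def)
    show "det A > 0" if "A \<in> \<Gamma>" for A using that props(2) by (auto simp: int_scaled_def)
    show "moebius_ext A x \<in> cusps" if "A \<in> \<Gamma>" "x \<in> cusps" for A x
      using that props(2) by (blast intro: int_scaled_cusp)
  qed (fact props(3) assms)+
  interpret atkin_lehner_setup \<Gamma> t Z tq Zq x0 \<mu> N S chi
    by unfold_locales (fact N0 assms)+
  show ?thesis
    by (rule lucas_all_cases[OF R p embedding tR t_coeffs(1) ZR T p_cond])
qed

end
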